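(* Let $\{a_k\}\subset\mathbb{C}$ be a sequence without finite limit points (each point may occur with finite multiplicity). Then $\{a_k\}$ is the zero set of some entire function $f$ of exponential type satisfying $$\int_{-\infty}^\infty\frac{\log^+|f(x)|}{1+x^2}\,dx<\infty$$ if and only if all of the following hold: (i) the limit $\lim_{R\to\infty}\sum_{0<|a_k|<R} a_k^{-1}$ exists; (ii) $n(0,t)=O(t)$ as $t\to\infty$; (iii) $n(0,t+1)-n(0,t)=o(t)$ as $t\to\infty$; (iv) for some point $b\in\mathbb{R}\setminus\{a_k\}$, $$\int_{-\infty}^\infty\left[\int_0^\infty [n(b,t)-n(x,t)]\,t^{-1}\,dt\right]^+\frac{dx}{1+x^2}<\infty .$$
   Context: For $c\in\mathbb{C}$ and $t\ge 0$, $n(c,t)=\mathrm{card}\{a_k:\,|a_k-c|\le t\}$, counted with multiplicity. A sequence $\{a_k\}$ is the zero set of an entire function $f$ if $f(a)\ne 0$ for $a\notin\{a_k\}$ and, for each $a$ occurring in $\{a_k\}$ with multiplicity $p$, $f(a)=f'(a)=\dots=f^{(p-1)}(a)=0$ and $f^{(p)}(a)\ne0$. An entire function $f$ is of exponential type if $|f(z)|\le Ae^{B|z|}$ for some constants $A,B$. $x^+=\max(x,0)$. *)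

theory Defs
  imports "HOL-Complex_Analysis.Complex_Analysis" "HOL-Library.Landau_Symbols"
begin

text \<open>A sequence {a_k} with multiplicities is encoded by its multiplicity function
  m :: complex => nat (m z = number of k with a_k = z).\<close>

definition no_finite_limit_points :: "(complex \<Rightarrow> nat) \<Rightarrow> bool" where
  "no_finite_limit_points m \<longleftrightarrow> (\<forall>z. \<not> z islimpt {w. m w \<noteq> 0})"

definition ncount :: "(complex \<Rightarrow> nat) \<Rightarrow> complex \<Rightarrow> real \<Rightarrow> nat" where
  "ncount m c t = (\<Sum>z\<in>{z. m z \<noteq> 0 \<and> cmod (z - c) \<le> t}. m z)"

definition is_zero_set :: "(complex \<Rightarrow> nat) \<Rightarrow> (complex \<Rightarrow> complex) \<Rightarrow> bool" where
  "is_zero_set m f \<longleftrightarrow>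
     (\<forall>a. (\<forall>j<m a. (deriv ^^ j) f a = 0) \<and> (deriv ^^ (m a)) f a \<noteq> 0)"

definition exponential_type :: "(complex \<Rightarrow> complex) \<Rightarrow> bool" where
  "exponential_type f \<longleftrightarrow> (\<exists>A B. \<forall>z. cmod (f z) \<le> A * exp (B * cmod z))"

definition inner_trunc :: "(complex \<Rightarrow> nat) \<Rightarrow> real \<Rightarrow> real \<Rightarrow> real \<Rightarrow> real" where
  "inner_trunc m b x T =
     (LINT t:{0<..T}|lborel. (real (ncount m (of_real b) t) - real (ncount m (of_real x) t)) / t)"

end

theory Submission
  imports Defs
begin

text \<open>Dividing by a power of \<open>z\<close>, assume \<open>f 0 \<noteq> 0\<close>. Let \<open>Q\<close> be holomorphic in the upper
  half-plane with \<open>Re Q\<close> the Poisson integral of \<open>log\<^sup>+ \<bar>f\<bar>\<close>. By Phragmen--Lindelof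
  \<open>G(z) = f(z) exp(- Q(z) + \<i> \<sigma> z)\<close> is bounded by 1 for a least \<open>\<sigma>\<close>. For such \<open>G\<close>, removing the
  zeros by Blaschke factors, Harnack's inequality bounds the mean of \<open>- log \<bar>G\<bar>\<close> over a circle by its
  value at any interior point. The least choice of \<open>\<sigma>\<close> provides interior points where
  \<open>- log \<bar>G(z)\<bar>\<close> is small compared to \<open>Im z\<close>, so \<open>log \<bar>f(r e\<^sup>i\<^sup>\<theta>)\<bar> / r\<close> is close to
  \<open>\<sigma> sin \<theta>\<close> in mean for some \<open>r\<close> in every interval \<open>[R, R e\<^sup>\<delta>]\<close> with \<open>R\<close> large; likewise in the
  lower half-plane.

  The Fourier coefficients of orders 0 and 1 of \<open>log \<bar>f\<bar>\<close> on circles (Jensen's formula and its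
  analogue), with a Tauberian argument to pass from good radii to all radii, give
  \<open>n(0,R) / R \<longrightarrow> D\<close>, \<open>R\<^sup>-\<^sup>2 \<Sum> cnj a\<^sub>k \<longrightarrow> 0\<close> over \<open>\<bar>a\<^sub>k\<bar> < R\<close>, and the convergence of
  \<open>\<Sum> 1 / a\<^sub>k\<close>. The Poisson--Jensen formula then shows that \<open>log \<bar>f x / f b\<bar>\<close> is the limit of the sums
  of \<open>log \<bar>(x - a\<^sub>k) / (b - a\<^sub>k)\<bar>\<close> over \<open>\<bar>a\<^sub>k\<bar> < R\<close>, which by (iii) is the inner integral in (iv).
  Conversely, (i) and (ii) make the products of \<open>1 - z / a\<^sub>k\<close> over \<open>\<bar>a\<^sub>k\<bar> < R\<close> converge to a
  function of exponential type, and the same identity turns (iv) into the logarithmic integral.\<close>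

section \<open>Blaschke products and the Jensen--Harnack inequality\<close>

text \<open>The obstacle is that log |f| is minus infinity at the zeros, which may lie anywhere, so
  no lower bound can hold on every circle; all estimates are for means, and only one good radius per
  short logarithmic interval is obtained. Such sparse information comes cheaply: one point where -
  log |G| is small compared to its height controls all larger scales, because a large disc tangent
  to the real axis carries the estimate upwards at a cost proportional to the scale. The order 1
  coefficient of the limit profile \<sigma> sin \<theta> is purely imaginary, since sin \<theta> cos
  \<theta> has integral 0 over (0, pi). This forces Re (L + f'(0) / f(0)) = 0, where L is the limit
  of \<Sum> 1 / a over the nonzero zeros, so log |f x / f b| contains no term linear in x - b. In
  the converse direction the product is formed without any factor exp (c z), and the same identity
  for log |f x / f b| serves both directions.\<close>

lemma circle_Cauchy:
  fixes h :: "complex \<Rightarrow> complex"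
  assumes "continuous_on (cball 0 r) h" "h holomorphic_on ball 0 r" "cmod w < r"
  shows "((\<lambda>t. h (r * cis t) * (r * cis t / (r * cis t - w))) has_integral (2 * pi * h w)) {0..2*pi}"
proof -
  have r: "r > 0" using assms(3) norm_ge_zero[of w] by linarith
  have "((\<lambda>u. h u / (u - w)) has_contour_integral (2 * of_real pi * \<i> * h w)) (part_circlepath 0 r 0 (2*pi))"
    using Cauchy_integral_circlepath[of 0 r h w] assms by (simp add: circlepath_def)
  then have "((\<lambda>t. h (0 + r * cis t) / (0 + r * cis t - w) * r * \<i> * cis t) has_integral (2 * of_real pi * \<i> * h w)) {0..2*pi}"
    by (subst (asm) has_contour_integral_part_circlepath_iff) auto
  then have "((\<lambda>t. (h (0 + r * cis t) / (0 + r * cis t - w) * r * \<i> * cis t) * (-\<i>)) has_integral (2 * of_real pi * \<i> * h w) * (-\<i>)) {0..2*pi}"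
    by (rule has_integral_mult_left)
  then show ?thesis
    by (simp add: algebra_simps)
qed

text \<open>Cauchy's formula for \<open>h\<close> is added to a conjugated copy of it. With \<zeta>
  = r e^{it} the kernel 2 \<zeta> / (\<zeta> - w) is 1 plus the Schwarz kernel (\<zeta> + w) /
  (\<zeta> - w), which is why the value is h(w) + conj h(0) and not h(w) - i Im h(0).\<close>

lemma circle_Schwarz:
  fixes h :: "complex \<Rightarrow> complex"
  assumes ch: "continuous_on (cball 0 r) h" and hh: "h holomorphic_on ball 0 r" and w: "cmod w < r"
  shows "((\<lambda>t. 2 * of_real (Re (h (r * cis t))) * (r * cis t / (r * cis t - w)))
           has_integral (2 * pi * (h w + cnj (h 0)))) {0..2*pi}"
proof -
  have r: "r > 0" using assms(3) norm_ge_zero[of w] by linarith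
  \<comment> \<open>The extra factor is 1 at the origin, has no pole in the closed disc, and on |z|
    = r its conjugate is z / (z - w). Conjugating Cauchy's formula for \<open>k\<close> at 0
    therefore produces the integral of \<open>cnj h\<close> against the wanted kernel.\<close>
  define k where "k z = h z * (r\<^sup>2 / (r\<^sup>2 - cnj w * z))" for z
  have nz: "r\<^sup>2 - cnj w * z \<noteq> 0" if "z \<in> cball 0 r" for z
  proof
    assume "r\<^sup>2 - cnj w * z = 0"
    then have "cmod (of_real (r\<^sup>2)) = cmod (cnj w * z)" by simp
    then have "r\<^sup>2 = cmod w * cmod z" by (simp add: norm_mult norm_power)
    also have "\<dots> \<le> cmod w * r" using that by (simp add: mult_left_mono)
    also have "\<dots> < r * r" using w r by simp
    finally show False by (simp add: power2_eq_square)
  qed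
  have "continuous_on (cball 0 r) k" unfolding k_def
    using nz by (intro continuous_intros ch) auto
  moreover have "k holomorphic_on ball 0 r" unfolding k_def
    using nz by (intro holomorphic_intros hh) auto
  ultimately have "((\<lambda>t. k (r * cis t) * (r * cis t / (r * cis t - 0))) has_integral (2 * pi * k 0)) {0..2*pi}"
    by (rule circle_Cauchy) (use r in auto)
  then have "((\<lambda>t. cnj (k (r * cis t) * (r * cis t / (r * cis t - 0)))) has_integral cnj (2 * pi * k 0)) {0..2*pi}"
    using has_integral_linear[OF _ bounded_linear_cnj] unfolding o_def by blast
  moreover have "cnj (k (r * cis t) * (r * cis t / (r * cis t - 0))) = cnj (h (r * cis t)) * (r * cis t / (r * cis t - w))" for t
  proof -
    have 1: "r * cis t \<noteq> 0" using r by simp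
    have 2: "r * cis t - w \<noteq> 0" using w r by (metis abs_of_pos eq_iff_diff_eq_0 less_irrefl norm_cis norm_mult norm_of_real mult.right_neutral)
    have 3: "r\<^sup>2 - w * cnj (r * cis t) \<noteq> 0"
    proof -
      have "r * cis t \<in> cball 0 r" using r by (simp add: norm_mult)
      from nz[OF this] have "cnj (r\<^sup>2 - cnj w * (r * cis t)) \<noteq> 0" unfolding complex_cnj_zero_iff .
      then show ?thesis by simp
    qed
    have "of_real (r\<^sup>2) * (r * cis t - w) = (r\<^sup>2 - w * cnj (r * cis t)) * (r * cis t)"
      by (simp add: algebra_simps cis_cnj power2_eq_square cis_mult)
    then have eq: "of_real (r\<^sup>2) / (of_real (r\<^sup>2) - w * cnj (r * cis t)) = r * cis t / (r * cis t - w)"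
      using 2 3 by (simp add: frac_eq_eq mult.commute)
    have "k (r * cis t) * (r * cis t / (r * cis t - 0)) = h (r * cis t) * (of_real (r\<^sup>2) / (of_real (r\<^sup>2) - cnj w * (r * cis t)))"
      using 1 r by (simp add: k_def)
    then show ?thesis
      by (simp only: complex_cnj_mult complex_cnj_divide complex_cnj_diff complex_cnj_cnj complex_cnj_complex_of_real eq[unfolded complex_cnj_mult complex_cnj_complex_of_real])
  qed
  moreover have "k 0 = h 0" using r by (simp add: k_def)
  ultimately have "((\<lambda>t. cnj (h (r * cis t)) * (r * cis t / (r * cis t - w))) has_integral (2 * pi * cnj (h 0))) {0..2*pi}"
    by simp
  from has_integral_add[OF circle_Cauchy[OF ch hh w] this]
  have *: "((\<lambda>t. h (r * cis t) * (r * cis t / (r * cis t - w)) + cnj (h (r * cis t)) * (r * cis t / (r * cis t - w)))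
     has_integral (2 * pi * h w + 2 * pi * cnj (h 0))) {0..2*pi}" .
  have eq: "h z * q + cnj (h z) * q = 2 * of_real (Re (h z)) * q" for z q
    by (metis complex_add_cnj distrib_right of_real_mult of_real_numeral)
  show ?thesis using * unfolding eq by (simp add: algebra_simps)
qed

text \<open>On the circle the Poisson kernel (r^2 - |w|^2) / |z - w|^2 is at least (r - |w|) / (r +
  |w|); multiplied by the nonpositive boundary values of \<open>Re h\<close> this becomes an upper
  bound. The denominator is cleared in the statement.\<close>

lemma Harnack_upper:
  fixes h :: "complex \<Rightarrow> complex"
  assumes ch: "continuous_on (cball 0 r) h" and hh: "h holomorphic_on ball 0 r" and w: "cmod w < r"
    and neg: "\<And>t. Re (h (r * cis t)) \<le> 0"
  shows "2 * pi * Re (h w) * (r + cmod w) \<le> (r - cmod w) * integral {0..2*pi} (\<lambda>t. Re (h (r * cis t)))"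
proof -
  have r: "r > 0" using assms(3) norm_ge_zero[of w] by linarith
  define u where "u t = Re (h (r * cis t))" for t
  have S: "((\<lambda>t. Re (2 * of_real (u t) * (r * cis t / (r * cis t - w)))) has_integral Re (2 * pi * (h w + cnj (h 0)))) {0..2*pi}" 
    using has_integral_linear[OF circle_Schwarz[OF ch hh w] bounded_linear_Re] by (simp add: u_def o_def)
  have "((\<lambda>t. Re (h (r * cis t) * (r * cis t / (r * cis t - 0)))) has_integral Re (2 * pi * h 0)) {0..2*pi}"
    using has_integral_linear[OF circle_Cauchy[OF ch hh, of 0] bounded_linear_Re] r by (simp add: o_def)
  then have M: "(u has_integral 2 * pi * Re (h 0)) {0..2*pi}"
    using r by (simp add: u_def[abs_def])
  \<comment> \<open>Subtracting the mean removes h(0) and turns the kernel 2 Re (z / (z - w)) into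
    the Poisson kernel 2 Re (z / (z - w)) - 1.\<close>
  have D: "((\<lambda>t. Re (2 * of_real (u t) * (r * cis t / (r * cis t - w))) - u t) has_integral 2 * pi * Re (h w)) {0..2*pi}"
    using has_integral_diff[OF S M] by (simp add: algebra_simps)
  have le: "Re (2 * of_real (u t) * (r * cis t / (r * cis t - w))) - u t \<le> (r - cmod w) / (r + cmod w) * u t" for t
  proof -
    define z where "z = r * cis t"
    have z: "cmod z = r" using r by (simp add: z_def norm_mult)
    have zw: "z \<noteq> w" using z w by auto
    have "2 * Re (z / (z - w)) - 1 = ((cmod z)\<^sup>2 - (cmod w)\<^sup>2) / (cmod (z - w))\<^sup>2"
    proof -
      have "2 * Re (z / (z - w)) - 1 = Re ((z + w) / (z - w))"
      proof -
        have "2 * (z / (z - w)) - 1 = (z + w) / (z - w)" using zw by (simp add: divide_simps)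
        moreover have "Re (2 * (z / (z - w)) - 1) = 2 * Re (z / (z - w)) - 1" by (simp del: times_divide_eq_right)
        ultimately show ?thesis by metis
      qed
      also have "\<dots> = ((cmod z)\<^sup>2 - (cmod w)\<^sup>2) / (cmod (z - w))\<^sup>2"
        by (simp only: cmod_power2) (simp add: Re_divide power2_eq_square algebra_simps)
      finally show ?thesis .
    qed
    also have "\<dots> \<ge> (r - cmod w) / (r + cmod w)"
    proof -
      have n: "cmod (z - w) \<le> r + cmod w" using norm_triangle_ineq4[of z w] z by simp
      have p: "cmod (z - w) > 0" using zw by simp
      have "(r - cmod w) / (r + cmod w) = (r\<^sup>2 - (cmod w)\<^sup>2) / (r + cmod w)\<^sup>2"
        using r by (simp add: divide_simps power2_eq_square) (simp add: algebra_simps)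
      also have "\<dots> \<le> (r\<^sup>2 - (cmod w)\<^sup>2) / (cmod (z - w))\<^sup>2"
        using w n p r by (intro divide_left_mono) (auto intro!: power_mono mult_pos_pos)
      finally show ?thesis using z by simp
    qed
    finally have k: "(r - cmod w) / (r + cmod w) \<le> 2 * Re (z / (z - w)) - 1" .
    have "u t * (2 * Re (z / (z - w)) - 1) \<le> u t * ((r - cmod w) / (r + cmod w))"
      using neg[of t] k by (intro mult_left_mono_neg) (auto simp: u_def)
    moreover have "Re (2 * of_real (u t) * (z / (z - w))) = 2 * u t * Re (z / (z - w))"
    proof -
      have "2 * of_real (u t) * (z / (z - w)) = of_real (2 * u t) * (z / (z - w))" by simp
      then show ?thesis by (simp only: Re_complex_of_real times_complex.sel Im_complex_of_real mult_zero_left diff_zero)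
    qed
    ultimately show ?thesis unfolding z_def by (simp add: algebra_simps)
  qed
  have "2 * pi * Re (h w) \<le> (r - cmod w) / (r + cmod w) * (2 * pi * Re (h 0))"
    using has_integral_le[OF D has_integral_mult_right[OF M]] le by blast
  then have "2 * pi * Re (h w) * (r + cmod w) \<le> (r - cmod w) * (2 * pi * Re (h 0))"
    using r by (simp add: pos_le_divide_eq add_pos_nonneg) 
  also have "2 * pi * Re (h 0) = integral {0..2*pi} u" using M by (simp add: integral_unique)
  finally show ?thesis by (simp add: u_def[abs_def])
qed

definition Blaschke :: "real \<Rightarrow> complex \<Rightarrow> complex \<Rightarrow> complex" where
  "Blaschke r a z = of_real r * (z - a) / (of_real (r\<^sup>2) - cnj a * z)"

lemma Blaschke_sphere:
  assumes "cmod z = r" "cmod a < r"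
  shows "cmod (Blaschke r a z) = 1"
proof -
  have r: "r > 0" using assms by (smt (verit) norm_ge_zero)
  have "of_real (r\<^sup>2) = z * cnj z" using assms(1) by (metis complex_norm_square of_real_power)
  then have "of_real (r\<^sup>2) - cnj a * z = z * cnj (z - a)" by (simp add: algebra_simps)
  then have "cmod (of_real (r\<^sup>2) - cnj a * z) = r * cmod (z - a)" using assms by (metis norm_mult complex_mod_cnj)
  moreover have "z \<noteq> a" using assms by auto
  ultimately show ?thesis using r by (simp add: Blaschke_def norm_divide norm_mult)
qed

lemma Blaschke_ball:
  assumes "cmod z \<le> r" "cmod a < r"
  shows "cmod (Blaschke r a z) \<le> 1"
proof -
  have r: "r > 0" using assms(2) by (smt (verit) norm_ge_zero)
  have "(cmod (of_real (r\<^sup>2) - cnj a * z))\<^sup>2 - (cmod (r * (z - a)))\<^sup>2 = (r\<^sup>2 - (cmod a)\<^sup>2) * (r\<^sup>2 - (cmod z)\<^sup>2)"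
    unfolding cmod_power2 by (simp add: cmod_power2 power2_eq_square algebra_simps)
  also have "\<dots> \<ge> 0" using assms r by (intro mult_nonneg_nonneg) (auto intro!: power_mono)
  finally have "(cmod (r * (z - a)))\<^sup>2 \<le> (cmod (of_real (r\<^sup>2) - cnj a * z))\<^sup>2" by linarith
  then have "cmod (r * (z - a)) \<le> cmod (of_real (r\<^sup>2) - cnj a * z)"
    by (rule power2_le_imp_le) (rule norm_ge_zero)
  then show ?thesis by (simp add: Blaschke_def norm_divide divide_le_eq_1)
qed

text \<open>The zero-free factor exp h lives on a disc of radius \<open>r'\<close> > r, so that
  \<open>h\<close> is continuous up to the circle on which its boundary values are taken.\<close>

lemma Blaschke_factorization:
  assumes f: "f holomorphic_on ball 0 R" and r: "0 < r" "r < R" and nz: "\<And>z. cmod z = r \<Longrightarrow> f z \<noteq> 0"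
  obtains h r' where "r < r'" "r' \<le> R" "h holomorphic_on ball 0 r'" "finite {a \<in> ball 0 r. f a = 0}"
    "\<And>z::complex. z \<in> ball 0 r' \<Longrightarrow> f z = (\<Prod>a\<in>{a \<in> ball 0 r. f a = 0}. Blaschke r a z ^ nat (zorder f a)) * exp (h z)"
proof -
  define Z where "Z = {a \<in> ball 0 r. f a = 0}"
  have ne: "\<not> f constant_on ball 0 R \<or> (\<forall>z\<in>ball 0 R. f z \<noteq> 0)"
  proof -
    have "of_real r \<in> ball (0::complex) R" "f (of_real r) \<noteq> 0" using r nz[of "of_real r"] by auto
    then show ?thesis unfolding constant_on_def by metis
  qed
  define R1 where "R1 = (r + R) / 2"
  have R1: "r < R1" "R1 < R" using r by (auto simp: R1_def)
  have fin1: "finite {z \<in> cball 0 R1. f z = 0}"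
  proof (cases "\<forall>z\<in>ball 0 R. f z \<noteq> 0")
    case True
    then have "{z \<in> cball 0 R1. f z = 0} = {}" using R1 by auto
    then show ?thesis by (metis finite.emptyI)
  next
    case False
    then have "\<not> f constant_on ball 0 R" using ne by blast
    then show ?thesis
      using R1 by (intro holomorphic_compact_finite_zeros[OF f]) auto
  qed
  have finZ: "finite Z" by (rule finite_subset[OF _ fin1]) (use R1 in \<open>auto simp: Z_def\<close>)
  \<comment> \<open>Every modulus that \<open>r'\<close> must not exceed: those of the zeros outside
    the circle, the moduli r^2 / |a| of the poles of the Blaschke factors, and \<open>R1\<close>.
    Elements that impose no restriction are replaced by \<open>R1\<close>.\<close>
  define X where "X = (\<lambda>a. if cmod a > r then cmod a else R1) ` {z \<in> cball 0 R1. f z = 0} \<union> (\<lambda>a. if a = 0 then R1 else r\<^sup>2 / cmod a) ` Z \<union> {R1}"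
  have finX: "finite X" using fin1 finZ by (auto simp: X_def)
  define r' where "r' = Min X"
  have X_gt: "x > r" if "x \<in> X" for x
  proof -
    have "r\<^sup>2 / cmod a > r" if "a \<in> Z" "a \<noteq> 0" for a
      using that r by (simp add: Z_def power2_eq_square pos_less_divide_eq)
    then show ?thesis using that R1 r unfolding X_def by auto
  qed
  have "X \<noteq> {}" by (simp add: X_def)
  then have r': "r < r'" using Min_in[OF finX] X_gt unfolding r'_def by blast
  have r'R1: "r' \<le> R1" unfolding r'_def using finX by (intro Min_le) (auto simp: X_def)
  have zZ: "z \<in> Z" if "z \<in> ball 0 r'" "f z = 0" for z
  proof (rule ccontr)
    assume "z \<notin> Z"
    then have "cmod z > r" using that nz unfolding Z_def by force
    then have "cmod z \<in> X" unfolding X_def using that r'R1 by force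
    then have "r' \<le> cmod z" unfolding r'_def using finX by simp
    then show False using that by simp
  qed
  have dnz: "of_real (r\<^sup>2) - cnj a * z \<noteq> 0" if "a \<in> Z" "z \<in> ball 0 r'" for a z
  proof
    assume "of_real (r\<^sup>2) - cnj a * z = 0"
    then have "cmod (of_real (r\<^sup>2)) = cmod (cnj a * z)" by simp
    then have eq: "r\<^sup>2 = cmod a * cmod z" by (simp add: norm_mult norm_power)
    then have a0: "a \<noteq> 0" using r by auto
    then have "r\<^sup>2 / cmod a \<in> X" using that unfolding X_def by auto
    then have "r' \<le> r\<^sup>2 / cmod a" unfolding r'_def using finX by simp
    then show False using that eq a0 by simp
  qed
  have Zsub: "Z \<subseteq> ball 0 r'" using r' by (auto simp: Z_def)
  have fr': "f holomorphic_on ball 0 r'" by (rule holomorphic_on_subset[OF f]) (use r'R1 R1 in auto)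
  have ex: "\<exists>w\<in>ball 0 r'. f w \<noteq> 0" using r' r nz[of "of_real r"] by (intro bexI[of _ "of_real r"]) auto
  have ord: "if f p = 0 then zorder f p > 0 else zorder f p = 0" if "p \<in> ball 0 r'" for p
    using zorder_exist_zero[OF fr' open_ball connected_ball that ex] by blast
  define Q where "Q z = (\<Prod>a\<in>Z. (z - a) ^ nat (zorder f a))" for z
  have Qhol: "Q holomorphic_on A" for A unfolding Q_def by (intro holomorphic_intros)
  have Q0: "Q z = 0 \<longleftrightarrow> f z = 0" if "z \<in> ball 0 r'" for z
    using finZ zZ that ord Zsub unfolding Q_def
    by (auto simp: prod_zero_iff Z_def split: if_splits)
  have Qord: "zorder Q p = zorder f p" if p: "p \<in> ball 0 r'" for p
  proof (cases "f p = 0")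
    case True
    then have pZ: "p \<in> Z" using zZ p by blast
    have "zorder f p > 0" using ord[OF p] True by simp
    moreover have "Q w = (\<Prod>a\<in>Z-{p}. (w - a) ^ nat (zorder f a)) * (w - p) ^ nat (zorder f p)" for w
      unfolding Q_def using prod.remove[OF finZ pZ, of "\<lambda>a. (w - a) ^ nat (zorder f a)"] by (simp add: mult.commute)
    ultimately show ?thesis using finZ
      by (intro zorder_eqI[where S = UNIV and g = "\<lambda>w. \<Prod>a\<in>Z-{p}. (w - a) ^ nat (zorder f a)"])
         (auto intro!: holomorphic_intros simp: power_int_def)
  next
    case False
    then have "zorder f p = 0" using ord[OF p] by simp
    moreover have "Q p \<noteq> 0" using Q0[OF p] False by simp
    ultimately show ?thesis
      by (intro zorder_eqI[where S = UNIV and g = Q]) (auto intro: Qhol)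
  qed
  obtain H where H: "H holomorphic_on ball 0 r'" "\<And>z. z \<in> ball 0 r' \<Longrightarrow> H z \<noteq> 0" "\<And>z. z \<in> ball 0 r' \<Longrightarrow> f z = H z * Q z"
    by (rule holomorphic_zorder_factorization[OF fr' open_ball connected_ball Qhol Q0 Qord]) auto
  \<comment> \<open>\<open>E\<close> is f divided by the Blaschke product: the factors (r^2 - conj a
    z) / r compensate for replacing z - a by a Blaschke factor. Being zero-free on a ball, it has a
    holomorphic logarithm.\<close>
  define E where "E z = H z * (\<Prod>a\<in>Z. ((of_real (r\<^sup>2) - cnj a * z) / r) ^ nat (zorder f a))" for z
  have "E holomorphic_on ball 0 r'" unfolding E_def using r by (intro holomorphic_intros H) auto
  moreover have "E z \<noteq> 0" if "z \<in> ball 0 r'" for z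
    using that dnz finZ r H(2) unfolding E_def by (auto simp: prod_zero_iff)
  moreover have "0 \<in> ball (0::complex) r'" using r r' by simp
  ultimately obtain h where h: "h holomorphic_on ball 0 r'" "\<And>z. z \<in> ball 0 r' \<Longrightarrow> exp (h z) = E z"
    using holomorphic_logarithm_exists[OF convex_ball open_ball] by metis
  have "f z = (\<Prod>a\<in>Z. Blaschke r a z ^ nat (zorder f a)) * exp (h z)" if z: "z \<in> ball 0 r'" for z
  proof -
    have "(\<Prod>a\<in>Z. Blaschke r a z ^ nat (zorder f a)) * (\<Prod>a\<in>Z. ((of_real (r\<^sup>2) - cnj a * z) / r) ^ nat (zorder f a)) = Q z"
      unfolding Q_def prod.distrib[symmetric] power_mult_distrib[symmetric]
      using dnz[OF _ z] r by (intro prod.cong) (auto simp: Blaschke_def)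
    then show ?thesis using H(3)[OF z] h(2)[OF z] by (simp add: E_def algebra_simps)
  qed
  note fac = this
  show thesis
  proof (rule that[of r' h])
    show "r' \<le> R" using r'R1 R1 by simp
    show "finite {a \<in> ball 0 r. f a = 0}" using finZ by (simp add: Z_def)
    show "f z = (\<Prod>a\<in>{a \<in> ball 0 r. f a = 0}. Blaschke r a z ^ nat (zorder f a)) * exp (h z)" if "z \<in> ball 0 r'" for z
      using fac[OF that] unfolding Z_def .
  qed (use r' h(1) in auto)
qed

text \<open>|f| equals exp (Re h) on the circle and is at most exp (Re h) inside, so dividing out
  the zeros costs nothing on the circle and goes in the favourable direction at w. In terms of - ln
  |f|: the circle mean is at most (r + |w|) / (r - |w|) times the value at w.\<close>

lemma Jensen_Harnack:
  assumes f: "f holomorphic_on ball 0 R" and r: "r < R" and nz: "\<And>z. cmod z = r \<Longrightarrow> f z \<noteq> 0"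
    and le1: "\<And>z. cmod z = r \<Longrightarrow> cmod (f z) \<le> 1" and w: "cmod w < r" "f w \<noteq> 0"
  shows "2 * pi * ln (cmod (f w)) * (r + cmod w) \<le> (r - cmod w) * integral {0..2*pi} (\<lambda>t. ln (cmod (f (r * cis t))))"
proof -
  have r0: "r > 0" using w norm_ge_zero[of w] by linarith
  obtain h r' where h: "r < r'" "r' \<le> R" "h holomorphic_on ball 0 r'" "finite {a \<in> ball 0 r. f a = 0}"
    and F: "\<And>z::complex. z \<in> ball 0 r' \<Longrightarrow> f z = (\<Prod>a\<in>{a \<in> ball 0 r. f a = 0}. Blaschke r a z ^ nat (zorder f a)) * exp (h z)"
  proof (rule Blaschke_factorization[OF f r0 r])
    show "f z \<noteq> 0" if "cmod z = r" for z using nz[OF that] .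
  qed (rule that)
  define Z where "Z = {a \<in> ball 0 r. f a = 0}"
  have sph: "ln (cmod (f z)) = Re (h z)" if "cmod z = r" for z
  proof -
    have "cmod (\<Prod>a\<in>Z. Blaschke r a z ^ nat (zorder f a)) = 1"
      unfolding prod_norm[symmetric] norm_power
      using Blaschke_sphere[OF that] by (intro prod.neutral) (auto simp: Z_def)
    then have "cmod (f z) = exp (Re (h z))"
      using F[of z] that h(1) unfolding Z_def[symmetric] by (simp add: norm_mult)
    then show ?thesis by simp
  qed
  have "cmod (\<Prod>a\<in>Z. Blaschke r a w ^ nat (zorder f a)) \<le> 1"
    unfolding prod_norm[symmetric] norm_power
    using Blaschke_ball[of w r] w by (intro prod_le_1) (auto simp: Z_def intro!: power_le_one)
  then have "cmod (f w) \<le> exp (Re (h w))"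
    using F[of w] w h(1) unfolding Z_def[symmetric] by (simp add: norm_mult mult_left_le_one_le)
  then have lw: "ln (cmod (f w)) \<le> Re (h w)"
    using w by (metis ln_exp ln_le_cancel_iff exp_gt_zero zero_less_norm_iff)
  have "2 * pi * Re (h w) * (r + cmod w) \<le> (r - cmod w) * integral {0..2*pi} (\<lambda>t. Re (h (r * cis t)))"
  proof (rule Harnack_upper)
    show "continuous_on (cball 0 r) h" 
      by (rule holomorphic_on_imp_continuous_on[OF holomorphic_on_subset[OF h(3)]]) (use h in auto)
    show "h holomorphic_on ball 0 r" by (rule holomorphic_on_subset[OF h(3)]) (use h in auto)
    show "Re (h (r * cis t)) \<le> 0" for t
    proof -
      have c: "cmod (r * cis t) = r" using r0 by (simp add: norm_mult)
      show ?thesis using sph[OF c] le1[OF c] nz[OF c] by (metis ln_le_zero_iff zero_less_norm_iff)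
    qed
  qed (use w in auto)
  also have "(\<lambda>t. Re (h (r * cis t))) = (\<lambda>t. ln (cmod (f (r * cis t))))"
  proof
    fix t
    have c: "cmod (r * cis t) = r" using r0 by (simp add: norm_mult)
    show "Re (h (r * cis t)) = ln (cmod (f (r * cis t)))" using sph[OF c] by simp
  qed
  finally have *: "2 * pi * Re (h w) * (r + cmod w) \<le> (r - cmod w) * integral {0..2*pi} (\<lambda>t. ln (cmod (f (r * cis t))))" .
  have "2 * pi * ln (cmod (f w)) * (r + cmod w) \<le> 2 * pi * Re (h w) * (r + cmod w)"
    using lw r0 by (intro mult_right_mono mult_left_mono) auto
  then show ?thesis using * by linarith
qed

section \<open>Means of negative logarithms over circles that touch the boundary\<close>

text \<open>The value \<open>top\<close> at 0 makes this continuous from the plane to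
  \<open>ennreal\<close>, so boundary limits and Fatou's lemma need no special treatment of zeros.
  It is meant for functions bounded by 1; where |g| > 1 the truncation of \<open>ennreal\<close>
  gives 0.\<close>

definition neglog :: "complex \<Rightarrow> ennreal" where
  "neglog g = (if g = 0 then top else ennreal (- ln (cmod g)))"

lemma tendsto_neglog:
  assumes "(f \<longlongrightarrow> g) F"
  shows "((\<lambda>x. neglog (f x)) \<longlongrightarrow> neglog g) F"
proof (cases "g = 0")
  case False
  have "((\<lambda>x. ennreal (- ln (cmod (f x)))) \<longlongrightarrow> ennreal (- ln (cmod g))) F"
    using False by (intro tendsto_ennrealI tendsto_intros assms) auto
  moreover have "\<forall>\<^sub>F x in F. f x \<noteq> 0"
    using tendsto_imp_eventually_ne[OF assms False] .
  ultimately show ?thesis using False unfolding neglog_def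
    by (simp, elim Lim_transform_eventually) (auto elim: eventually_mono)
next
  case True
  have "\<forall>\<^sub>F x in F. ennreal l < neglog (f x)" if "l \<ge> 0" for l
  proof -
    have "\<forall>\<^sub>F x in F. cmod (f x) < exp (- l)"
      using assms True tendsto_norm_zero order_tendstoD(2) by fastforce
    then show ?thesis
    proof eventually_elim
      case (elim x)
      show ?case
      proof (cases "f x = 0")
        case False
        then have "ln (cmod (f x)) < - l" using elim by (metis ln_exp ln_less_cancel_iff exp_gt_zero zero_less_norm_iff)
        then show ?thesis using False that by (simp add: neglog_def ennreal_less_iff)
      qed (simp add: neglog_def)
    qed
  qed
  then show ?thesis using True by (simp add: neglog_def tendsto_top_iff_ennreal)
qed

lemma continuous_on_neglog: "continuous_on A neglog"
  unfolding continuous_on_def by (auto intro!: tendsto_neglog tendsto_ident_at)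

lemma measurable_neglog [measurable]: "neglog \<in> borel_measurable borel"
  by (rule borel_measurable_continuous_onI[OF continuous_on_neglog])

lemma neglog_1 [simp]: "neglog 1 = 0"
  by (simp add: neglog_def)

text \<open>Serves to show that a holomorphic function has countably many zeros in an open ball,
  hence that only countably many concentric circles meet a zero.\<close>

lemma fsigma_ball: "fsigma (ball (c::complex) T)"
proof -
  have "ball c T = (\<Union>n. cball c (T - 1 / real (Suc n)))" (is "_ = ?U")
  proof (intro equalityI subsetI)
    fix z assume "z \<in> ball c T"
    then have "T - dist c z > 0" by simp
    then obtain n where "1 / real (Suc n) < T - dist c z" using nat_approx_posE by blast
    then have "z \<in> cball c (T - 1 / real (Suc n))" by simp
    then show "z \<in> ?U" by blast
  next
    fix z assume "z \<in> ?U"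
    then obtain n where "dist c z \<le> T - 1 / real (Suc n)" by auto
    moreover have "1 / real (Suc n) > 0" by simp
    ultimately show "z \<in> ball c T" unfolding mem_ball by linarith
  qed
  then show ?thesis using fsigma.intros[of "\<lambda>n. cball c (T - 1 / real (Suc n))"] by simp
qed

lemma exists_real_not_in_countable:
  fixes a b :: real
  assumes "countable C" "a < b"
  shows "\<exists>x. a < x \<and> x < b \<and> x \<notin> C"
proof (rule ccontr)
  assume "\<not> ?thesis"
  then have "{a<..<b} \<subseteq> C" by auto
  then have "countable {a<..<b}" using assms(1) by (rule countable_subset)
  then show False using assms(2) uncountable_open_interval by blast
qed

lemma circle_neglog_le_interior:
  assumes G: "G holomorphic_on ball c T" and le: "\<And>z. z \<in> ball c T \<Longrightarrow> cmod (G z) \<le> 1"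
    and z0: "z0 \<in> ball c T" "G z0 \<noteq> 0" and r: "dist c z0 < r" "r < T" and nz: "\<And>z. dist c z = r \<Longrightarrow> G z \<noteq> 0"
  shows "(\<integral>\<^sup>+t. neglog (G (c - r * cis t)) * indicator {0..2*pi} t \<partial>lborel)
          \<le> ennreal (2 * pi * (r + dist c z0) / (r - dist c z0) * (- ln (cmod (G z0))))"
proof -
  define F where "F z = G (c - z)" for z
  have r0: "r > 0" using r zero_le_dist[of c z0] by linarith
  have F: "F holomorphic_on ball 0 T" unfolding F_def
    by (rule holomorphic_on_compose_gen[OF _ G, of _ "ball 0 T", unfolded o_def])
       (auto intro!: holomorphic_intros simp: dist_norm)
  have cis: "cmod (of_real r * cis t) = r" for t using r0 by (simp add: norm_mult)
  have FJ: "2 * pi * ln (cmod (F (c - z0))) * (r + cmod (c - z0)) \<le> (r - cmod (c - z0)) * integral {0..2*pi} (\<lambda>t. ln (cmod (F (r * cis t))))"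
  proof (rule Jensen_Harnack[OF F r(2)])
    show "F z \<noteq> 0" if "cmod z = r" for z using nz[of "c - z"] that by (simp add: F_def dist_norm)
    show "cmod (F z) \<le> 1" if "cmod z = r" for z using le[of "c - z"] that r by (simp add: F_def dist_norm)
  qed (use r z0 in \<open>auto simp: F_def dist_norm\<close>)
  have nzF: "F (r * cis t) \<noteq> 0" for t using nz[of "c - r * cis t"] cis[of t] by (simp add: F_def dist_norm)
  have cont: "continuous_on {0..2*pi} (\<lambda>t. - ln (cmod (F (r * cis t))))"
  proof -
    have "continuous_on {0..2*pi} (\<lambda>t. F (r * cis t))"
      by (rule continuous_on_compose2[OF holomorphic_on_imp_continuous_on[OF F]])
         (use r r0 in \<open>auto intro!: continuous_intros simp: norm_mult\<close>)
    then show ?thesis using nzF by (intro continuous_intros) auto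
  qed
  have "(\<integral>\<^sup>+t. ennreal (- ln (cmod (F (r * cis t)))) * indicator {0..2*pi} t \<partial>lborel) = ennreal (integral {0..2*pi} (\<lambda>t. - ln (cmod (F (r * cis t)))))"
  proof (rule nn_integral_has_integral_lebesgue')
    show "0 \<le> - ln (cmod (F (r * cis t)))" for t
      using le[of "c - r * cis t"] nzF[of t] cis[of t] r by (simp add: F_def dist_norm)
    show "((\<lambda>t. - ln (cmod (F (r * cis t)))) has_integral integral {0..2*pi} (\<lambda>t. - ln (cmod (F (r * cis t))))) {0..2*pi}"
      by (rule integrable_integral) (rule integrable_continuous_real[OF cont])
  qed
  also have "ennreal (integral {0..2*pi} (\<lambda>t. - ln (cmod (F (r * cis t))))) \<le> ennreal ( 2 * pi * (r + dist c z0) / (r - dist c z0) * (- ln (cmod (G z0))))"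
    using FJ r by (intro ennreal_leI) (simp add: F_def dist_norm field_simps)
  finally have "(\<integral>\<^sup>+t. ennreal (- ln (cmod (F (r * cis t)))) * indicator {0..2*pi} t \<partial>lborel) \<le> ennreal (2 * pi * (r + dist c z0) / (r - dist c z0) * (- ln (cmod (G z0))))" .
  moreover have "neglog (G (c - r * cis t)) = ennreal (- ln (cmod (F (r * cis t))))" for t
    using nzF[of t] by (simp add: neglog_def F_def)
  ultimately show ?thesis by simp
qed

text \<open>The circle of radius T may leave \<open>S\<close>, so only its points in
  \<open>S\<close> are counted. Radii increasing to T that avoid the countably many moduli of zeros
  reduce this to the interior case. Fatou's lemma passes to the limit, for which pointwise
  convergence at the points of \<open>S\<close> is enough.\<close>

lemma circle_neglog_le:
  assumes S: "open S" "ball c T \<subseteq> S" and G: "G holomorphic_on S" and le: "\<And>z. z \<in> S \<Longrightarrow> cmod (G z) \<le> 1"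
    and z0: "dist c z0 < T"
  shows "(\<integral>\<^sup>+t. neglog (G (c - T * cis t)) * indicator ({t. c - T * cis t \<in> S} \<inter> {0..2*pi}) t \<partial>lborel)
          \<le> ennreal (2 * pi * (T + dist c z0) / (T - dist c z0)) * neglog (G z0)"
proof (cases "G z0 = 0")
  case True
  have "T > 0" using z0 zero_le_dist[of c z0] by linarith
  then have "0 < 2 * pi * (T + dist c z0) / (T - dist c z0)"
    using z0 zero_le_dist[of c z0] \<open>T > 0\<close> by (intro divide_pos_pos mult_pos_pos add_pos_nonneg) auto
  then have "ennreal (2 * pi * (T + dist c z0) / (T - dist c z0)) * neglog (G z0) = top"
    using True by (simp only: neglog_def if_True ennreal_mult_top ennreal_0 flip: ennreal_0) (metis ennreal_eq_0_iff ennreal_mult_eq_top_iff not_le)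
  then show ?thesis by (metis top_greatest)
next
  case False
  define d where "d = dist c z0"
  have T: "T > d" "d \<ge> 0" using z0 by (auto simp: d_def)
  define B where "B = dist c ` {z \<in> ball c T. G z = 0}"
  have holb: "G holomorphic_on ball c T" using G S holomorphic_on_subset by blast
  have "countable B"
  proof (cases "\<forall>z\<in>ball c T. G z \<noteq> 0")
    case True
    then have "B = {}" by (auto simp: B_def)
    then show ?thesis by simp
  next
    case F2: False
    then have "\<not> G constant_on ball c T" using False z0 unfolding constant_on_def by (metis mem_ball)
    then show ?thesis unfolding B_def
      by (intro countable_image holomorphic_countable_zeros[OF holb] open_ball connected_ball fsigma_ball)
  qed
  then have "\<forall>k. \<exists>r. max d (T - 1 / Suc k) < r \<and> r < T \<and> r \<notin> B"
    using T by (intro allI exists_real_not_in_countable) auto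
  then obtain R where R: "\<And>k. max d (T - 1 / Suc k) < R k" "\<And>k. R k < T" "\<And>k. R k \<notin> B" by metis
  have Rlim: "R \<longlonglongrightarrow> T"
  proof (rule real_tendsto_sandwich[of "\<lambda>k. T - 1 / Suc k"])
    show "(\<lambda>k. T - 1 / Suc k) \<longlonglongrightarrow> T"
      using tendsto_diff[OF tendsto_const LIMSEQ_inverse_real_of_nat, of T] by (simp add: inverse_eq_divide)
    show "\<forall>\<^sub>F k in sequentially. T - 1 / Suc k \<le> R k" using R(1) by (intro always_eventually allI) (simp add: less_imp_le)
    show "\<forall>\<^sub>F k in sequentially. R k \<le> T" using R(2) by (intro always_eventually allI) (simp add: less_imp_le)
  qed simp
  define L where "L = - ln (cmod (G z0))"
  have L: "L \<ge> 0" using le[of z0] S z0 False by (auto simp: L_def)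
  define f where "f k t = neglog (G (c - R k * cis t)) * indicator {0..2*pi} t" for k t
  have inb: "c - R k * cis t \<in> ball c T" for k t
    using R(2)[of k] R(1)[of k] T by (simp add: dist_norm norm_mult)
  have meas: "f k \<in> borel_measurable lborel" for k
  proof -
    have "continuous_on UNIV (\<lambda>t. G (c - R k * cis t))"
      by (rule continuous_on_compose2[OF holomorphic_on_imp_continuous_on[OF holb]])
         (use inb in \<open>auto intro!: continuous_intros\<close>)
    then have [measurable]: "(\<lambda>t. G (c - R k * cis t)) \<in> borel_measurable borel"
      by (rule borel_measurable_continuous_onI)
    show ?thesis unfolding f_def by measurable
  qed
  have bd: "integral\<^sup>N lborel (f k) \<le> ennreal (2 * pi * (R k + d) / (R k - d) * L)" for k
    unfolding f_def L_def d_def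
  proof (rule circle_neglog_le_interior[OF holb])
    show "dist c z0 < R k" using R(1)[of k] by (simp add: d_def)
    show "G z \<noteq> 0" if "dist c z = R k" for z using R(2,3)[of k] that by (force simp: B_def)
  qed (use z0 S le False R(2) in auto)
  have "(\<integral>\<^sup>+t. neglog (G (c - T * cis t)) * indicator ({t. c - T * cis t \<in> S} \<inter> {0..2*pi}) t \<partial>lborel)
     \<le> (\<integral>\<^sup>+t. liminf (\<lambda>k. f k t) \<partial>lborel)"
  proof (rule nn_integral_mono)
    fix t
    show "neglog (G (c - T * cis t)) * indicator ({t. c - T * cis t \<in> S} \<inter> {0..2*pi}) t \<le> liminf (\<lambda>k. f k t)"
    proof (cases "c - T * cis t \<in> S \<and> t \<in> {0..2*pi}")
      case True
      have "isCont G (c - T * cis t)"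
        using True G S(1) holomorphic_on_imp_continuous_on continuous_on_eq_continuous_at by blast
      then have "(\<lambda>k. G (c - R k * cis t)) \<longlonglongrightarrow> G (c - T * cis t)"
        by (rule isCont_tendsto_compose) (intro tendsto_intros Rlim)
      then have "(\<lambda>k. f k t) \<longlonglongrightarrow> neglog (G (c - T * cis t))"
        using True tendsto_neglog by (simp add: f_def)
      then have "liminf (\<lambda>k. f k t) = neglog (G (c - T * cis t))"
        by (rule lim_imp_Liminf[OF sequentially_bot])
      then show ?thesis using True by simp
    next
      case False
      then show ?thesis by (auto simp: indicator_def)
    qed
  qed
  also have "\<dots> \<le> liminf (\<lambda>k. integral\<^sup>N lborel (f k))"
    by (rule nn_integral_liminf[OF meas])
  also have "\<dots> \<le> liminf (\<lambda>k. ennreal (2 * pi * (R k + d) / (R k - d) * L))"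
    by (intro Liminf_mono always_eventually allI bd)
  also have "\<dots> = ennreal (2 * pi * (T + d) / (T - d) * L)"
    using T by (intro lim_imp_Liminf tendsto_ennrealI tendsto_intros Rlim) auto
  also have "\<dots> = ennreal (2 * pi * (T + d) / (T - d)) * neglog (G z0)"
    using False L T by (simp add: neglog_def L_def flip: ennreal_mult)
  finally show ?thesis by (simp add: d_def)
qed

text \<open>In logarithmic coordinates \<open>\<zeta> = \<xi> + \<i> \<theta>\<close> the half-plane is a strip; averaging
  the circles of radius \<open>\<pi>/2\<close> inscribed in the strip over horizontal translations dominates
  the area average up to the boundary.\<close>
lemma polar_average_neglog_le:
  fixes \<xi>0 :: real
  assumes G: "G holomorphic_on {z. Im z > 0}" and le: "\<And>z. Im z > 0 \<Longrightarrow> cmod (G z) \<le> 1"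
    and z1: "dist \<zeta> (Complex (\<xi>0 - pi/4) (pi/2)) \<le> 1/5"
  shows "(\<integral>\<^sup>+\<xi>. (\<integral>\<^sup>+\<theta>. neglog (G (exp (Complex \<xi> \<theta>))) * indicator {0<..<pi} \<theta> \<partial>lborel) * indicator {\<xi>0..\<xi>0+1/10} \<xi> \<partial>lborel)
     \<le> ennreal 200 * neglog (G (exp \<zeta>))"
proof -
  define S where "S = {\<zeta>. 0 < Im \<zeta> \<and> Im \<zeta> < pi}"
  define N where "N = neglog (G (exp \<zeta>))"
  \<comment> \<open>The value 1 outside the strip has \<open>neglog\<close> 0: the extension is
    measurable on the plane and adds nothing to the integrals.\<close>
  define g where "g \<zeta> = (if \<zeta> \<in> S then G (exp \<zeta>) else 1)" for \<zeta>
  have openS: "open S" unfolding S_def by (intro open_Collect_conj open_Collect_less continuous_intros)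
  have expS: "Im (exp \<zeta>) > 0" if "\<zeta> \<in> S" for \<zeta>
    using that by (simp add: S_def Im_exp sin_gt_zero)
  have holS: "(\<lambda>\<zeta>. G (exp \<zeta>)) holomorphic_on S"
    by (rule holomorphic_on_compose_gen[OF _ G, of exp S, unfolded o_def])
       (use expS in \<open>auto intro!: holomorphic_intros\<close>)
  have [measurable]: "g \<in> borel_measurable borel" unfolding g_def
    using openS holomorphic_on_imp_continuous_on[OF holS]
    by (intro borel_measurable_continuous_on_if) auto
  \<comment> \<open>The point of the circle of radius pi/2 around s + i pi/2 with parameter t, taken
    as centre minus pi/2 e^{it}, has coordinates s - a t and th t.\<close>
  define a where "a t = pi/2 * cos t" for t
  define th where "th t = pi/2 - pi/2 * sin t" for t
  have [measurable]: "a \<in> borel_measurable borel" "th \<in> borel_measurable borel"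
    unfolding a_def th_def by measurable
  have [measurable]: "(\<lambda>p. Complex (fst p) (snd p)) \<in> borel_measurable (borel \<Otimes>\<^sub>M borel)"
  proof -
    have "continuous_on UNIV (\<lambda>p::real\<times>real. Complex (fst p) (snd p))"
      unfolding Complex_eq by (intro continuous_intros)
    then show ?thesis using borel_measurable_continuous_onI borel_prod by metis
  qed
  have Cm[measurable (raw)]: "(\<lambda>x. Complex (p x) (q x)) \<in> borel_measurable M" if [measurable]: "p \<in> borel_measurable M" "q \<in> borel_measurable M" for p q :: "'a \<Rightarrow> real" and M
  proof -
    have "(\<lambda>x. (p x, q x)) \<in> measurable M (borel \<Otimes>\<^sub>M borel)" by measurable
    from measurable_compose[OF this, of "\<lambda>p. Complex (fst p) (snd p)" borel] show ?thesis by simp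
  qed
  define W where "W \<xi> \<theta> = neglog (g (Complex \<xi> \<theta>))" for \<xi> \<theta>
  have Wm[measurable]: "(\<lambda>x. W (p x) (q x)) \<in> borel_measurable M" if [measurable]: "p \<in> borel_measurable M" "q \<in> borel_measurable M" for p q :: "'a \<Rightarrow> real" and M
    unfolding W_def by measurable
  \<comment> \<open>\<open>I\<close> contains \<xi> + a t for every \<xi> in the window and every a
    t in [-pi/2, 0]. \<open>J\<close> is the right half of the circle, on which \<open>th\<close>
    increases from 0 to pi; the minus sign in c - T e^{it} places this half inside
    [0, 2 pi].\<close>
  define I where "I = {\<xi>0 - pi/2..\<xi>0 + 1/10}"
  define J where "J = {pi/2..3*pi/2}"
  \<comment> \<open>Centres with s in \<open>I\<close> are within pi/4 + 1/10 of the point over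
    \<xi>0 - pi/4, so \<zeta> is at distance at most 6/5 < pi/2 from each of them. With 3 < pi < 3.2
    the Harnack factor is below 6.4 * 2.8 / 0.3 < 70.\<close>
  have circ: "(\<integral>\<^sup>+t. W (s - a t) (th t) * indicator J t \<partial>lborel) \<le> ennreal 70 * N" if s: "s \<in> I" for s
  proof -
    define c where "c = Complex s (pi/2)"
    have d: "dist c \<zeta> \<le> 6/5"
    proof -
      have "dist c \<zeta> \<le> dist c (Complex (\<xi>0 - pi/4) (pi/2)) + dist (Complex (\<xi>0 - pi/4) (pi/2)) \<zeta>" by (rule dist_triangle)
      also have "dist (Complex (\<xi>0 - pi/4) (pi/2)) \<zeta> \<le> 1/5" using z1 by (simp add: dist_commute)
      also have "dist c (Complex (\<xi>0 - pi/4) (pi/2)) = \<bar>s - (\<xi>0 - pi/4)\<bar>"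
      proof -
        have "c - Complex (\<xi>0 - pi/4) (pi/2) = of_real (s - (\<xi>0 - pi/4))" by (simp add: c_def complex_eq_iff)
        then show ?thesis unfolding dist_norm by (simp only: norm_of_real)
      qed
      also have "\<dots> \<le> pi/4 + 1/10" using s pi_gt_zero unfolding I_def atLeastAtMost_iff by linarith
      also have "pi/4 \<le> 4/5" using pi_less_4 pi_approx by simp
      finally show ?thesis by simp
    qed
    have pi3: "3 < pi" "pi < 3.2" using pi_gt3 pi_approx by auto
    have sub: "ball c (pi/2) \<subseteq> S"
    proof
      fix z assume "z \<in> ball c (pi/2)"
      then have "\<bar>Im (c - z)\<bar> < pi/2" using abs_Im_le_cmod[of "c - z"] by (simp add: dist_norm)
      then have "0 < Im z \<and> Im z < pi" unfolding c_def minus_complex.sel complex.sel by linarith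
      then show "z \<in> S" by (simp add: S_def)
    qed
    have pt: "c - (pi/2) * cis t = Complex (s - a t) (th t)" for t
      by (simp add: complex_eq_iff c_def a_def th_def)
    have "(\<integral>\<^sup>+t. neglog (G (exp (c - (pi/2) * cis t))) * indicator ({t. c - (pi/2) * cis t \<in> S} \<inter> {0..2*pi}) t \<partial>lborel)
      \<le> ennreal (2 * pi * (pi/2 + dist c \<zeta>) / (pi/2 - dist c \<zeta>)) * neglog (G (exp \<zeta>))"
      using circle_neglog_le[OF openS sub holS, of \<zeta>] le expS d pi3 by auto
    also have "\<dots> \<le> ennreal 70 * N" unfolding N_def
    proof (intro mult_right_mono ennreal_leI)
      have "2 * pi * (pi/2 + dist c \<zeta>) \<le> 70 * (pi/2 - dist c \<zeta>)"
      proof -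
        have "2 * pi * (pi/2 + dist c \<zeta>) \<le> 6.4 * (2.8)"
          using pi3 d by (intro mult_mono) auto
        also have "\<dots> \<le> 70 * (pi/2 - dist c \<zeta>)" using pi3 d by simp
        finally show ?thesis .
      qed
      then show "2 * pi * (pi/2 + dist c \<zeta>) / (pi/2 - dist c \<zeta>) \<le> 70"
        using pi3 d by (simp add: pos_divide_le_eq)
    qed simp
    finally have le70: "(\<integral>\<^sup>+t. neglog (G (exp (c - (pi/2) * cis t))) * indicator ({t. c - (pi/2) * cis t \<in> S} \<inter> {0..2*pi}) t \<partial>lborel) \<le> ennreal 70 * N" .
    have "(\<integral>\<^sup>+t. W (s - a t) (th t) * indicator J t \<partial>lborel) \<le> (\<integral>\<^sup>+t. neglog (G (exp (c - (pi/2) * cis t))) * indicator ({t. c - (pi/2) * cis t \<in> S} \<inter> {0..2*pi}) t \<partial>lborel)"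
    proof (rule nn_integral_mono)
      fix t :: real
      show "W (s - a t) (th t) * indicator J t \<le> neglog (G (exp (c - (pi/2) * cis t))) * indicator ({t. c - (pi/2) * cis t \<in> S} \<inter> {0..2*pi}) t"
        unfolding W_def pt g_def J_def using pi3 by (auto simp: indicator_def)
    qed
    then show ?thesis using le70 by (rule order_trans)
  qed
  define Wt where "Wt \<theta> = (\<integral>\<^sup>+\<xi>. W \<xi> \<theta> * indicator {\<xi>0..\<xi>0+1/10} \<xi> \<partial>lborel)" for \<theta>
  have [measurable]: "Wt \<in> borel_measurable borel" unfolding Wt_def by measurable
  have cosneg: "cos t \<le> 0" if "t \<in> J" for t
    using cos_ge_zero[of "t - pi"] that by (simp add: J_def cos_diff)
  have a_bounds: "- (pi/2) \<le> a t" "t \<in> J \<Longrightarrow> a t \<le> 0" for t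
    using mult_left_mono[OF cos_ge_minus_one[of t], of "pi/2"] cosneg[of t] by (auto simp: a_def mult_nonneg_nonpos)
  have shift: "Wt (th t) \<le> (\<integral>\<^sup>+s. W (s - a t) (th t) * indicator I s \<partial>lborel)" if t: "t \<in> J" for t
  proof -
    have at: "- (pi/2) \<le> a t" "a t \<le> 0" using a_bounds t by auto
    have "(\<integral>\<^sup>+s. W (s - a t) (th t) * indicator I s \<partial>lborel) = (\<integral>\<^sup>+s. W (a t + 1 * s - a t) (th t) * indicator I (a t + 1 * s) \<partial>lborel)"
      by (subst nn_integral_real_affine[where c = 1 and t = "a t"]) (auto simp: I_def)
    also have "\<dots> \<ge> Wt (th t)" unfolding Wt_def
      using at by (intro nn_integral_mono) (auto simp: I_def indicator_def)
    finally show ?thesis .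
  qed
  have "(\<integral>\<^sup>+t. Wt (th t) * indicator J t \<partial>lborel) \<le> (\<integral>\<^sup>+t. (\<integral>\<^sup>+s. W (s - a t) (th t) * indicator I s \<partial>lborel) * indicator J t \<partial>lborel)"
    using shift by (intro nn_integral_mono) (auto simp: indicator_def)
  also have "\<dots> = (\<integral>\<^sup>+t. (\<integral>\<^sup>+s. W (s - a t) (th t) * indicator I s * indicator J t \<partial>lborel) \<partial>lborel)"
    by (intro nn_integral_cong, subst nn_integral_multc) (auto simp: I_def)
  also have "\<dots> = (\<integral>\<^sup>+s. (\<integral>\<^sup>+t. W (s - a t) (th t) * indicator I s * indicator J t \<partial>lborel) \<partial>lborel)"
    by (rule lborel_pair.Fubini') (simp add: I_def J_def)
  also have "\<dots> = (\<integral>\<^sup>+s. (\<integral>\<^sup>+t. W (s - a t) (th t) * indicator J t \<partial>lborel) * indicator I s \<partial>lborel)"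
    by (intro nn_integral_cong, subst nn_integral_multc[symmetric]) (auto simp: J_def mult_ac)
  also have "\<dots> \<le> (\<integral>\<^sup>+s. ennreal 70 * N * indicator I s \<partial>lborel)"
    using circ by (intro nn_integral_mono) (auto simp: indicator_def)
  also have "\<dots> = ennreal 70 * N * ennreal (pi/2 + 1/10)"
  proof -
    have "emeasure lborel I = ennreal (pi/2 + 1/10)"
      unfolding I_def using pi_gt_zero by (subst emeasure_lborel_Icc) (auto simp: algebra_simps simp del: ennreal_plus)
    then show ?thesis by (subst nn_integral_cmult_indicator) (auto simp: I_def simp del: ennreal_plus)
  qed
  finally have main: "(\<integral>\<^sup>+t. Wt (th t) * indicator J t \<partial>lborel) \<le> ennreal 70 * N * ennreal (pi/2 + 1/10)" .
  \<comment> \<open>These endpoints permit the substitution \<theta> = th t with d\<theta> = - a t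
    dt. The weight - a t is at most pi/2, and so the integral over the half-circle dominates the one
    over \<theta>.\<close>
  have th: "th (pi/2) = 0" "th (3*pi/2) = pi" 
  proof -
    have "sin (3*pi/2) = - 1" using sin_periodic_pi2[of "pi/2"] by (simp add: field_simps)
    then show "th (3*pi/2) = pi" unfolding th_def by simp
  qed (simp add: th_def)
  have "(\<integral>\<^sup>+\<theta>. Wt \<theta> * indicator {th (pi/2)..th (3*pi/2)} \<theta> \<partial>lborel) = (\<integral>\<^sup>+t. Wt (th t) * ennreal (- a t) * indicator {pi/2..3*pi/2} t \<partial>lborel)"
  proof (rule nn_integral_substitution_aux)
    show "(th has_real_derivative - a x) (at x)" for x
      unfolding th_def a_def by (auto intro!: derivative_eq_intros)
    show "continuous_on {pi/2..3*pi/2} (\<lambda>x. - a x)" unfolding a_def by (intro continuous_intros)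
    show "0 \<le> - a x" if "x \<in> {pi/2..3*pi/2}" for x
      using that a_bounds(2)[of x] by (simp add: J_def)
  qed (auto simp: th)
  also have "\<dots> \<le> (\<integral>\<^sup>+t. ennreal (pi/2) * (Wt (th t) * indicator J t) \<partial>lborel)"
  proof (rule nn_integral_mono)
    fix t :: real
    have "- a t \<le> pi/2" using a_bounds(1)[of t] by simp
    then have "ennreal (- a t) \<le> ennreal (pi/2)" by (rule ennreal_leI)
    then have "Wt (th t) * ennreal (- a t) \<le> Wt (th t) * ennreal (pi/2)" by (rule mult_left_mono) simp
    then show "Wt (th t) * ennreal (- a t) * indicator {pi/2..3*pi/2} t \<le> ennreal (pi/2) * (Wt (th t) * indicator J t)"
      by (auto simp: J_def indicator_def mult.commute)
  qed
  also have "\<dots> = ennreal (pi/2) * (\<integral>\<^sup>+t. Wt (th t) * indicator J t \<partial>lborel)"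
    by (rule nn_integral_cmult) (simp add: J_def)
  also have "\<dots> \<le> ennreal (pi/2) * (ennreal 70 * N * ennreal (pi/2 + 1/10))"
    by (intro mult_left_mono main) simp
  also have "\<dots> = ennreal (pi/2 * 70 * (pi/2 + 1/10)) * N"
  proof -
    have "ennreal (pi/2 * 70 * (pi/2 + 1/10)) = ennreal (pi/2) * ennreal 70 * ennreal (pi/2 + 1/10)"
      using pi_gt_zero by (subst ennreal_mult[symmetric], simp, simp)+ simp
    then show ?thesis by (simp only: mult_ac)
  qed
  also have "\<dots> \<le> ennreal 200 * N"
  proof (intro mult_right_mono ennreal_leI)
    have "pi < 3.2" using pi_approx by simp
    then have "pi/2 * 70 * (pi/2 + 1/10) \<le> 1.6 * 70 * 1.7" by (intro mult_mono) (auto simp: pi_ge_zero)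
    then show "pi/2 * 70 * (pi/2 + 1/10) \<le> 200" by simp
  qed simp
  finally have fin: "(\<integral>\<^sup>+\<theta>. Wt \<theta> * indicator {0..pi} \<theta> \<partial>lborel) \<le> ennreal 200 * N" by (simp add: th)
  have "(\<integral>\<^sup>+\<xi>. (\<integral>\<^sup>+\<theta>. neglog (G (exp (Complex \<xi> \<theta>))) * indicator {0<..<pi} \<theta> \<partial>lborel) * indicator {\<xi>0..\<xi>0+1/10} \<xi> \<partial>lborel)
    \<le> (\<integral>\<^sup>+\<xi>. (\<integral>\<^sup>+\<theta>. W \<xi> \<theta> * indicator {0..pi} \<theta> \<partial>lborel) * indicator {\<xi>0..\<xi>0+1/10} \<xi> \<partial>lborel)"
    by (intro nn_integral_mono mult_right_mono) (auto simp: W_def g_def S_def indicator_def)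
  also have "\<dots> = (\<integral>\<^sup>+\<xi>. (\<integral>\<^sup>+\<theta>. W \<xi> \<theta> * indicator {0..pi} \<theta> * indicator {\<xi>0..\<xi>0+1/10} \<xi> \<partial>lborel) \<partial>lborel)"
    by (intro nn_integral_cong, subst nn_integral_multc) auto
  also have "\<dots> = (\<integral>\<^sup>+\<theta>. (\<integral>\<^sup>+\<xi>. W \<xi> \<theta> * indicator {0..pi} \<theta> * indicator {\<xi>0..\<xi>0+1/10} \<xi> \<partial>lborel) \<partial>lborel)"
    by (rule lborel_pair.Fubini') simp
  also have "\<dots> = (\<integral>\<^sup>+\<theta>. Wt \<theta> * indicator {0..pi} \<theta> \<partial>lborel)"
    unfolding Wt_def by (intro nn_integral_cong, subst nn_integral_multc[symmetric]) (auto simp: mult_ac)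
  finally show ?thesis using fin unfolding N_def by (rule order_trans)
qed

section \<open>Poisson integrals in the half-plane\<close>

text \<open>F need not extend to the frontier. The set where |F| > 1 + e is open, and the boundary
  hypothesis keeps its closure inside \<open>S\<close>; on its frontier |F| is at most 1 + e, so the
  ordinary maximum principle applies there.\<close>

lemma maximum_modulus_boundary_limsup:
  assumes F: "F holomorphic_on S" and S: "open S" "bounded S"
    and bd: "\<And>w e. w \<in> frontier S \<Longrightarrow> e > 0 \<Longrightarrow> \<exists>d>0. \<forall>z\<in>S. dist z w < d \<longrightarrow> cmod (F z) \<le> 1 + e"
    and z: "z \<in> S"
  shows "cmod (F z) \<le> 1"
proof (rule field_le_epsilon)
  fix e :: real assume e: "e > 0"
  define K where "K = {z \<in> S. cmod (F z) > 1 + e}"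
  have contF: "continuous_on S (\<lambda>z. cmod (F z))"
    by (intro continuous_intros holomorphic_on_imp_continuous_on F)
  have "open K"
    using continuous_open_preimage[OF contF S(1), of "{1+e<..}"] by (simp add: K_def vimage_def Int_def)
  have cl: "closure K \<subseteq> S"
  proof
    fix w assume w: "w \<in> closure K"
    show "w \<in> S"
    proof (rule ccontr)
      assume "w \<notin> S"
      moreover have "w \<in> closure S" using w closure_mono[of K S] by (auto simp: K_def)
      ultimately have "w \<in> frontier S" using S(1) by (simp add: frontier_def interior_open)
      then obtain d where d: "d > 0" "\<forall>z\<in>S. dist z w < d \<longrightarrow> cmod (F z) \<le> 1 + e" using bd e by blast
      obtain y where "y \<in> K" "dist y w < d" using w d(1) closure_approachable by blast
      then show False using d(2) by (auto simp: K_def)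
    qed
  qed
  show "cmod (F z) \<le> 1 + e"
  proof (cases "z \<in> K")
    case True
    show ?thesis
    proof (rule maximum_modulus_frontier[of F K, OF _ _ _ _ True])
      show "F holomorphic_on interior K"
        using \<open>open K\<close> by (simp add: interior_open) (rule holomorphic_on_subset[OF F], auto simp: K_def)
      show "continuous_on (closure K) F"
        using cl F continuous_on_subset holomorphic_on_imp_continuous_on by blast
      show "bounded K" by (rule bounded_subset[OF S(2)]) (auto simp: K_def)
      show "cmod (F w) \<le> 1 + e" if "w \<in> frontier K" for w
        using that \<open>open K\<close> cl by (auto simp: frontier_def interior_open K_def not_less)
    qed
  next
    case False
    then show ?thesis using z by (simp add: K_def)
  qed
qed

section \<open>The Poisson integral and its holomorphic completion\<close>

definition poisson_integral :: "(real \<Rightarrow> real) \<Rightarrow> complex \<Rightarrow> real" where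
  "poisson_integral p z = (LINT t|lborel. p t * (Im z / ((Re z - t)\<^sup>2 + (Im z)\<^sup>2))) / pi"

lemma Im_inverse_of_real_diff:
  "Im (1 / (of_real t - z)) = Im z / ((Re z - t)\<^sup>2 + (Im z)\<^sup>2)"
  by (simp add: Im_divide power2_commute)

text \<open>From |t - z| \<ge> |t| / 2. The decay of order 1 / t^2, uniform for |z| \<le> M, is what
  allows integrability of p / (1 + t^2) to dominate the kernel far out.\<close>

lemma schwarz_kernel_bound:
  assumes z: "cmod z \<le> M" and t: "2 * M + 1 \<le> \<bar>t\<bar>"
  shows "cmod ((1 + of_real t * z) / ((of_real t - z) * (1 + (of_real t)\<^sup>2))) \<le> (2 + 2 * M) / (1 + t\<^sup>2)"
proof -
  have M: "M \<ge> 0" using z norm_ge_zero[of z] by linarith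
  have "cmod (1 + of_real t * z) \<le> 1 + \<bar>t\<bar> * M"
    using norm_triangle_ineq[of 1 "of_real t * z"] mult_left_mono[OF z, of "\<bar>t\<bar>"] by (simp add: norm_mult)
  also have "\<dots> \<le> \<bar>t\<bar> * (1 + M)" using t M by (simp add: algebra_simps)
  finally have num: "cmod (1 + of_real t * z) \<le> \<bar>t\<bar> * (1 + M)" .
  have "cmod (of_real t - z) \<ge> \<bar>t\<bar> - M"
    using norm_triangle_ineq2[of "of_real t" z] z by simp
  then have den: "cmod (of_real t - z) \<ge> \<bar>t\<bar> / 2" using t by linarith
  have den0: "\<bar>t\<bar> / 2 > 0" using t M by linarith
  have sq: "cmod (1 + (of_real t)\<^sup>2) = 1 + t\<^sup>2"
  proof -
    have "1 + (of_real t)\<^sup>2 = complex_of_real (1 + t\<^sup>2)" by simp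
    then show ?thesis by (simp only: norm_of_real) (simp add: add_nonneg_nonneg)
  qed
  have "cmod (1 + of_real t * z) / cmod (of_real t - z) \<le> (\<bar>t\<bar> * (1 + M)) / (\<bar>t\<bar> / 2)"
    using num den den0 M by (intro frac_le) auto
  also have "\<dots> = 2 + 2 * M" using den0 by (simp add: field_simps)
  finally have "cmod (1 + of_real t * z) / cmod (of_real t - z) \<le> 2 + 2 * M" .
  then have "cmod (1 + of_real t * z) / cmod (of_real t - z) / (1 + t\<^sup>2) \<le> (2 + 2 * M) / (1 + t\<^sup>2)"
    by (intro divide_right_mono) (auto simp: add_nonneg_nonneg)
  then show ?thesis by (simp add: norm_divide norm_mult sq del: of_real_power)
qed

context
  fixes p :: "real \<Rightarrow> real"
  assumes cont_p: "continuous_on UNIV p" and p_nonneg: "\<And>t. p t \<ge> 0"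
    and p_int: "integrable lborel (\<lambda>t. p t / (1 + t\<^sup>2))"
begin

text \<open>The Cauchy kernel 1 / (t - z) minus the real number t / (1 + t^2). The correction makes
  it integrable against \<open>p\<close> and leaves the imaginary part unchanged, which is pi times
  the Poisson kernel.\<close>

private definition "poisson_kernel z t = (1 + of_real t * z) / ((of_real t - z) * (1 + (of_real t)\<^sup>2))" for z t

private lemma poisson_kernel_eq:
  assumes "Im z > 0"
  shows "poisson_kernel z t = 1 / (of_real t - z) - of_real (t / (1 + t\<^sup>2))"
proof -
  have 1: "of_real t - z \<noteq> 0" using assms by (auto simp: complex_eq_iff)
  have "(1 + (of_real t)\<^sup>2 :: complex) = of_real (1 + t\<^sup>2)" by simp
  then have 2: "(1 + (of_real t)\<^sup>2 :: complex) \<noteq> 0"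
    by (metis add_pos_nonneg of_real_eq_0_iff less_irrefl zero_le_power2 zero_less_one)
  show ?thesis unfolding poisson_kernel_def using 1 2 by (simp add: field_simps power2_eq_square)
qed

private lemma continuous_on_kernel:
  assumes "Im z > 0"
  shows "continuous_on UNIV (poisson_kernel z)"
proof -
  have "of_real t - z \<noteq> 0" for t using assms by (auto simp: complex_eq_iff)
  moreover have "(1 + t\<^sup>2 :: real) \<noteq> 0" for t by (metis add_pos_nonneg less_irrefl zero_le_power2 zero_less_one)
  ultimately have "continuous_on UNIV (\<lambda>t. 1 / (of_real t - z) - of_real (t / (1 + t\<^sup>2)))"
    by (intro continuous_intros) auto
  then show ?thesis using poisson_kernel_eq[OF assms] by (simp cong: continuous_on_cong)
qed

private lemma integrable_kernel:
  assumes z: "Im z > 0"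
  shows "integrable lborel (\<lambda>t. of_real (p t) * poisson_kernel z t)"
proof -
  define M where "M = 2 * cmod z + 1"
  have M: "M > 0" by (simp add: M_def add_nonneg_pos)
  have cont: "continuous_on UNIV (\<lambda>t. of_real (p t) * poisson_kernel z t)"
    by (intro continuous_intros cont_p continuous_on_kernel z)
  have 1: "integrable lborel (\<lambda>t. indicator {-M..M} t *\<^sub>R (of_real (p t) * poisson_kernel z t))"
    using borel_integrable_atLeastAtMost'[OF continuous_on_subset[OF cont subset_UNIV], of "-M" M] unfolding set_integrable_def .
  have 2: "integrable lborel (\<lambda>t. indicator (-{-M..M}) t *\<^sub>R (of_real (p t) * poisson_kernel z t))"
  proof (rule Bochner_Integration.integrable_bound[OF integrable_mult_left[OF p_int, of "2 + 2 * cmod z"]])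
    have [measurable]: "(\<lambda>t. of_real (p t) * poisson_kernel z t) \<in> borel_measurable borel"
      by (rule borel_measurable_continuous_onI[OF cont])
    show "(\<lambda>t. indicator (-{-M..M}) t *\<^sub>R (of_real (p t) * poisson_kernel z t)) \<in> borel_measurable lborel" by measurable
    have "norm (indicator (-{-M..M}) t *\<^sub>R (of_real (p t) * poisson_kernel z t)) \<le> norm (p t / (1 + t\<^sup>2) * (2 + 2 * cmod z))" for t
    proof (cases "t \<in> {-M..M}")
      case False
      then have "2 * cmod z + 1 \<le> \<bar>t\<bar>" by (auto simp: M_def)
      then have "cmod (poisson_kernel z t) \<le> (2 + 2 * cmod z) / (1 + t\<^sup>2)" unfolding poisson_kernel_def
        by (rule schwarz_kernel_bound[OF order_refl])
      then have "p t * cmod (poisson_kernel z t) \<le> p t * ((2 + 2 * cmod z) / (1 + t\<^sup>2))" by (rule mult_left_mono[OF _ p_nonneg])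
      also have "\<dots> = norm (p t / (1 + t\<^sup>2) * (2 + 2 * cmod z))" using p_nonneg[of t]
        by (simp add: abs_mult)
      finally show ?thesis using False p_nonneg[of t] by (simp add: norm_mult)
    qed simp
    then show "AE t in lborel. norm (indicator (-{-M..M}) t *\<^sub>R (of_real (p t) * poisson_kernel z t)) \<le> norm (p t / (1 + t\<^sup>2) * (2 + 2 * cmod z))"
      by simp
  qed
  have "indicator {-M..M} t *\<^sub>R x + indicator (-{-M..M}) t *\<^sub>R x = x" for t and x :: complex
    by (auto simp: indicator_def)
  then show ?thesis using Bochner_Integration.integrable_add[OF 1 2] by simp
qed

text \<open>Division by pi i moves the imaginary part to the real part, so the real part becomes the
  Poisson integral of \<open>p\<close>.\<close>

private definition "poisson_extension z = (LINT t|lborel. of_real (p t) * poisson_kernel z t) / (of_real pi * \<i>)"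

private lemma integrable_poisson:
  assumes z: "Im z > 0"
  shows "integrable lborel (\<lambda>t. p t * (Im z / ((Re z - t)\<^sup>2 + (Im z)\<^sup>2)))"
proof -
  have "integrable lborel (\<lambda>t. Im (of_real (p t) * poisson_kernel z t))"
    by (intro integrable_bounded_linear[OF bounded_linear_Im] integrable_kernel z)
  moreover have "Im (of_real (p t) * poisson_kernel z t) = p t * (Im z / ((Re z - t)\<^sup>2 + (Im z)\<^sup>2))" for t
    by (simp only: poisson_kernel_eq[OF z] Im_inverse_of_real_diff minus_complex.sel Im_complex_of_real times_complex.sel Re_complex_of_real) simp
  ultimately show ?thesis by simp
qed

private lemma Re_poisson_extension:
  assumes z: "Im z > 0"
  shows "Re (poisson_extension z) = poisson_integral p z"
proof -
  have e: "Im (of_real (p t) * poisson_kernel z t) = p t * (Im z / ((Re z - t)\<^sup>2 + (Im z)\<^sup>2))" for t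
    by (simp only: poisson_kernel_eq[OF z] Im_inverse_of_real_diff minus_complex.sel Im_complex_of_real times_complex.sel Re_complex_of_real) simp
  have "Im (LINT t|lborel. of_real (p t) * poisson_kernel z t) = (LINT t|lborel. Im (of_real (p t) * poisson_kernel z t))"
    by (rule integral_bounded_linear[OF bounded_linear_Im integrable_kernel[OF z], symmetric])
  moreover have "Re (X / (of_real pi * \<i>)) = Im X / pi" for X
    by (simp add: Re_divide power2_eq_square)
  ultimately show ?thesis unfolding poisson_extension_def poisson_integral_def e by metis
qed

text \<open>The truncations to [-n, n] are holomorphic by differentiation under the integral. By
  \<open>schwarz_kernel_bound\<close> their distance to the full integral is, uniformly on closed
  discs, at most a multiple of the tail of the integral of p / (1 + t^2).\<close>

private lemma holomorphic_poisson_integral: "poisson_extension holomorphic_on {z. Im z > 0}"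
proof -
  define I :: "nat \<Rightarrow> complex \<Rightarrow> complex" where "I n z = integral (cbox (- real n) (real n)) (\<lambda>t. of_real (p t) * poisson_kernel z t)" for n z
  have openH: "open {z. Im z > 0}" by (intro open_Collect_less continuous_intros)
  have Ihol: "I n holomorphic_on {z. Im z > 0}" for n
    unfolding I_def
  proof (rule leibniz_rule_holomorphic)
    show "convex {z. Im z > 0}" by (rule convex_halfspace_Im_gt)
    show "((\<lambda>z. of_real (p t) * poisson_kernel z t) has_field_derivative of_real (p t) * (1 / (of_real t - z)\<^sup>2)) (at z within {z. Im z > 0})"
      if "z \<in> {z. Im z > 0}" for z t
    proof -
      have nz: "of_real t - z \<noteq> 0" using that by (auto simp: complex_eq_iff)
      have "((\<lambda>z. of_real (p t) * (1 / (of_real t - z) - of_real (t / (1 + t\<^sup>2)))) has_field_derivative of_real (p t) * (1 / (of_real t - z)\<^sup>2)) (at z within {z. Im z > 0})"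
        using nz by (auto intro!: derivative_eq_intros simp: power2_eq_square)
      then show ?thesis
        by (rule has_field_derivative_transform_within[OF _ zero_less_one that]) (simp add: poisson_kernel_eq)
    qed
    show "(\<lambda>t. of_real (p t) * poisson_kernel z t) integrable_on cbox (- real n) (real n)" if "z \<in> {z. Im z > 0}" for z
      using that by (intro integrable_continuous continuous_on_mult continuous_on_of_real continuous_on_subset[OF cont_p] continuous_on_subset[OF continuous_on_kernel]) auto
    show "continuous_on ({z. Im z > 0} \<times> cbox (- real n) (real n)) (\<lambda>(z, t). of_real (p t) * (1 / (of_real t - z)\<^sup>2))"
    proof -
      have "of_real t - z \<noteq> 0" if "Im z > 0" for z and t :: real using that by (auto simp: complex_eq_iff)
      then show ?thesis unfolding case_prod_unfold
        by (intro continuous_intros continuous_on_compose2[OF cont_p]) auto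
    qed
  qed
  have tail: "(\<lambda>n. LINT t|lborel. indicator (-{-real n..real n}) t *\<^sub>R (p t / (1 + t\<^sup>2))) \<longlonglongrightarrow> (LINT t|(lborel :: real measure). 0::real)"
  proof (rule Bochner_Integration.integral_dominated_convergence[where w = "\<lambda>t. p t / (1 + t\<^sup>2)"])
    show "integrable lborel (\<lambda>t. p t / (1 + t\<^sup>2))" by (rule p_int)
    have [measurable]: "p \<in> borel_measurable borel" using cont_p by (rule borel_measurable_continuous_onI)
    show "(\<lambda>t. indicator (-{-real n..real n}) t *\<^sub>R (p t / (1 + t\<^sup>2))) \<in> borel_measurable lborel" for n by measurable
    have "(\<lambda>n. indicator (-{-real n..real n}) t *\<^sub>R (p t / (1 + t\<^sup>2))) \<longlonglongrightarrow> 0" for t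
    proof (rule tendsto_eventually)
      show "\<forall>\<^sub>F n in sequentially. indicator (-{-real n..real n}) t *\<^sub>R (p t / (1 + t\<^sup>2)) = 0"
        using eventually_ge_at_top[of "nat \<lceil>\<bar>t\<bar>\<rceil>"]
      proof eventually_elim
        case (elim n)
        then have "\<bar>t\<bar> \<le> real n" by linarith
        then show ?case by (auto simp: abs_le_iff indicator_def)
      qed
    qed
    then show "AE t in lborel. (\<lambda>n. indicator (-{-real n..real n}) t *\<^sub>R (p t / (1 + t\<^sup>2))) \<longlonglongrightarrow> 0" by simp
    show "AE t in lborel. norm (indicator (-{-real n..real n}) t *\<^sub>R (p t / (1 + t\<^sup>2))) \<le> p t / (1 + t\<^sup>2)" for n
      using p_nonneg by (auto simp: indicator_def add_nonneg_nonneg)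
  qed simp
  have Jhol: "(\<lambda>z. LINT t|lborel. of_real (p t) * poisson_kernel z t) holomorphic_on {z. Im z > 0}"
  proof (subst holomorphic_on_open[OF openH], safe)
    fix z0 assume z0: "Im z0 > 0"
    obtain r where r: "r > 0" "cball z0 r \<subseteq> {z. Im z > 0}" using openH z0 open_contains_cball by blast
    define M where "M = cmod z0 + r"
    define T where "T n = (LINT t|lborel. indicator (-{-real n..real n}) t *\<^sub>R (p t / (1 + t\<^sup>2)))" for n :: nat
    have est: "cmod (I n z - (LINT t|lborel. of_real (p t) * poisson_kernel z t)) \<le> (2 + 2 * M) * T n"
      if z: "z \<in> cball z0 r" and n: "real n \<ge> 2 * M + 1" for z n
    proof -
      have zH: "Im z > 0" using z r by auto
      have zM: "cmod z \<le> M" using z norm_triangle_ineq[of z0 "z - z0"] by (simp add: M_def dist_norm norm_minus_commute)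
      have cont: "continuous_on UNIV (\<lambda>t. of_real (p t) * poisson_kernel z t)"
        by (intro continuous_intros cont_p continuous_on_kernel zH)
      have si: "set_integrable lborel {-real n..real n} (\<lambda>t. of_real (p t) * poisson_kernel z t)"
        by (rule borel_integrable_atLeastAtMost'[OF continuous_on_subset[OF cont subset_UNIV]])
      have In: "I n z = (LINT t|lborel. indicator {-real n..real n} t *\<^sub>R (of_real (p t) * poisson_kernel z t))"
        unfolding I_def using set_borel_integral_eq_integral(2)[OF si] by (simp add: set_lebesgue_integral_def)
      have spl: "of_real (p t) * poisson_kernel z t - indicator {-real n..real n} t *\<^sub>R (of_real (p t) * poisson_kernel z t) = indicator (-{-real n..real n}) t *\<^sub>R (of_real (p t) * poisson_kernel z t)" for t
        by (auto simp: indicator_def)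
      have "(LINT t|lborel. of_real (p t) * poisson_kernel z t) - I n z = (LINT t|lborel. indicator (-{-real n..real n}) t *\<^sub>R (of_real (p t) * poisson_kernel z t))"
        unfolding In spl[symmetric]
        by (rule Bochner_Integration.integral_diff[symmetric]) (use integrable_kernel[OF zH] si in \<open>auto simp: set_integrable_def\<close>)
      also have "cmod \<dots> \<le> (LINT t|lborel. (2 + 2 * M) * (indicator (-{-real n..real n}) t *\<^sub>R (p t / (1 + t\<^sup>2))))"
      proof (rule Bochner_Integration.integral_norm_bound_integral)
        show "integrable lborel (\<lambda>t. indicator (-{-real n..real n}) t *\<^sub>R (of_real (p t) * poisson_kernel z t))"
          unfolding spl[symmetric] by (rule Bochner_Integration.integrable_diff) (use integrable_kernel[OF zH] si in \<open>auto simp: set_integrable_def\<close>)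
        show "integrable lborel (\<lambda>t. (2 + 2 * M) * (indicator (-{-real n..real n}) t *\<^sub>R (p t / (1 + t\<^sup>2))))"
          by (intro integrable_mult_right integrable_mult_indicator p_int) auto
        fix t
        show "norm (indicator (-{-real n..real n}) t *\<^sub>R (of_real (p t) * poisson_kernel z t)) \<le> (2 + 2 * M) * (indicator (-{-real n..real n}) t *\<^sub>R (p t / (1 + t\<^sup>2)))"
        proof (cases "t \<in> {-real n..real n}")
          case False
          then have "2 * M + 1 \<le> \<bar>t\<bar>" using n by auto
          then have "cmod (poisson_kernel z t) \<le> (2 + 2 * M) / (1 + t\<^sup>2)" unfolding poisson_kernel_def
            by (rule schwarz_kernel_bound[OF zM])
          then have "p t * cmod (poisson_kernel z t) \<le> p t * ((2 + 2 * M) / (1 + t\<^sup>2))" by (rule mult_left_mono[OF _ p_nonneg])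
          then show ?thesis using False p_nonneg[of t] by (simp add: norm_mult mult_ac)
        qed simp
      qed
      also have "\<dots> = (2 + 2 * M) * T n" unfolding T_def by (rule integral_mult_right_zero)
      finally show ?thesis by (simp add: norm_minus_commute)
    qed
    have "uniform_limit (cball z0 r) I (\<lambda>z. LINT t|lborel. of_real (p t) * poisson_kernel z t) sequentially"
    proof (rule uniform_limitI)
      fix e :: real assume e: "e > 0"
      have "(\<lambda>n. (2 + 2 * M) * T n) \<longlonglongrightarrow> (2 + 2 * M) * 0" using tail unfolding T_def by (intro tendsto_mult_left) simp
      then have "\<forall>\<^sub>F n in sequentially. (2 + 2 * M) * T n < e" using e by (simp add: order_tendstoD)
      moreover have "\<forall>\<^sub>F n in sequentially. real n \<ge> 2 * M + 1"
        using eventually_ge_at_top[of "nat \<lceil>2 * M + 1\<rceil>"] by eventually_elim linarith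
      ultimately show "\<forall>\<^sub>F n in sequentially. \<forall>z\<in>cball z0 r. dist (I n z) (LINT t|lborel. of_real (p t) * poisson_kernel z t) < e"
        by eventually_elim (use est in \<open>force simp: dist_norm\<close>)
    qed
    then have "(\<lambda>z. LINT t|lborel. of_real (p t) * poisson_kernel z t) holomorphic_on ball z0 r"
    proof (rule holomorphic_uniform_limit[rotated])
      show "\<forall>\<^sub>F n in sequentially. continuous_on (cball z0 r) (I n) \<and> I n holomorphic_on ball z0 r"
        using r(2) ball_subset_cball[of z0 r]
        by (intro always_eventually allI conjI holomorphic_on_imp_continuous_on)
           (rule holomorphic_on_subset[OF Ihol], blast)+
    qed auto
    then show "\<exists>f'. ((\<lambda>z. LINT t|lborel. of_real (p t) * poisson_kernel z t) has_field_derivative f') (at z0)"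
      using r(1) by (subst (asm) holomorphic_on_open) auto
  qed
  then show ?thesis unfolding poisson_extension_def[abs_def] by (intro holomorphic_intros) auto
qed

private lemma poisson_nonneg:
  assumes "Im z > 0"
  shows "poisson_integral p z \<ge> 0"
  unfolding poisson_integral_def using assms p_nonneg
  by (intro divide_nonneg_pos Bochner_Integration.integral_nonneg) (auto intro!: mult_nonneg_nonneg divide_nonneg_nonneg)

text \<open>The Poisson kernel mass of a small interval around x tends to 1 as z approaches x,
  \<open>p\<close> is at least \<open>q\<close> on that interval, and the rest of the integral is
  nonnegative.\<close>

private lemma poisson_lower_limit:
  assumes e: "e > 0"
  shows "\<exists>d>0. \<forall>z. Im z > 0 \<longrightarrow> dist z (of_real x) < d \<longrightarrow> poisson_integral p z \<ge> p x - e"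
proof -
  have "isCont p x" using cont_p by (simp add: continuous_on_eq_continuous_at)
  then obtain d1 where d1: "d1 > 0" "\<And>t. \<bar>t - x\<bar> < d1 \<Longrightarrow> \<bar>p t - p x\<bar> < e/2"
    using e unfolding continuous_at_eps_delta dist_real_def by (meson half_gt_zero)
  \<comment> \<open>Truncation at 0 keeps \<open>q\<close> a lower bound of p near x and makes
    multiplication by \<open>q\<close> monotone.\<close>
  define q where "q = max 0 (p x - e/2)"
  define d2 where "d2 = d1/2"
  have d2: "d2 > 0" using d1 by (simp add: d2_def)
  have pq: "p t \<ge> q" if "t \<in> {x - d2..x + d2}" for t
  proof -
    have "\<bar>t - x\<bar> < d1" using that d1(1) unfolding d2_def atLeastAtMost_iff by linarith
    then have "\<bar>p t - p x\<bar> < e/2" by (rule d1(2))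
    then show ?thesis using p_nonneg[of t] unfolding q_def by linarith
  qed
  have "((\<lambda>y. q * 2 / pi * arctan (d2 / (2 * y))) \<longlongrightarrow> q * 2 / pi * (pi / 2)) (at_right 0)"
  proof (intro tendsto_mult_left filterlim_compose[OF tendsto_arctan_at_top])
    have "filterlim (\<lambda>y::real. inverse y) at_top (at_right 0)" by (rule filterlim_inverse_at_top_right)
    then have "filterlim (\<lambda>y. (d2/2) * inverse y) at_top (at_right 0)"
      using d2 by (intro filterlim_tendsto_pos_mult_at_top[OF tendsto_const]) auto
    moreover have "d2/2 * inverse y = d2 / (2 * y)" for y by (simp add: divide_simps)
    ultimately show "filterlim (\<lambda>y. d2 / (2 * y)) at_top (at_right 0)" by (simp only:)
  qed
  then have "\<forall>\<^sub>F y in at_right 0. q * 2 / pi * arctan (d2 / (2 * y)) > q - e/2"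
    using e by (intro order_tendstoD) auto
  then obtain d3 where d3: "d3 > 0" "\<And>y. 0 < y \<Longrightarrow> y < d3 \<Longrightarrow> q * 2 / pi * arctan (d2 / (2 * y)) > q - e/2"
    by (auto simp: eventually_at_right_field)
  define d where "d = min d3 (d2/2)"
  have "poisson_integral p z \<ge> p x - e" if zH: "Im z > 0" and zd: "dist z (of_real x) < d" for z
  proof -
    define u y where "u = Re z" and "y = Im z"
    have uy: "\<bar>u - x\<bar> < d" "y < d" "y > 0"
      using zd zH abs_Re_le_cmod[of "z - of_real x"] abs_Im_le_cmod[of "z - of_real x"] by (auto simp: dist_norm u_def y_def)
    define k where "k t = y / ((u - t)\<^sup>2 + y\<^sup>2)" for t
    have k0: "k t \<ge> 0" for t using uy by (simp add: k_def)
    have den: "(u - t)\<^sup>2 + y\<^sup>2 \<noteq> 0" for t using uy by (simp add: add_nonneg_eq_0_iff)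
    have "(LINT t|lborel. indicator {x - d2..x + d2} t *\<^sub>R k t) = arctan ((x + d2 - u) / y) - arctan ((x - d2 - u) / y)"
    proof (rule integral_FTC_atLeastAtMost)
      show "x - d2 \<le> x + d2" using d2 by simp
      show "((\<lambda>t. arctan ((t - u) / y)) has_vector_derivative k t) (at t within {x - d2..x + d2})" for t
      proof -
        have "1 + ((t - u) / y)\<^sup>2 = ((u - t)\<^sup>2 + y\<^sup>2) / y\<^sup>2" using uy by (simp add: field_simps power2_commute)
        then have "inverse (1 + ((t - u) / y)\<^sup>2) * (1 / y) = k t" using uy den[of t] by (simp add: k_def field_simps power2_eq_square)
        moreover have "((\<lambda>t. arctan ((t - u) / y)) has_field_derivative inverse (1 + ((t - u) / y)\<^sup>2) * (1 / y)) (at t within {x - d2..x + d2})"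
          using uy by (auto intro!: derivative_eq_intros)
        ultimately show ?thesis by (simp add: has_real_derivative_iff_has_vector_derivative)
      qed
      show "continuous_on {x - d2..x + d2} k" unfolding k_def using den by (intro continuous_intros) auto
    qed
    also have "\<dots> \<ge> 2 * arctan (d2 / (2 * y))"
    proof -
      have "arctan (d2 / (2 * y)) \<le> arctan ((x + d2 - u) / y)"
      proof (rule arctan_monotone')
        have "d2 / 2 \<le> x + d2 - u" using uy unfolding d_def by linarith
        then have "d2 / 2 / y \<le> (x + d2 - u) / y" using uy by (intro divide_right_mono) auto
        then show "d2 / (2 * y) \<le> (x + d2 - u) / y" by simp
      qed
      moreover have "arctan ((x - d2 - u) / y) \<le> arctan (- (d2 / (2 * y)))"
      proof (rule arctan_monotone')
        have "x - d2 - u \<le> - (d2 / 2)" using uy unfolding d_def by linarith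
        then have "(x - d2 - u) / y \<le> - (d2 / 2) / y" using uy by (intro divide_right_mono) auto
        then show "(x - d2 - u) / y \<le> - (d2 / (2 * y))" by simp
      qed
      ultimately show ?thesis by (simp add: arctan_minus)
    qed
    finally have kint: "2 * arctan (d2 / (2 * y)) \<le> (LINT t|lborel. indicator {x - d2..x + d2} t *\<^sub>R k t)" .
    have intk: "integrable lborel (\<lambda>t. indicator {x - d2..x + d2} t *\<^sub>R k t)"
      using borel_integrable_atLeastAtMost'[of "x - d2" "x + d2" k] den unfolding set_integrable_def
      by (simp add: k_def continuous_intros)
    have "q * (2 * arctan (d2 / (2 * y))) \<le> q * (LINT t|lborel. indicator {x - d2..x + d2} t *\<^sub>R k t)"
      by (intro mult_left_mono kint) (simp add: q_def)
    also have "\<dots> = (LINT t|lborel. q * (indicator {x - d2..x + d2} t *\<^sub>R k t))" by simp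
    also have "\<dots> \<le> (LINT t|lborel. p t * k t)"
    proof (rule integral_mono)
      show "integrable lborel (\<lambda>t. p t * k t)" using integrable_poisson[OF zH] by (simp add: k_def u_def y_def)
      show "q * (indicator {x - d2..x + d2} t *\<^sub>R k t) \<le> p t * k t" for t
        using pq[of t] k0[of t] p_nonneg[of t] by (auto simp: indicator_def intro!: mult_right_mono)
    qed (intro integrable_mult_right intk)
    finally have "q * 2 / pi * arctan (d2 / (2 * y)) \<le> poisson_integral p z"
      unfolding poisson_integral_def k_def u_def y_def by (simp add: field_simps)
    then have "q - e/2 \<le> poisson_integral p z" using d3(2)[of y] uy by (simp add: d_def)
    then show ?thesis by (simp add: q_def)
  qed
  moreover have "d > 0" using d3 d2 by (simp add: d_def)
  ultimately show ?thesis by blast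
qed

text \<open>At i R the Poisson integral divided by R is 1 / pi times the integral of p / (t^2 +
  R^2), which is dominated by p / (1 + t^2) once R \<ge> 1. It provides points where Re Q is
  negligible compared to the height.\<close>

private lemma poisson_vertical_limit: "((\<lambda>R. poisson_integral p (\<i> * of_real R) / R) \<longlongrightarrow> 0) at_top"
proof -
  have [measurable]: "p \<in> borel_measurable borel" using cont_p by (rule borel_measurable_continuous_onI)
  have "((\<lambda>R. LINT t|lborel. p t / (t\<^sup>2 + R\<^sup>2)) \<longlongrightarrow> (LINT t|(lborel :: real measure). 0::real)) at_top"
  proof (rule Bochner_Integration.integral_dominated_convergence_at_top[where M = lborel and s = "\<lambda>R t. p t / (t\<^sup>2 + R\<^sup>2)" and f = "\<lambda>t. 0::real" and w = "\<lambda>t. p t / (1 + t\<^sup>2)"])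
    show "integrable lborel (\<lambda>t. p t / (1 + t\<^sup>2))" by (rule p_int)
    have "((\<lambda>R. p t / (t\<^sup>2 + R\<^sup>2)) \<longlongrightarrow> 0) at_top" for t
    proof (rule tendsto_divide_0[OF tendsto_const filterlim_at_top_imp_at_infinity])
      show "filterlim (\<lambda>R::real. t\<^sup>2 + R\<^sup>2) at_top at_top"
        by (intro filterlim_tendsto_add_at_top[OF tendsto_const] filterlim_pow_at_top filterlim_ident) auto
    qed
    then show "AE t in lborel. ((\<lambda>R. p t / (t\<^sup>2 + R\<^sup>2)) \<longlongrightarrow> 0) at_top" by simp
    show "\<forall>\<^sub>F R in at_top. AE t in lborel. norm (p t / (t\<^sup>2 + R\<^sup>2)) \<le> p t / (1 + t\<^sup>2)"
      using eventually_ge_at_top[of 1]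
    proof eventually_elim
      case (elim R)
      have "norm (p t / (t\<^sup>2 + R\<^sup>2)) \<le> p t / (1 + t\<^sup>2)" for t
      proof -
        have "1 \<le> R\<^sup>2" using elim by simp
        moreover have "0 < 1 + t\<^sup>2" by (intro add_pos_nonneg) auto
        ultimately have "p t / (t\<^sup>2 + R\<^sup>2) \<le> p t / (1 + t\<^sup>2)" using p_nonneg[of t]
          by (intro divide_left_mono mult_pos_pos) linarith+
        then show ?thesis using p_nonneg[of t] by simp
      qed
      then show ?case by simp
    qed
  qed auto
  then have "((\<lambda>R. (LINT t|lborel. p t / (t\<^sup>2 + R\<^sup>2)) / pi) \<longlongrightarrow> 0 / pi) at_top" by (intro tendsto_divide tendsto_const) auto
  moreover have "\<forall>\<^sub>F R in at_top. (LINT t|lborel. p t / (t\<^sup>2 + R\<^sup>2)) / pi = poisson_integral p (\<i> * of_real R) / R"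
    using eventually_gt_at_top[of 0]
  proof eventually_elim
    case (elim R)
    have "p t * (R / ((0 - t)\<^sup>2 + R\<^sup>2)) = R * (p t / (t\<^sup>2 + R\<^sup>2))" for t by simp
    then have "poisson_integral p (\<i> * of_real R) = R * (LINT t|lborel. p t / (t\<^sup>2 + R\<^sup>2)) / pi" 
      unfolding poisson_integral_def by (simp del: times_divide_eq_right)
    then show ?case using elim by simp
  qed
  ultimately show ?thesis by (simp add: tendsto_cong)
qed

lemma holomorphic_poisson_extension:
  obtains Q where "Q holomorphic_on {z. Im z > 0}" "\<And>z. Im z > 0 \<Longrightarrow> Re (Q z) \<ge> 0"
    "\<And>x e. e > 0 \<Longrightarrow> \<exists>d>0. \<forall>z. Im z > 0 \<longrightarrow> dist z (of_real x) < d \<longrightarrow> Re (Q z) \<ge> p x - e"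
    "((\<lambda>R. Re (Q (\<i> * of_real R)) / R) \<longlongrightarrow> 0) at_top"
proof (rule that[OF holomorphic_poisson_integral])
  show "Re (poisson_extension z) \<ge> 0" if "Im z > 0" for z using poisson_nonneg[OF that] by (simp add: Re_poisson_extension[OF that])
  show "\<exists>d>0. \<forall>z. Im z > 0 \<longrightarrow> dist z (of_real x) < d \<longrightarrow> Re (poisson_extension z) \<ge> p x - e" if "e > 0" for x e
    using poisson_lower_limit[OF that] by (metis Re_poisson_extension)
  have "\<forall>\<^sub>F R in at_top. poisson_integral p (\<i> * of_real R) / R = Re (poisson_extension (\<i> * of_real R)) / R"
    using eventually_gt_at_top[of 0] by eventually_elim (simp add: Re_poisson_extension)
  then show "((\<lambda>R. Re (poisson_extension (\<i> * of_real R)) / R) \<longlongrightarrow> 0) at_top"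
    using poisson_vertical_limit by (rule Lim_transform_eventually[rotated])
qed

end

section \<open>Phragmen-Lindelof bounds in the upper half-plane\<close>

text \<open>The map (R + z) / (R - z) sends the upper half-disc to the first quadrant. Its argument
  is harmonic, with boundary value 0 on the diameter and pi/2 on the semicircle.\<close>

lemma half_disc_barrier:
  assumes "Im z > 0" "cmod z < R"
  shows "Im (Ln ((of_real R + z) / (of_real R - z))) = arctan (2 * R * Im z / (R\<^sup>2 - (cmod z)\<^sup>2))"
    "(of_real R + z) / (of_real R - z) \<notin> \<real>\<^sub>\<le>\<^sub>0" "of_real R - z \<noteq> 0" "R\<^sup>2 - (cmod z)\<^sup>2 > 0"
proof -
  have R: "R > 0" using assms norm_ge_zero[of z] by linarith
  show nz: "of_real R - z \<noteq> 0" using assms by (auto simp: complex_eq_iff)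
  show pos: "R\<^sup>2 - (cmod z)\<^sup>2 > 0" using assms R by (simp add: power_strict_mono)
  define w where "w = (of_real R + z) / (of_real R - z)"
  define D where "D = (cmod (of_real R - z))\<^sup>2"
  have D: "D > 0" using nz by (simp add: D_def)
  have w: "w = (of_real R + z) * cnj (of_real R - z) / of_real D"
    unfolding w_def D_def by (subst complex_div_cnj) simp
  have Re_w: "Re w = (R\<^sup>2 - (cmod z)\<^sup>2) / D"
    unfolding w cmod_power2 by (simp add: power2_eq_square algebra_simps)
  have Im_w: "Im w = 2 * R * Im z / D"
    unfolding w by (simp add: algebra_simps)
  have Re_pos: "Re w > 0" using Re_w pos D by simp
  then show "(of_real R + z) / (of_real R - z) \<notin> \<real>\<^sub>\<le>\<^sub>0"
    unfolding w_def by (auto simp: complex_nonpos_Reals_iff)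
  have "w \<noteq> 0" using Re_pos by auto
  moreover have "Im w / Re w = 2 * R * Im z / (R\<^sup>2 - (cmod z)\<^sup>2)"
    unfolding Re_w Im_w using D pos by (simp add: field_simps)
  ultimately show "Im (Ln ((of_real R + z) / (of_real R - z))) = arctan (2 * R * Im z / (R\<^sup>2 - (cmod z)\<^sup>2))"
    using Re_pos Im_Ln_eq[of w] unfolding w_def by simp
qed

text \<open>The maximum principle on the half-disc: on the semicircle the barrier absorbs the growth
  of f, on the diameter the boundary behaviour of Re Q absorbs |f|. The barrier is finally estimated
  by arctan s \<le> s.\<close>

lemma half_plane_majorant_finite:
  fixes f Q :: "complex \<Rightarrow> complex"
  assumes f: "f holomorphic_on UNIV" and A: "A \<ge> 1" "B \<ge> 0" "\<And>z. cmod (f z) \<le> A * exp (B * cmod z)"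
    and Q: "Q holomorphic_on {z. Im z > 0}" "\<And>z. Im z > 0 \<Longrightarrow> Re (Q z) \<ge> 0"
    and bQ: "\<And>x e. e > 0 \<Longrightarrow> \<exists>d>0. \<forall>z. Im z > 0 \<longrightarrow> dist z (of_real x) < d \<longrightarrow> Re (Q z) \<ge> ln (max 1 (cmod (f (of_real x)))) - e"
    and z: "Im z > 0" "cmod z < R"
  shows "cmod (f z * exp (- Q z)) \<le> exp (4 / pi * (ln A + B * R) * (2 * R * Im z / (R\<^sup>2 - (cmod z)\<^sup>2)))"
proof -
  have R: "R > 0" using z norm_ge_zero[of z] by linarith
  define c where "c = ln A + B * R"
  have c: "c \<ge> 0" using A R by (simp add: c_def)
  define th where "th z = arctan (2 * R * Im z / (R\<^sup>2 - (cmod z)\<^sup>2))" for z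
  define S where "S = {z. Im z > 0} \<inter> ball 0 R"
  \<comment> \<open>The coefficient 4 c / pi is twice what the boundary value pi/2 would require. It
    then suffices that the argument is at least pi/4, and this holds in a whole neighbourhood of
    each point of the arc.\<close>
  define F where "F z = f z * exp (- Q z) * exp (\<i> * of_real (4 * c / pi) * Ln ((of_real R + z) / (of_real R - z)))" for z
  have openS: "open S" unfolding S_def by (intro open_Int open_Collect_less continuous_intros open_ball)
  have normF: "cmod (F z) = cmod (f z) * exp (- Re (Q z)) * exp (- (4 * c / pi * th z))" if "z \<in> S" for z
    using half_disc_barrier(1)[of z R] that by (simp add: F_def S_def th_def norm_mult)
  have th0: "th z \<ge> 0" if "z \<in> S" for z
    using half_disc_barrier(4)[of z R] that R by (simp add: th_def S_def zero_le_arctan_iff)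
  have fc: "cmod (f z) \<le> exp c" if "z \<in> S" for z
  proof -
    have "cmod (f z) \<le> A * exp (B * cmod z)" by (rule A)
    also have "\<dots> \<le> A * exp (B * R)" using that A by (intro mult_left_mono) (auto simp: S_def mult_left_mono)
    also have "\<dots> = exp c" using A by (simp add: c_def exp_add)
    finally show ?thesis .
  qed
  have le_fQ: "cmod (F z) \<le> cmod (f z) * exp (- Re (Q z))" if "z \<in> S" for z
    unfolding normF[OF that] using th0[OF that] c by (intro mult_right_le_one_le) auto
  have zS: "z \<in> S" using z by (simp add: S_def)
  have "cmod (F z) \<le> 1"
  proof (rule maximum_modulus_boundary_limsup[OF _ openS _ _ zS])
    show "F holomorphic_on S" unfolding F_def
      using half_disc_barrier(2,3)[of _ R]
      by (intro holomorphic_intros holomorphic_on_subset[OF f] holomorphic_on_subset[OF Q(1)]) (auto simp: S_def)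
    show "bounded S" by (rule bounded_subset[OF bounded_ball[of 0 R]]) (auto simp: S_def)
    fix w e assume w: "w \<in> frontier S" and e: "(e::real) > 0"
    have "closure S \<subseteq> {z. Im z \<ge> 0} \<inter> cball 0 R"
      by (rule closure_minimal) (auto simp: S_def intro!: closed_Int closed_Collect_le continuous_intros)
    then have w': "Im w \<ge> 0" "cmod w \<le> R" "w \<notin> S"
      using w openS by (auto simp: frontier_def interior_open)
    show "\<exists>d>0. \<forall>z\<in>S. dist z w < d \<longrightarrow> cmod (F z) \<le> 1 + e"
    proof (cases "Im w = 0")
      case False
      then have "Im w > 0" "cmod w = R" using w' by (auto simp: S_def)
      then have "2 * R * Im w - (R\<^sup>2 - (cmod w)\<^sup>2) > 0" using R by simp
      moreover have "((\<lambda>z. 2 * R * Im z - (R\<^sup>2 - (cmod z)\<^sup>2)) \<longlongrightarrow> 2 * R * Im w - (R\<^sup>2 - (cmod w)\<^sup>2)) (at w)" by (intro tendsto_intros)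
      ultimately have "\<forall>\<^sub>F z in at w. 2 * R * Im z - (R\<^sup>2 - (cmod z)\<^sup>2) > 0"
        by (rule order_tendstoD(1)[rotated])
      then obtain d where d: "d > 0" "\<And>z. z \<noteq> w \<Longrightarrow> dist z w < d \<Longrightarrow> 2 * R * Im z - (R\<^sup>2 - (cmod z)\<^sup>2) > 0"
        unfolding eventually_at by auto
      have "cmod (F z) \<le> 1 + e" if zS: "z \<in> S" and zd: "dist z w < d" for z
      proof -
        have "z \<noteq> w" using zS w' by auto
        then have "R\<^sup>2 - (cmod z)\<^sup>2 \<le> 2 * R * Im z" using d(2) zd by force
        moreover have "R\<^sup>2 - (cmod z)\<^sup>2 > 0" using half_disc_barrier(4)[of z R] zS by (simp add: S_def)
        ultimately have "1 \<le> 2 * R * Im z / (R\<^sup>2 - (cmod z)\<^sup>2)" by simp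
        then have "arctan 1 \<le> th z" unfolding th_def by (rule arctan_monotone')
        then have "4 / pi * c * (pi / 4) \<le> 4 / pi * c * th z" using c by (intro mult_left_mono) (auto simp: arctan_one)
        then have "exp (- (4 * c / pi * th z)) \<le> exp (- c)" by simp
        moreover have "exp (- Re (Q z)) \<le> 1" using Q(2) zS by (simp add: S_def)
        ultimately have "cmod (F z) \<le> exp c * 1 * exp (- c)" unfolding normF[OF zS]
          by (intro mult_mono fc zS) auto
        then show ?thesis using e by (simp flip: exp_add)
      qed
      then show ?thesis using d(1) by blast
    next
      case True
      define x where "x = Re w"
      have wx: "w = of_real x" using True by (simp add: x_def complex_eq_iff)
      define q where "q = max 1 (cmod (f w))"
      \<comment> \<open>The error enters twice, through |f| and through Re Q, hence half of ln (1 +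
        e). The corners -R and R belong to this case, which uses only that the barrier is
        nonnegative.\<close>
      define \<epsilon> where "\<epsilon> = ln (1 + e) / 2"
      have \<epsilon>: "\<epsilon> > 0" using e by (simp add: \<epsilon>_def)
      obtain d1 where d1: "d1 > 0" "\<And>z. Im z > 0 \<Longrightarrow> dist z w < d1 \<Longrightarrow> Re (Q z) \<ge> ln q - \<epsilon>"
        using bQ[OF \<epsilon>, of x] unfolding wx q_def by blast
      have "isCont f w" using f holomorphic_on_imp_continuous_on continuous_on_eq_continuous_at open_UNIV by blast
      then have "((\<lambda>z. cmod (f z)) \<longlongrightarrow> cmod (f w)) (nhds w)" unfolding isCont_def tendsto_at_iff_tendsto_nhds
        by (rule tendsto_norm)
      moreover have "cmod (f w) < q * exp \<epsilon>"
      proof -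
        have "cmod (f w) \<le> q * 1" by (simp add: q_def)
        also have "\<dots> < q * exp \<epsilon>" using \<epsilon> by (intro mult_strict_left_mono) (auto simp: q_def)
        finally show ?thesis .
      qed
      ultimately have "\<forall>\<^sub>F z in nhds w. cmod (f z) < q * exp \<epsilon>" by (rule order_tendstoD(2))
      then obtain d2 where d2: "d2 > 0" "\<And>z. dist z w < d2 \<Longrightarrow> cmod (f z) < q * exp \<epsilon>"
        unfolding eventually_nhds_metric by blast
      have "cmod (F z) \<le> 1 + e" if zS: "z \<in> S" and zd: "dist z w < min d1 d2" for z
      proof -
        have "cmod (F z) \<le> cmod (f z) * exp (- Re (Q z))" by (rule le_fQ[OF zS])
        also have "\<dots> \<le> (q * exp \<epsilon>) * exp (- (ln q - \<epsilon>))"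
          using d1(2)[of z] d2(2)[of z] zd zS by (intro mult_mono) (auto simp: S_def q_def)
        also have "\<dots> = exp (ln q) * (exp \<epsilon> * (exp (- ln q) * exp \<epsilon>))"
          by (simp add: q_def exp_diff exp_minus field_simps)
        also have "\<dots> = exp (2 * \<epsilon>)" by (simp flip: exp_add)
        also have "\<dots> = 1 + e" using e by (simp add: \<epsilon>_def)
        finally show ?thesis .
      qed
      then show ?thesis using d1(1) d2(1) by (intro exI[of _ "min d1 d2"]) auto
    qed
  qed
  then have "cmod (f z * exp (- Q z)) * exp (- (4 * c / pi * th z)) \<le> 1"
    unfolding normF[OF zS] by (simp add: norm_mult)
  then have "cmod (f z * exp (- Q z)) * exp (- (4 * c / pi * th z)) * exp (4 * c / pi * th z) \<le> 1 * exp (4 * c / pi * th z)"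
    by (rule mult_right_mono) simp
  then have "cmod (f z * exp (- Q z)) \<le> exp (4 * c / pi * th z)"
    by (simp add: mult.assoc flip: exp_add)
  also have "\<dots> \<le> exp (4 / pi * c * (2 * R * Im z / (R\<^sup>2 - (cmod z)\<^sup>2)))"
  proof -
    have "th z \<le> 2 * R * Im z / (R\<^sup>2 - (cmod z)\<^sup>2)" unfolding th_def
      using z R half_disc_barrier(4)[of z R] by (intro arctan_le_self) auto
    then have "4 * c / pi * th z \<le> 4 * c / pi * (2 * R * Im z / (R\<^sup>2 - (cmod z)\<^sup>2))" using c by (intro mult_left_mono) auto
    then show ?thesis by simp
  qed
  finally show ?thesis by (simp add: c_def)
qed

text \<open>As R tends to infinity the exponent tends to 8 B / pi times Im z. The constant is not
  sharp; any linear bound will do, because the best exponent is chosen afterwards.\<close>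

lemma half_plane_majorant:
  fixes f Q :: "complex \<Rightarrow> complex"
  assumes f: "f holomorphic_on UNIV" and A: "A \<ge> 1" "B \<ge> 0" "\<And>z. cmod (f z) \<le> A * exp (B * cmod z)"
    and Q: "Q holomorphic_on {z. Im z > 0}" "\<And>z. Im z > 0 \<Longrightarrow> Re (Q z) \<ge> 0"
    and bQ: "\<And>x e. e > 0 \<Longrightarrow> \<exists>d>0. \<forall>z. Im z > 0 \<longrightarrow> dist z (of_real x) < d \<longrightarrow> Re (Q z) \<ge> ln (max 1 (cmod (f (of_real x)))) - e"
    and z: "Im z > 0"
  shows "cmod (f z * exp (- Q z)) \<le> exp (8 * B / pi * Im z)"
proof (rule tendsto_lowerbound)
  define y where "y = Im z"
  have lim: "((\<lambda>R. 4 / pi * (ln A / R + B) * (2 * y / (1 - (cmod z)\<^sup>2 / R\<^sup>2))) \<longlongrightarrow> 4 / pi * (0 + B) * (2 * y / (1 - 0))) at_top"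
    by (intro tendsto_intros tendsto_divide_0[OF tendsto_const] filterlim_at_top_imp_at_infinity filterlim_pow_at_top filterlim_ident) auto
  have ev: "\<forall>\<^sub>F R in at_top. 4 / pi * (ln A / R + B) * (2 * y / (1 - (cmod z)\<^sup>2 / R\<^sup>2)) = 4 / pi * (ln A + B * R) * (2 * R * y / (R\<^sup>2 - (cmod z)\<^sup>2))"
    using eventually_gt_at_top[of "cmod z"]
  proof eventually_elim
    case (elim R)
    have R: "R > 0" using elim norm_ge_zero[of z] by linarith
    have p: "R\<^sup>2 - (cmod z)\<^sup>2 \<noteq> 0" using elim R by (simp add: power_strict_mono less_imp_neq)
    have "1 - (cmod z)\<^sup>2 / R\<^sup>2 = (R\<^sup>2 - (cmod z)\<^sup>2) / R\<^sup>2" using R by (simp add: field_simps)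
    then have "(2 * y / (1 - (cmod z)\<^sup>2 / R\<^sup>2)) = 2 * y * R\<^sup>2 / (R\<^sup>2 - (cmod z)\<^sup>2)" by simp
    moreover have "ln A / R + B = (ln A + B * R) / R" using R by (simp add: field_simps)
    ultimately show ?case using R p by (simp add: power2_eq_square)
  qed
  have "4 / pi * (0 + B) * (2 * y / (1 - 0)) = 8 * B / pi * Im z" by (simp add: y_def)
  with Lim_transform_eventually[OF lim ev]
  have "((\<lambda>R. 4 / pi * (ln A + B * R) * (2 * R * y / (R\<^sup>2 - (cmod z)\<^sup>2))) \<longlongrightarrow> 8 * B / pi * Im z) at_top"
    by (simp only:)
  then show "((\<lambda>R. exp (4 / pi * (ln A + B * R) * (2 * R * y / (R\<^sup>2 - (cmod z)\<^sup>2)))) \<longlongrightarrow> exp (8 * B / pi * Im z)) at_top"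
    by (rule tendsto_exp)
  show "\<forall>\<^sub>F R in at_top. cmod (f z * exp (- Q z)) \<le> exp (4 / pi * (ln A + B * R) * (2 * R * y / (R\<^sup>2 - (cmod z)\<^sup>2)))"
    using eventually_gt_at_top[of "cmod z"] unfolding y_def
    by eventually_elim (rule half_plane_majorant_finite[OF f A Q bQ z])
qed simp

text \<open>The infimum of the admissible exponents is itself admissible, each condition being
  closed, and a point with F \<noteq> 0 bounds the exponents from below.\<close>

lemma best_exponential_majorant:
  fixes F :: "complex \<Rightarrow> complex"
  assumes F: "\<And>z. Im z > 0 \<Longrightarrow> cmod (F z) \<le> exp (C * Im z)" and nz: "Im z1 > 0" "F z1 \<noteq> 0"
  obtains \<sigma> where "\<And>z. Im z > 0 \<Longrightarrow> cmod (F z) \<le> exp (\<sigma> * Im z)"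
    "\<And>e. e > 0 \<Longrightarrow> \<exists>z. Im z > 0 \<and> cmod (F z) > exp ((\<sigma> - e) * Im z)"
proof -
  define X where "X = {C. \<forall>z. Im z > 0 \<longrightarrow> cmod (F z) \<le> exp (C * Im z)}"
  have ne: "X \<noteq> {}" using F by (auto simp: X_def)
  have lb: "ln (cmod (F z)) / Im z \<le> C" if "C \<in> X" "Im z > 0" "F z \<noteq> 0" for C z
  proof -
    have "cmod (F z) \<le> exp (C * Im z)" using that by (simp add: X_def)
    then have "ln (cmod (F z)) \<le> C * Im z" using that by (metis ln_exp ln_le_cancel_iff exp_gt_zero zero_less_norm_iff)
    then show ?thesis using that by (simp add: field_simps)
  qed
  have bdd: "bdd_below X" using lb[OF _ nz] by (auto intro!: bdd_belowI)
  show thesis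
  proof (rule that[of "Inf X"])
    fix z assume z: "Im z > 0"
    show "cmod (F z) \<le> exp (Inf X * Im z)"
    proof (cases "F z = 0")
      case False
      have "ln (cmod (F z)) / Im z \<le> Inf X" using lb z False by (intro cInf_greatest ne) auto
      then have "ln (cmod (F z)) \<le> Inf X * Im z" using z by (simp add: field_simps)
      then show ?thesis using False by (metis exp_le_cancel_iff exp_ln zero_less_norm_iff)
    qed simp
  next
    fix e :: real assume "e > 0"
    then have "Inf X - e \<notin> X" using cInf_lower[OF _ bdd, of "Inf X - e"] by auto
    then show "\<exists>z. Im z > 0 \<and> cmod (F z) > exp ((Inf X - e) * Im z)" by (auto simp: X_def not_le)
  qed
qed

section \<open>Propagation of one small value to all larger scales\<close>

lemma cis_close_to_minus_i:
  assumes "\<bar>t - 3 * pi / 2\<bar> \<le> d"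
  shows "cmod (\<i> + cis t) \<le> d"
proof -
  define s where "s = t - 3 * pi / 2"
  have t: "t = s + (pi + pi/2)" by (simp add: s_def)
  have "sin t = - cos s" "cos t = sin s" unfolding t sin_add cos_add by (simp_all add: sin_add cos_add)
  then have "(cmod (\<i> + cis t))\<^sup>2 = (sin s)\<^sup>2 + (1 - cos s)\<^sup>2" by (simp add: cmod_power2)
  also have "\<dots> = 2 - 2 * cos s" using sin_cos_squared_add[of s] by (simp add: power2_diff)
  also have "\<dots> = (2 * sin (s/2))\<^sup>2" using cos_double_sin[of "s/2"] by (simp add: power_mult_distrib)
  also have "\<dots> \<le> d\<^sup>2"
  proof -
    have "\<bar>2 * sin (s/2)\<bar> \<le> \<bar>s\<bar>" using abs_sin_x_le_abs_x[of "s/2"] by simp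
    then have "\<bar>2 * sin (s/2)\<bar> \<le> \<bar>d\<bar>" using assms by (simp add: s_def)
    then show ?thesis by (rule abs_le_square_iff[THEN iffD1])
  qed
  finally show ?thesis by (rule power2_le_imp_le) (use assms in linarith)
qed

text \<open>The disc of radius T around Re z0 + i T touches the real axis and has z0 on its vertical
  radius, at distance Im z0 from the circle. The Harnack factor is thus of order T / Im z0 and turns
  the bound e Im z0 into one of order e T: smallness relative to the height is inherited by a point
  near the top of the circle.\<close>

lemma deep_point_neglog:
  assumes G: "G holomorphic_on {z. Im z > 0}" and le: "\<And>z. Im z > 0 \<Longrightarrow> cmod (G z) \<le> 1"
    and z0: "Im z0 > 0" "neglog (G z0) \<le> ennreal (e * Im z0)" and e: "e > 0"
    and T: "T > Im z0" "T \<ge> 10 * \<bar>Re z0\<bar>"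
  shows "\<exists>\<zeta>. dist \<zeta> (Complex (ln (2 * T)) (pi/2)) \<le> 1/5 \<and> neglog (G (exp \<zeta>)) \<le> ennreal (63 * T * e)"
proof -
  define H where "H = {z. Im z > 0}"
  define c where "c = Complex (Re z0) T"
  have T0: "T > 0" using T z0 by linarith
  have dc: "dist c z0 = T - Im z0"
  proof -
    have "c - z0 = \<i> * of_real (T - Im z0)" by (simp add: c_def complex_eq_iff)
    then have "cmod (c - z0) = \<bar>T - Im z0\<bar>" by (simp only: norm_mult norm_ii norm_of_real) simp
    then show ?thesis using T by (simp add: dist_norm)
  qed
  have openH: "open H" unfolding H_def by (intro open_Collect_less continuous_intros)
  have sub: "ball c T \<subseteq> H"
  proof
    fix z assume "z \<in> ball c T"
    then have "\<bar>Im (c - z)\<bar> < T" using abs_Im_le_cmod[of "c - z"] by (simp add: dist_norm)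
    then have "Im z > 0" unfolding c_def minus_complex.sel complex.sel by linarith
    then show "z \<in> H" by (simp add: H_def)
  qed
  \<comment> \<open>An arc of length 1/5 around t = 3 pi / 2, the highest point of c - T e^{it}. If
    - ln |G| exceeded 63 T e on all of it, the integral would be at least 63/5 T e, more than 4 pi T
    e.\<close>
  define J where "J = {3*pi/2 - 1/10..3*pi/2 + 1/10}"
  have mean: "(\<integral>\<^sup>+t. neglog (G (c - T * cis t)) * indicator ({t. c - T * cis t \<in> H} \<inter> {0..2*pi}) t \<partial>lborel) \<le> ennreal (4 * pi * T * e)"
  proof -
    have "(\<integral>\<^sup>+t. neglog (G (c - T * cis t)) * indicator ({t. c - T * cis t \<in> H} \<inter> {0..2*pi}) t \<partial>lborel)
        \<le> ennreal (2 * pi * (T + dist c z0) / (T - dist c z0)) * neglog (G z0)"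
      using G le z0 by (intro circle_neglog_le[OF openH sub]) (auto simp: H_def dc)
    also have "\<dots> \<le> ennreal (2 * pi * (T + dist c z0) / (T - dist c z0)) * ennreal (e * Im z0)"
      by (intro mult_left_mono z0) simp
    also have "\<dots> = ennreal (2 * pi * (T + dist c z0) / (T - dist c z0) * (e * Im z0))"
      using T z0 e by (intro ennreal_mult[symmetric]) (auto simp: dc)
    also have "\<dots> \<le> ennreal (4 * pi * T * e)"
    proof (rule ennreal_leI)
      have "2 * pi * (T + dist c z0) / (T - dist c z0) * (e * Im z0) = 2 * pi * (2 * T - Im z0) * e"
        using z0 by (simp add: dc)
      also have "\<dots> \<le> 2 * pi * (2 * T) * e" using z0 e by (intro mult_right_mono mult_left_mono) auto
      finally show "2 * pi * (T + dist c z0) / (T - dist c z0) * (e * Im z0) \<le> 4 * pi * T * e" by simp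
    qed
    finally show ?thesis .
  qed
  have Jin: "c - T * cis t \<in> H \<and> t \<in> {0..2*pi}" if t: "t \<in> J" for t
  proof -
    have tb: "\<bar>t - 3 * pi / 2\<bar> \<le> 1/10" using t unfolding J_def atLeastAtMost_iff by linarith
    from cis_close_to_minus_i[OF this] have "\<bar>Im (\<i> + cis t)\<bar> \<le> 1/10" using abs_Im_le_cmod order_trans by blast
    then have "\<bar>1 + sin t\<bar> \<le> 1/10" by (simp only: plus_complex.sel imaginary_unit.sel cis.sel)
    then have "sin t < 0" by linarith
    then have "T - T * sin t > 0" using T0 by (simp add: mult_pos_neg add_pos_pos less_trans[of _ 0])
    then have "c - T * cis t \<in> H" by (simp add: H_def c_def)
    moreover have "t \<in> {0..2*pi}" using tb pi_gt3 unfolding atLeastAtMost_iff abs_le_iff by linarith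
    ultimately show ?thesis by blast
  qed
  have "\<exists>t\<in>J. neglog (G (c - T * cis t)) \<le> ennreal (63 * T * e)"
  proof (rule ccontr)
    assume "\<not> ?thesis"
    then have gt: "neglog (G (c - T * cis t)) \<ge> ennreal (63 * T * e)" if "t \<in> J" for t using that by force
    have "ennreal (63 * T * e / 5) = ennreal (63 * T * e) * ennreal (1/5)"
      using T0 e by (subst ennreal_mult[symmetric]) auto
    also have "\<dots> = (\<integral>\<^sup>+t. ennreal (63 * T * e) * indicator J t \<partial>lborel)"
      unfolding J_def by (subst nn_integral_cmult_indicator) auto
    also have "\<dots> \<le> (\<integral>\<^sup>+t. neglog (G (c - T * cis t)) * indicator ({t. c - T * cis t \<in> H} \<inter> {0..2*pi}) t \<partial>lborel)"
      using gt Jin by (intro nn_integral_mono) (auto simp: indicator_def)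
    also have "\<dots> \<le> ennreal (4 * pi * T * e)" by (rule mean)
    finally have "63 * T * e / 5 \<le> 4 * pi * T * e" using T0 e by (subst (asm) ennreal_le_iff) auto
    moreover have "4 * pi < 63 / 5" using pi_approx by simp
    then have "4 * pi * (T * e) < 63 / 5 * (T * e)" using T0 e by (intro mult_strict_right_mono) auto
    ultimately show False by (simp add: mult_ac)
  qed
  then obtain t where t: "t \<in> J" "neglog (G (c - T * cis t)) \<le> ennreal (63 * T * e)" by blast
  \<comment> \<open>The relative deviation of the chosen point from 2 i T. The horizontal offset |Re
    z0| \<le> T/10 and the arc contribute 1/20 each; then |Ln (1 + \<eta>)| \<le> 1/5, the tolerance
    accepted by \<open>polar_average_neglog_le\<close>.\<close>
  define \<eta> where "\<eta> = (c - T * cis t) / (2 * \<i> * T) - 1"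
  have \<eta>: "cmod \<eta> \<le> 1/10"
  proof -
    have "\<eta> = (of_real (Re z0) - T * (\<i> + cis t)) / (2 * \<i> * T)"
      using T0 by (simp add: \<eta>_def c_def Complex_eq field_simps)
    then have "cmod \<eta> = cmod (of_real (Re z0) - T * (\<i> + cis t)) / (2 * T)"
      using T0 by (simp add: norm_divide norm_mult)
    also have "\<dots> \<le> (\<bar>Re z0\<bar> + T * cmod (\<i> + cis t)) / (2 * T)"
      using norm_triangle_ineq4[of "of_real (Re z0)" "T * (\<i> + cis t)"] T0
      by (intro divide_right_mono) (auto simp: norm_mult)
    also have "\<dots> \<le> (T / 10 + T * (1/10)) / (2 * T)"
    proof -
      have "\<bar>t - 3 * pi / 2\<bar> \<le> 1/10" using t(1) unfolding J_def atLeastAtMost_iff by linarith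
      then show ?thesis using T T0 cis_close_to_minus_i[of t "1/10"] by (intro divide_right_mono add_mono mult_left_mono) auto
    qed
    also have "\<dots> = 1/10" using T0 by simp
    finally show ?thesis .
  qed
  define \<zeta> where "\<zeta> = Complex (ln (2 * T)) (pi/2) + Ln (1 + \<eta>)"
  have "1 + \<eta> \<noteq> 0"
  proof
    assume "1 + \<eta> = 0"
    then have "\<eta> = - 1" by (simp add: add_eq_0_iff)
    then show False using \<eta> by simp
  qed
  then have "exp \<zeta> = exp (Complex (ln (2 * T)) (pi/2)) * (1 + \<eta>)" by (simp add: \<zeta>_def exp_add)
  also have "exp (Complex (ln (2 * T)) (pi/2)) = 2 * \<i> * T" using T0 by (simp add: complex_eq_iff Re_exp Im_exp)
  also have "2 * \<i> * T * (1 + \<eta>) = c - T * cis t" using T0 by (simp add: \<eta>_def)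
  finally have "neglog (G (exp \<zeta>)) \<le> ennreal (63 * T * e)" using t by simp
  moreover have "dist \<zeta> (Complex (ln (2 * T)) (pi/2)) \<le> 1/5"
    using norm_Ln_le[of \<eta>] \<eta> by (simp add: \<zeta>_def dist_norm)
  ultimately show ?thesis by blast
qed

section \<open>Limits in mean on circles\<close>

lemma measurable_Complex [measurable (raw)]:
  assumes [measurable]: "p \<in> borel_measurable M" "q \<in> borel_measurable M"
  shows "(\<lambda>x. Complex (p x) (q x)) \<in> borel_measurable M"
  unfolding Complex_eq by measurable

text \<open>An integral over a half-annulus in logarithmic coordinates, where d\<xi> d\<theta> is
  area divided by |z|^2. The order of integration makes the inner integral a mean over one
  half-circle, from which good radii can be selected.\<close>

definition polar_average :: "(complex \<Rightarrow> ennreal) \<Rightarrow> real \<Rightarrow> ennreal" where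
  "polar_average u \<xi>0 = (\<integral>\<^sup>+\<xi>. (\<integral>\<^sup>+\<theta>. u (exp (Complex \<xi> \<theta>)) * indicator {0<..<pi} \<theta> \<partial>lborel) * indicator {\<xi>0..\<xi>0+1/10} \<xi> \<partial>lborel)"

lemma measurable_polar_neglog:
  assumes G: "G holomorphic_on {z. Im z > 0}"
  shows "(\<lambda>(\<xi>, \<theta>). neglog (G (exp (Complex \<xi> \<theta>))) * indicator {0<..<pi} \<theta>) \<in> borel_measurable (borel \<Otimes>\<^sub>M borel)"
proof -
  define S where "S = {\<zeta>. 0 < Im \<zeta> \<and> Im \<zeta> < pi}"
  define g where "g \<zeta> = (if \<zeta> \<in> S then G (exp \<zeta>) else 1)" for \<zeta>
  have openS: "open S" unfolding S_def by (intro open_Collect_conj open_Collect_less continuous_intros)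
  have holS: "(\<lambda>\<zeta>. G (exp \<zeta>)) holomorphic_on S"
    by (rule holomorphic_on_compose_gen[OF _ G, of exp S, unfolded o_def])
       (auto intro!: holomorphic_intros simp: S_def Im_exp sin_gt_zero)
  have [measurable]: "g \<in> borel_measurable borel" unfolding g_def
    using openS holomorphic_on_imp_continuous_on[OF holS]
    by (intro borel_measurable_continuous_on_if) auto
  have "(\<lambda>(\<xi>, \<theta>). neglog (G (exp (Complex \<xi> \<theta>))) * indicator {0<..<pi} \<theta>) = (\<lambda>p. neglog (g (Complex (fst p) (snd p))) * indicator {0<..<pi} (snd p))"
    by (auto simp: g_def S_def indicator_def fun_eq_iff)
  then show ?thesis by simp
qed

lemma polar_average_add_neglog:
  assumes "G holomorphic_on {z. Im z > 0}" "F holomorphic_on {z. Im z > 0}"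
  shows "polar_average (\<lambda>z. neglog (G z) + neglog (F z)) \<xi>0 = polar_average (\<lambda>z. neglog (G z)) \<xi>0 + polar_average (\<lambda>z. neglog (F z)) \<xi>0"
proof -
  have [measurable]: "(\<lambda>p. neglog (G (exp (Complex (fst p) (snd p)))) * indicator {0<..<pi} (snd p)) \<in> borel_measurable (borel \<Otimes>\<^sub>M borel)"
     "(\<lambda>p. neglog (F (exp (Complex (fst p) (snd p)))) * indicator {0<..<pi} (snd p)) \<in> borel_measurable (borel \<Otimes>\<^sub>M borel)"
    using assms[THEN measurable_polar_neglog] by (simp_all add: case_prod_unfold)
  have m1: "(\<lambda>\<theta>. neglog (G (exp (Complex \<xi> \<theta>))) * indicator {0<..<pi} \<theta>) \<in> borel_measurable borel"
     "(\<lambda>\<theta>. neglog (F (exp (Complex \<xi> \<theta>))) * indicator {0<..<pi} \<theta>) \<in> borel_measurable borel" for \<xi>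
    using measurable_compose[OF _ measurable_polar_neglog[OF assms(1)], of "\<lambda>\<theta>. (\<xi>, \<theta>)" borel]
      measurable_compose[OF _ measurable_polar_neglog[OF assms(2)], of "\<lambda>\<theta>. (\<xi>, \<theta>)" borel] by simp_all
  have m2: "(\<lambda>\<xi>. \<integral>\<^sup>+\<theta>. neglog (G (exp (Complex \<xi> \<theta>))) * indicator {0<..<pi} \<theta> \<partial>lborel) \<in> borel_measurable borel"
     "(\<lambda>\<xi>. \<integral>\<^sup>+\<theta>. neglog (F (exp (Complex \<xi> \<theta>))) * indicator {0<..<pi} \<theta> \<partial>lborel) \<in> borel_measurable borel"
    using assms[THEN measurable_polar_neglog] by (intro lborel.borel_measurable_nn_integral; simp)+
  show ?thesis unfolding polar_average_def
    using m1 m2 by (simp add: distrib_right nn_integral_add)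
qed

lemma polar_average_mono:
  assumes "\<And>z. Im z > 0 \<Longrightarrow> u z \<le> v z"
  shows "polar_average u \<xi>0 \<le> polar_average v \<xi>0"
proof -
  have "u (exp (Complex \<xi> \<theta>)) * indicator {0<..<pi} \<theta> \<le> v (exp (Complex \<xi> \<theta>)) * indicator {0<..<pi} \<theta>" for \<xi> \<theta>
    using assms[of "exp (Complex \<xi> \<theta>)"] by (auto simp: indicator_def Im_exp sin_gt_zero)
  then show ?thesis unfolding polar_average_def
    by - (rule nn_integral_mono, rule mult_right_mono, rule nn_integral_mono, simp_all)
qed

text \<open>A single point with - ln |G| \<le> e Im z0 settles all large \<xi>0 at once: with ln (2
  T) = \<xi>0 - pi/4 the estimate is carried to height about 2 T and from there spread over the
  half-annulus.\<close>

lemma polar_average_neglog_small: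
  assumes G: "G holomorphic_on {z. Im z > 0}" and le: "\<And>z. Im z > 0 \<Longrightarrow> cmod (G z) \<le> 1"
    and small: "\<And>e. e > 0 \<Longrightarrow> \<exists>z0. Im z0 > 0 \<and> neglog (G z0) \<le> ennreal (e * Im z0)" and \<epsilon>: "\<epsilon> > 0"
  shows "\<exists>\<xi>1. \<forall>\<xi>0\<ge>\<xi>1. polar_average (\<lambda>z. neglog (G z)) \<xi>0 \<le> ennreal (\<epsilon> * exp \<xi>0)"
proof -
  \<comment> \<open>The constants multiply to 200 * 63 / 10000 = 1.26 < 2, and 2 T \<le> exp
    \<xi>0.\<close>
  define e where "e = \<epsilon> / 10000"
  have e: "e > 0" using \<epsilon> by (simp add: e_def)
  obtain z0 where z0: "Im z0 > 0" "neglog (G z0) \<le> ennreal (e * Im z0)" using small[OF e] by blast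
  define K where "K = Im z0 + 10 * \<bar>Re z0\<bar> + 1"
  have K: "K > 0" using z0 by (simp add: K_def)
  have "polar_average (\<lambda>z. neglog (G z)) \<xi>0 \<le> ennreal (\<epsilon> * exp \<xi>0)" if \<xi>0: "\<xi>0 \<ge> ln (2 * K) + pi/4" for \<xi>0
  proof -
    define T where "T = exp (\<xi>0 - pi/4) / 2"
    have T2: "2 * T = exp (\<xi>0 - pi/4)" by (simp add: T_def)
    have "exp (ln (2 * K)) \<le> exp (\<xi>0 - pi/4)" using \<xi>0 by simp
    then have TK: "K \<le> T" using K T2 by simp
    have lnT: "ln (2 * T) = \<xi>0 - pi/4" unfolding T2 by simp
    obtain \<zeta> where \<zeta>: "dist \<zeta> (Complex (ln (2 * T)) (pi/2)) \<le> 1/5" "neglog (G (exp \<zeta>)) \<le> ennreal (63 * T * e)"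
    proof -
      have "\<exists>\<zeta>. dist \<zeta> (Complex (ln (2 * T)) (pi/2)) \<le> 1/5 \<and> neglog (G (exp \<zeta>)) \<le> ennreal (63 * T * e)"
        by (rule deep_point_neglog[OF G _ z0 e]) (use TK z0(1) le in \<open>auto simp: K_def\<close>)
      then show ?thesis using that by blast
    qed
    have "polar_average (\<lambda>z. neglog (G z)) \<xi>0 \<le> ennreal 200 * neglog (G (exp \<zeta>))"
      unfolding polar_average_def using \<zeta>(1) unfolding lnT by (intro polar_average_neglog_le[OF G]) (auto intro: le)
    also have "\<dots> \<le> ennreal 200 * ennreal (63 * T * e)" by (intro mult_left_mono \<zeta>) simp
    also have "\<dots> = ennreal (200 * (63 * T * e))" using TK K e by (subst ennreal_mult[symmetric]) auto
    also have "\<dots> \<le> ennreal (\<epsilon> * exp \<xi>0)"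
    proof (rule ennreal_leI)
      have "2 * T \<le> exp \<xi>0" unfolding T2 by simp
      then have "\<epsilon> * (2 * T) \<le> \<epsilon> * exp \<xi>0" using \<epsilon> by (intro mult_left_mono) auto
      moreover have "200 * (63 * T * e) \<le> \<epsilon> * (2 * T)" using \<epsilon> TK K by (simp add: e_def)
      ultimately show "200 * (63 * T * e) \<le> \<epsilon> * exp \<xi>0" by linarith
    qed
    finally show ?thesis .
  qed
  then show ?thesis by blast
qed

text \<open>ln |f| - \<sigma> Im z is the difference of the nonnegative functions Re Q = - ln |E|
  and - ln |G|, where E = exp (- Q). Both E and G are bounded by 1, so
  \<open>polar_average_neglog_small\<close> applies to each. The small values it asks for come from
  the limit of Re Q along the imaginary axis for E, and from the minimality of \<sigma> for
  G.\<close>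

lemma cartwright_half_plane:
  fixes f :: "complex \<Rightarrow> complex"
  assumes f: "f holomorphic_on UNIV" and A: "A \<ge> 1" "B \<ge> 0" "\<And>z. cmod (f z) \<le> A * exp (B * cmod z)"
    and int: "integrable lborel (\<lambda>t. ln (max 1 (cmod (f (of_real t)))) / (1 + t\<^sup>2))"
    and nz: "Im z1 > 0" "f z1 \<noteq> 0"
  shows "\<exists>\<sigma>. \<forall>\<epsilon>>0. \<exists>\<xi>1. \<forall>\<xi>0\<ge>\<xi>1. polar_average (\<lambda>z. ennreal \<bar>ln (cmod (f z)) - \<sigma> * Im z\<bar>) \<xi>0 \<le> ennreal (\<epsilon> * exp \<xi>0)"
proof -
  define p where "p t = ln (max 1 (cmod (f (of_real t))))" for t
  have "continuous_on UNIV (\<lambda>t. f (of_real t))"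
    by (rule continuous_on_compose2[OF holomorphic_on_imp_continuous_on[OF f]]) (auto intro!: continuous_intros)
  then have cont_p: "continuous_on UNIV p" unfolding p_def by (intro continuous_intros) (auto simp: max_def)
  have p0: "p t \<ge> 0" for t by (simp add: p_def)
  obtain Q where Q: "Q holomorphic_on {z. Im z > 0}" "\<And>z. Im z > 0 \<Longrightarrow> Re (Q z) \<ge> 0"
    and bQ: "\<And>x e. e > 0 \<Longrightarrow> \<exists>d>0. \<forall>z. Im z > 0 \<longrightarrow> dist z (of_real x) < d \<longrightarrow> Re (Q z) \<ge> p x - e"
    and lim: "((\<lambda>R. Re (Q (\<i> * of_real R)) / R) \<longlongrightarrow> 0) at_top"
  proof (rule holomorphic_poisson_extension[OF cont_p _ int[folded p_def]])
    show "p t \<ge> 0" for t by (rule p0)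
  qed (rule that)
  define F where "F z = f z * exp (- Q z)" for z
  have F: "cmod (F z) \<le> exp (8 * B / pi * Im z)" if "Im z > 0" for z
    unfolding F_def by (rule half_plane_majorant[OF f A Q _ that]) (use bQ in \<open>simp_all add: p_def\<close>)
  have Fnz: "F z1 \<noteq> 0" using nz by (simp add: F_def)
  obtain \<sigma> where \<sigma>: "\<And>z. Im z > 0 \<Longrightarrow> cmod (F z) \<le> exp (\<sigma> * Im z)"
      "\<And>e. e > 0 \<Longrightarrow> \<exists>z. Im z > 0 \<and> cmod (F z) > exp ((\<sigma> - e) * Im z)"
  proof (rule best_exponential_majorant[where F = F and C = "8 * B / pi" and ?z1.0 = z1])
    show "Im z1 > 0" "F z1 \<noteq> 0" by (fact nz Fnz)+
    show "cmod (F z) \<le> exp (8 * B / pi * Im z)" if "Im z > 0" for z by (rule F[OF that])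
  qed (rule that)
  define G where "G z = F z * exp (\<i> * of_real \<sigma> * z)" for z
  define E where "E z = exp (- Q z)" for z
  have normG: "cmod (G z) = cmod (F z) * exp (- (\<sigma> * Im z))" for z
    by (simp add: G_def norm_mult)
  have holE: "E holomorphic_on {z. Im z > 0}" unfolding E_def by (intro holomorphic_intros Q)
  have holG: "G holomorphic_on {z. Im z > 0}" unfolding G_def F_def
    by (intro holomorphic_intros Q holomorphic_on_subset[OF f]) auto
  have leE: "cmod (E z) \<le> 1" if "Im z > 0" for z using Q(2)[OF that] by (simp add: E_def)
  have leG: "cmod (G z) \<le> 1" if "Im z > 0" for z
  proof -
    have "cmod (F z) * exp (- (\<sigma> * Im z)) \<le> exp (\<sigma> * Im z) * exp (- (\<sigma> * Im z))"
      by (intro mult_right_mono \<sigma> that) simp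
    then show ?thesis unfolding normG by (simp flip: exp_add)
  qed
  have smallE: "\<exists>z0. Im z0 > 0 \<and> neglog (E z0) \<le> ennreal (e * Im z0)" if "e > 0" for e
  proof -
    have "\<forall>\<^sub>F R in at_top. Re (Q (\<i> * of_real R)) / R < e \<and> R > 0"
      using order_tendstoD(2)[OF lim that] eventually_gt_at_top[of 0] by (rule eventually_conj)
    then obtain R where R: "Re (Q (\<i> * of_real R)) / R < e" "R > 0"
      using eventually_happens'[OF trivial_limit_at_top_linorder] by blast
    then have "Re (Q (\<i> * of_real R)) \<le> e * R" by (simp add: field_simps)
    then show ?thesis using R(2) by (intro exI[of _ "\<i> * of_real R"]) (auto simp: E_def neglog_def intro!: ennreal_leI)
  qed
  have smallG: "\<exists>z0. Im z0 > 0 \<and> neglog (G z0) \<le> ennreal (e * Im z0)" if e: "e > 0" for e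
  proof -
    obtain z where z: "Im z > 0" "cmod (F z) > exp ((\<sigma> - e) * Im z)" using \<sigma>(2)[OF e] by blast
    have "cmod (G z) > exp ((\<sigma> - e) * Im z) * exp (- (\<sigma> * Im z))" unfolding normG
      using z by (intro mult_strict_right_mono) auto
    then have g: "cmod (G z) > exp (- (e * Im z))" by (simp add: algebra_simps flip: exp_add)
    then have "G z \<noteq> 0" by auto
    moreover have "ln (exp (- (e * Im z))) < ln (cmod (G z))" using g \<open>G z \<noteq> 0\<close> by (subst ln_less_cancel_iff) auto
    ultimately have "neglog (G z) \<le> ennreal (e * Im z)" by (auto simp: neglog_def intro!: ennreal_leI)
    then show ?thesis using z by blast
  qed
  have pt: "ennreal \<bar>ln (cmod (f z)) - \<sigma> * Im z\<bar> \<le> neglog (G z) + neglog (E z)" if z: "Im z > 0" for z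
  proof (cases "f z = 0")
    case True
    then show ?thesis by (simp add: neglog_def G_def F_def)
  next
    case False
    then have nzs: "G z \<noteq> 0" "E z \<noteq> 0" by (auto simp: G_def F_def E_def)
    have "ln (cmod (G z)) = ln (cmod (f z)) - Re (Q z) - \<sigma> * Im z"
      using False by (simp add: G_def F_def norm_mult ln_mult)
    moreover have "ln (cmod (G z)) \<le> 0" using leG[OF z] nzs by simp
    ultimately have "\<bar>ln (cmod (f z)) - \<sigma> * Im z\<bar> \<le> - ln (cmod (G z)) + Re (Q z)" using Q(2)[OF z] by linarith
    moreover have "neglog (G z) + neglog (E z) = ennreal (- ln (cmod (G z)) + Re (Q z))"
      using nzs Q(2)[OF z] \<open>ln (cmod (G z)) \<le> 0\<close> by (simp add: neglog_def E_def flip: ennreal_plus)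
    ultimately show ?thesis by (simp add: ennreal_leI)
  qed
  show ?thesis
  proof (rule exI[of _ \<sigma>], intro allI impI)
    fix \<epsilon> :: real assume \<epsilon>: "\<epsilon> > 0"
    then have \<epsilon>2: "\<epsilon>/2 > 0" by simp
    obtain \<xi>1 \<xi>2 where x: "\<And>\<xi>0. \<xi>0 \<ge> \<xi>1 \<Longrightarrow> polar_average (\<lambda>z. neglog (G z)) \<xi>0 \<le> ennreal (\<epsilon>/2 * exp \<xi>0)"
      "\<And>\<xi>0. \<xi>0 \<ge> \<xi>2 \<Longrightarrow> polar_average (\<lambda>z. neglog (E z)) \<xi>0 \<le> ennreal (\<epsilon>/2 * exp \<xi>0)"
      using polar_average_neglog_small[OF holG leG smallG \<epsilon>2] polar_average_neglog_small[OF holE leE smallE \<epsilon>2] by blast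
    have "polar_average (\<lambda>z. ennreal \<bar>ln (cmod (f z)) - \<sigma> * Im z\<bar>) \<xi>0 \<le> ennreal (\<epsilon> * exp \<xi>0)" if \<xi>0: "\<xi>0 \<ge> max \<xi>1 \<xi>2" for \<xi>0
    proof -
      have "polar_average (\<lambda>z. ennreal \<bar>ln (cmod (f z)) - \<sigma> * Im z\<bar>) \<xi>0 \<le> polar_average (\<lambda>z. neglog (G z) + neglog (E z)) \<xi>0"
        by (rule polar_average_mono) (rule pt)
      also have "\<dots> \<le> ennreal (\<epsilon>/2 * exp \<xi>0) + ennreal (\<epsilon>/2 * exp \<xi>0)"
        unfolding polar_average_add_neglog[OF holG holE] using \<xi>0 by (intro add_mono x) auto
      also have "\<dots> = ennreal (\<epsilon> * exp \<xi>0)" using \<epsilon> by (subst ennreal_plus[symmetric]) (auto simp: field_simps)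
      finally show ?thesis .
    qed
    then show "\<exists>\<xi>1. \<forall>\<xi>0\<ge>\<xi>1. polar_average (\<lambda>z. ennreal \<bar>ln (cmod (f z)) - \<sigma> * Im z\<bar>) \<xi>0 \<le> ennreal (\<epsilon> * exp \<xi>0)" by blast
  qed
qed

lemma polar_slice_eq_integral:
  fixes f :: "complex \<Rightarrow> complex"
  assumes f: "f holomorphic_on UNIV" and nz: "\<And>z. cmod z = exp \<xi> \<Longrightarrow> f z \<noteq> 0"
  shows "(\<integral>\<^sup>+\<theta>. ennreal \<bar>ln (cmod (f (exp (Complex \<xi> \<theta>)))) - \<sigma> * Im (exp (Complex \<xi> \<theta>))\<bar> * indicator {0<..<pi} \<theta> \<partial>lborel)
     = ennreal (integral {0..pi} (\<lambda>\<theta>. \<bar>ln (cmod (f (of_real (exp \<xi>) * cis \<theta>))) - \<sigma> * (exp \<xi> * sin \<theta>)\<bar>))"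
proof -
  have e: "exp (Complex \<xi> \<theta>) = of_real (exp \<xi>) * cis \<theta>" for \<theta>
    by (simp add: complex_eq_iff Re_exp Im_exp)
  have nz': "f (of_real (exp \<xi>) * cis \<theta>) \<noteq> 0" for \<theta> by (rule nz) (simp add: norm_mult)
  have "continuous_on {0..pi} (\<lambda>\<theta>. f (of_real (exp \<xi>) * cis \<theta>))"
    by (rule continuous_on_compose2[OF holomorphic_on_imp_continuous_on[OF f]]) (auto intro!: continuous_intros)
  then have c: "continuous_on {0..pi} (\<lambda>\<theta>. \<bar>ln (cmod (f (of_real (exp \<xi>) * cis \<theta>))) - \<sigma> * (exp \<xi> * sin \<theta>)\<bar>)"
    using nz' by (intro continuous_intros) auto
  have "(\<integral>\<^sup>+\<theta>. ennreal \<bar>ln (cmod (f (exp (Complex \<xi> \<theta>)))) - \<sigma> * Im (exp (Complex \<xi> \<theta>))\<bar> * indicator {0<..<pi} \<theta> \<partial>lborel)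
      = (\<integral>\<^sup>+\<theta>. ennreal \<bar>ln (cmod (f (of_real (exp \<xi>) * cis \<theta>))) - \<sigma> * (exp \<xi> * sin \<theta>)\<bar> * indicator {0..pi} \<theta> \<partial>lborel)"
  proof (rule nn_integral_cong_AE)
    have "AE \<theta> in lborel. \<theta> \<noteq> 0 \<and> \<theta> \<noteq> pi" using AE_lborel_singleton[of 0] AE_lborel_singleton[of pi] by eventually_elim auto
    then show "AE \<theta> in lborel. ennreal \<bar>ln (cmod (f (exp (Complex \<xi> \<theta>)))) - \<sigma> * Im (exp (Complex \<xi> \<theta>))\<bar> * indicator {0<..<pi} \<theta>
      = ennreal \<bar>ln (cmod (f (of_real (exp \<xi>) * cis \<theta>))) - \<sigma> * (exp \<xi> * sin \<theta>)\<bar> * indicator {0..pi} \<theta>"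
      by eventually_elim (auto simp: e indicator_def)
  qed
  also have "\<dots> = ennreal (integral {0..pi} (\<lambda>\<theta>. \<bar>ln (cmod (f (of_real (exp \<xi>) * cis \<theta>))) - \<sigma> * (exp \<xi> * sin \<theta>)\<bar>))"
    by (rule nn_integral_has_integral_lebesgue') (auto intro!: integrable_integral integrable_continuous_real c)
  finally show ?thesis .
qed

text \<open>The lower half-plane is the upper one for conj f(conj z), which has the same modulus on
  the real line. If the sum of the two half-circle integrals were large for almost all \<xi> in an
  interval, its average would be too large; using the sum yields one radius for both
  half-planes.\<close>

lemma cartwright_good_radii:
  fixes f :: "complex \<Rightarrow> complex"
  assumes f: "f holomorphic_on UNIV" and A: "A \<ge> 1" "B \<ge> 0" "\<And>z. cmod (f z) \<le> A * exp (B * cmod z)"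
    and int: "integrable lborel (\<lambda>t. ln (max 1 (cmod (f (of_real t)))) / (1 + t\<^sup>2))"
    and zeros: "countable {z. f z = 0}"
  shows "\<exists>\<sigma>1 \<sigma>2. \<forall>\<epsilon>>0. \<forall>\<delta>>0. \<exists>R0>0. \<forall>R\<ge>R0. \<exists>r. R \<le> r \<and> r \<le> R * exp \<delta> \<and> (\<forall>z. cmod z = r \<longrightarrow> f z \<noteq> 0) \<and>
      integral {0..pi} (\<lambda>t. \<bar>ln (cmod (f (r * cis t))) - \<sigma>1 * (r * sin t)\<bar>) \<le> \<epsilon> * r \<and>
      integral {0..pi} (\<lambda>t. \<bar>ln (cmod (f (r * cis (- t)))) - \<sigma>2 * (r * sin t)\<bar>) \<le> \<epsilon> * r"
proof -
  define f2 where "f2 z = cnj (f (cnj z))" for z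
  have f2: "f2 holomorphic_on UNIV"
  proof -
    have "range cnj = UNIV" by (metis complex_cnj_cnj surjI)
    then show ?thesis using holomorphic_on_compose_cnj_cnj[of f UNIV] f unfolding f2_def o_def by simp
  qed
  have A2: "cmod (f2 z) \<le> A * exp (B * cmod z)" for z using A(3)[of "cnj z"] by (simp add: f2_def)
  have int2: "integrable lborel (\<lambda>t. ln (max 1 (cmod (f2 (of_real t)))) / (1 + t\<^sup>2))"
    using int by (simp add: f2_def)
  have unc: "uncountable {z. Im z > 0}" "uncountable {z. Im z < 0}"
  proof -
    have "ball \<i> 1 \<subseteq> {z. Im z > 0}"
    proof
      fix z assume "z \<in> ball \<i> 1"
      then have "\<bar>Im (\<i> - z)\<bar> < 1" using abs_Im_le_cmod[of "\<i> - z"] by (simp add: dist_norm)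
      then show "z \<in> {z. Im z > 0}" by simp
    qed
    then show "uncountable {z. Im z > 0}" using uncountable_ball[of 1 \<i>] countable_subset by auto
    have "ball (-\<i>) 1 \<subseteq> {z. Im z < 0}"
    proof
      fix z assume "z \<in> ball (-\<i>) 1"
      then have "\<bar>Im (-\<i> - z)\<bar> < 1" using abs_Im_le_cmod[of "-\<i> - z"] by (simp add: dist_norm)
      then show "z \<in> {z. Im z < 0}" by simp
    qed
    then show "uncountable {z. Im z < 0}" using uncountable_ball[of 1 "-\<i>"] countable_subset by auto
  qed
  obtain z1 where z1: "Im z1 > 0" "f z1 \<noteq> 0" using unc(1) zeros countable_subset[of "{z. Im z > 0}" "{z. f z = 0}"] by blast
  obtain z2 where z2: "Im z2 < 0" "f z2 \<noteq> 0" using unc(2) zeros countable_subset[of "{z. Im z < 0}" "{z. f z = 0}"] by blast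
  have z2': "Im (cnj z2) > 0" "f2 (cnj z2) \<noteq> 0" using z2 by (auto simp: f2_def)
  define u where "u f \<sigma> \<xi> = (\<integral>\<^sup>+\<theta>. ennreal \<bar>ln (cmod (f (exp (Complex \<xi> \<theta>)))) - \<sigma> * Im (exp (Complex \<xi> \<theta>))\<bar> * indicator {0<..<pi} \<theta> \<partial>lborel)"
    for f :: "complex \<Rightarrow> complex" and \<sigma> \<xi>
  have um: "u g \<sigma> \<in> borel_measurable borel" if "g holomorphic_on UNIV" for g \<sigma>
  proof -
    have [measurable]: "g \<in> borel_measurable borel" by (rule borel_measurable_continuous_onI[OF holomorphic_on_imp_continuous_on[OF that]])
    show ?thesis unfolding u_def by measurable
  qed
  obtain \<sigma>1 where \<sigma>1: "\<And>\<epsilon>. \<epsilon> > 0 \<Longrightarrow> \<exists>\<xi>1. \<forall>\<xi>0\<ge>\<xi>1. (\<integral>\<^sup>+\<xi>. u f \<sigma>1 \<xi> * indicator {\<xi>0..\<xi>0+1/10} \<xi> \<partial>lborel) \<le> ennreal (\<epsilon> * exp \<xi>0)"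
    using cartwright_half_plane[OF f A int z1] unfolding polar_average_def u_def by blast
  obtain \<sigma>2 where \<sigma>2: "\<And>\<epsilon>. \<epsilon> > 0 \<Longrightarrow> \<exists>\<xi>1. \<forall>\<xi>0\<ge>\<xi>1. (\<integral>\<^sup>+\<xi>. u f2 \<sigma>2 \<xi> * indicator {\<xi>0..\<xi>0+1/10} \<xi> \<partial>lborel) \<le> ennreal (\<epsilon> * exp \<xi>0)"
    using cartwright_half_plane[OF f2 A(1,2) A2 int2 z2'] unfolding polar_average_def u_def by blast
  \<comment> \<open>Logarithms of the radii that meet a zero: a countable set, hence negligible in
    the averaging.\<close>
  define C where "C = (\<lambda>z. ln (cmod z)) ` {z. f z = 0}"
  have C: "countable C" unfolding C_def by (rule countable_image[OF zeros])
  show ?thesis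
  proof (rule exI[of _ \<sigma>1], rule exI[of _ \<sigma>2], intro allI impI)
    fix \<epsilon> \<delta> :: real assume \<epsilon>: "\<epsilon> > 0" and \<delta>: "\<delta> > 0"
    \<comment> \<open>The averages run over windows of width 1/10, hence the cap. With
      \<open>e\<close> as below the two half-planes together contribute 2 e R = \<epsilon> d R / 2,
      strictly less than \<epsilon> d R.\<close>
    define d where "d = min \<delta> (1/10)"
    have d: "d > 0" "d \<le> \<delta>" "d \<le> 1/10" using \<delta> by (auto simp: d_def)
    define e where "e = \<epsilon> * d / 4"
    have e: "e > 0" using \<epsilon> d by (simp add: e_def)
    obtain x1 x2 where x: "\<And>\<xi>0. \<xi>0 \<ge> x1 \<Longrightarrow> (\<integral>\<^sup>+\<xi>. u f \<sigma>1 \<xi> * indicator {\<xi>0..\<xi>0+1/10} \<xi> \<partial>lborel) \<le> ennreal (e * exp \<xi>0)"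
       "\<And>\<xi>0. \<xi>0 \<ge> x2 \<Longrightarrow> (\<integral>\<^sup>+\<xi>. u f2 \<sigma>2 \<xi> * indicator {\<xi>0..\<xi>0+1/10} \<xi> \<partial>lborel) \<le> ennreal (e * exp \<xi>0)"
      using \<sigma>1[OF e] \<sigma>2[OF e] by blast
    show "\<exists>R0>0. \<forall>R\<ge>R0. \<exists>r. R \<le> r \<and> r \<le> R * exp \<delta> \<and> (\<forall>z. cmod z = r \<longrightarrow> f z \<noteq> 0) \<and>
      integral {0..pi} (\<lambda>t. \<bar>ln (cmod (f (r * cis t))) - \<sigma>1 * (r * sin t)\<bar>) \<le> \<epsilon> * r \<and>
      integral {0..pi} (\<lambda>t. \<bar>ln (cmod (f (r * cis (- t)))) - \<sigma>2 * (r * sin t)\<bar>) \<le> \<epsilon> * r"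
    proof (rule exI[of _ "exp (max x1 x2)"], intro conjI allI impI)
      fix R assume R: "R \<ge> exp (max x1 x2)"
      have R0: "R > 0" using R exp_gt_zero less_le_trans by blast
      define \<xi>0 where "\<xi>0 = ln R"
      have "max x1 x2 \<le> \<xi>0" unfolding \<xi>0_def using R ln_ge_iff[OF R0, of "max x1 x2"] by blast
      then have \<xi>0: "\<xi>0 \<ge> x1" "\<xi>0 \<ge> x2" "exp \<xi>0 = R" using R0 by (auto simp: \<xi>0_def)
      have "\<exists>\<xi>. \<xi>0 \<le> \<xi> \<and> \<xi> \<le> \<xi>0 + d \<and> \<xi> \<notin> C \<and> u f \<sigma>1 \<xi> + u f2 \<sigma>2 \<xi> \<le> ennreal (\<epsilon> * R)"
      proof (rule ccontr)
        assume "\<not> ?thesis"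
        then have gt: "ennreal (\<epsilon> * R) \<le> u f \<sigma>1 \<xi> + u f2 \<sigma>2 \<xi>" if "\<xi>0 \<le> \<xi>" "\<xi> \<le> \<xi>0 + d" "\<xi> \<notin> C" for \<xi>
          using that by force
        have "AE \<xi> in lborel. \<xi> \<notin> C" using C by (intro AE_not_in) (simp add: countable_imp_null_set_lborel)
        have "ennreal (\<epsilon> * R * d) = ennreal (\<epsilon> * R) * ennreal d" using \<epsilon> R0 d by (intro ennreal_mult) auto
        also have "\<dots> = (\<integral>\<^sup>+\<xi>. ennreal (\<epsilon> * R) * indicator {\<xi>0..\<xi>0+d} \<xi> \<partial>lborel)"
          using d by (subst nn_integral_cmult_indicator) auto
        also have "\<dots> \<le> (\<integral>\<^sup>+\<xi>. u f \<sigma>1 \<xi> * indicator {\<xi>0..\<xi>0+1/10} \<xi> + u f2 \<sigma>2 \<xi> * indicator {\<xi>0..\<xi>0+1/10} \<xi> \<partial>lborel)"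
        proof (rule nn_integral_mono_AE)
          show "AE \<xi> in lborel. ennreal (\<epsilon> * R) * indicator {\<xi>0..\<xi>0+d} \<xi> \<le> u f \<sigma>1 \<xi> * indicator {\<xi>0..\<xi>0+1/10} \<xi> + u f2 \<sigma>2 \<xi> * indicator {\<xi>0..\<xi>0+1/10} \<xi>"
            using \<open>AE \<xi> in lborel. \<xi> \<notin> C\<close> by eventually_elim (use gt d in \<open>auto simp: indicator_def\<close>)
        qed
        also have "\<dots> = (\<integral>\<^sup>+\<xi>. u f \<sigma>1 \<xi> * indicator {\<xi>0..\<xi>0+1/10} \<xi> \<partial>lborel) + (\<integral>\<^sup>+\<xi>. u f2 \<sigma>2 \<xi> * indicator {\<xi>0..\<xi>0+1/10} \<xi> \<partial>lborel)"
          using um[OF f, of \<sigma>1] um[OF f2, of \<sigma>2] by (intro nn_integral_add) auto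
        also have "\<dots> \<le> ennreal (e * R) + ennreal (e * R)" using x[of \<xi>0] \<xi>0 by (intro add_mono) auto
        also have "\<dots> = ennreal (2 * e * R)" using e R0 by (subst ennreal_plus[symmetric]) auto
        finally have "\<epsilon> * R * d \<le> 2 * e * R" using e R0 by (subst (asm) ennreal_le_iff) auto
        also have "\<dots> < \<epsilon> * R * d" using \<epsilon> R0 d by (simp add: e_def)
        finally show False by simp
      qed
      then obtain \<xi> where \<xi>: "\<xi>0 \<le> \<xi>" "\<xi> \<le> \<xi>0 + d" "\<xi> \<notin> C" "u f \<sigma>1 \<xi> + u f2 \<sigma>2 \<xi> \<le> ennreal (\<epsilon> * R)" by blast
      define r where "r = exp \<xi>"
      have "exp \<xi>0 \<le> exp \<xi>" "exp \<xi> \<le> exp (\<xi>0 + \<delta>)" using \<xi> d by auto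
      then have rR: "R \<le> r" "r \<le> R * exp \<delta>" by (simp_all add: r_def exp_add \<xi>0(3))
      have nzr: "f z \<noteq> 0" if "cmod z = exp \<xi>" for z
      proof
        assume "f z = 0"
        then have "ln (cmod z) \<in> C" by (auto simp: C_def)
        then show False using that \<xi>(3) by simp
      qed
      have nzr2: "f2 z \<noteq> 0" if "cmod z = exp \<xi>" for z using nzr[of "cnj z"] that by (simp add: f2_def)
      have "ennreal (integral {0..pi} (\<lambda>t. \<bar>ln (cmod (f (r * cis t))) - \<sigma>1 * (r * sin t)\<bar>)) \<le> ennreal (\<epsilon> * R)"
      proof -
        have "u f \<sigma>1 \<xi> \<le> ennreal (\<epsilon> * R)" by (rule order_trans[OF _ \<xi>(4)]) (simp add: add_increasing2)
        moreover have "u f \<sigma>1 \<xi> = ennreal (integral {0..pi} (\<lambda>t. \<bar>ln (cmod (f (r * cis t))) - \<sigma>1 * (r * sin t)\<bar>))"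
          unfolding u_def r_def by (rule polar_slice_eq_integral[OF f nzr])
        ultimately show ?thesis by (simp only:)
      qed
      then have 1: "integral {0..pi} (\<lambda>t. \<bar>ln (cmod (f (r * cis t))) - \<sigma>1 * (r * sin t)\<bar>) \<le> \<epsilon> * R"
        using \<epsilon> R0 by (subst (asm) ennreal_le_iff) auto
      have "ennreal (integral {0..pi} (\<lambda>t. \<bar>ln (cmod (f2 (r * cis t))) - \<sigma>2 * (r * sin t)\<bar>)) \<le> ennreal (\<epsilon> * R)"
      proof -
        have "u f2 \<sigma>2 \<xi> \<le> ennreal (\<epsilon> * R)" by (rule order_trans[OF _ \<xi>(4)]) (simp add: add_increasing)
        moreover have "u f2 \<sigma>2 \<xi> = ennreal (integral {0..pi} (\<lambda>t. \<bar>ln (cmod (f2 (r * cis t))) - \<sigma>2 * (r * sin t)\<bar>))"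
          unfolding u_def r_def by (rule polar_slice_eq_integral[OF f2 nzr2])
        ultimately show ?thesis by (simp only:)
      qed
      then have 2: "integral {0..pi} (\<lambda>t. \<bar>ln (cmod (f2 (r * cis t))) - \<sigma>2 * (r * sin t)\<bar>) \<le> \<epsilon> * R"
        using \<epsilon> R0 by (subst (asm) ennreal_le_iff) auto
      have 3: "\<epsilon> * R \<le> \<epsilon> * r" using rR \<epsilon> by (intro mult_left_mono) auto
      have 4: "cmod (f2 (r * cis t)) = cmod (f (r * cis (- t)))" for t by (simp add: f2_def cis_cnj)
      show "\<exists>r. R \<le> r \<and> r \<le> R * exp \<delta> \<and> (\<forall>z. cmod z = r \<longrightarrow> f z \<noteq> 0) \<and>
        integral {0..pi} (\<lambda>t. \<bar>ln (cmod (f (r * cis t))) - \<sigma>1 * (r * sin t)\<bar>) \<le> \<epsilon> * r \<and>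
        integral {0..pi} (\<lambda>t. \<bar>ln (cmod (f (r * cis (- t)))) - \<sigma>2 * (r * sin t)\<bar>) \<le> \<epsilon> * r"
      proof (rule exI[of _ r], intro conjI allI impI)
        show "f z \<noteq> 0" if "cmod z = r" for z using nzr[of z] that by (simp add: r_def)
        show "integral {0..pi} (\<lambda>t. \<bar>ln (cmod (f (r * cis t))) - \<sigma>1 * (r * sin t)\<bar>) \<le> \<epsilon> * r" by (rule order_trans[OF 1 3])
        show "integral {0..pi} (\<lambda>t. \<bar>ln (cmod (f (r * cis (- t)))) - \<sigma>2 * (r * sin t)\<bar>) \<le> \<epsilon> * r"
          using order_trans[OF 2 3] unfolding 4 .
      qed (rule rR)+
    qed simp
  qed
qed

section \<open>Fourier coefficients on circles\<close>

lemma is_zero_set_iff: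
  assumes "f holomorphic_on UNIV" "is_zero_set m f"
  shows "f a = 0 \<longleftrightarrow> m a \<noteq> 0" "zorder f a = int (m a)"
proof -
  have d: "\<And>j. j < m a \<Longrightarrow> (deriv ^^ j) f a = 0" "(deriv ^^ (m a)) f a \<noteq> 0"
    using assms(2) by (auto simp: is_zero_set_def)
  show "f a = 0 \<longleftrightarrow> m a \<noteq> 0" using d(1)[of 0] d(2) by (cases "m a = 0") auto
  show "zorder f a = int (m a)"
    by (rule zorder_zero_eqI[OF assms(1)]) (use d in auto)
qed

lemma Ln_one_minus_bound:
  assumes "cmod v \<le> 1/2"
  shows "cmod (Ln (1 - v) + v) \<le> 2 * (cmod v)\<^sup>2"
proof -
  have "cmod (Ln (1 + (- v)) - (- v)) \<le> (cmod (- v))\<^sup>2 / (1 - cmod (- v))"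
    using assms by (intro Ln_approx_linear) auto
  also have "\<dots> \<le> (cmod v)\<^sup>2 / (1/2)"
    unfolding norm_minus_cancel using assms by (intro divide_left_mono) auto
  finally show ?thesis by simp
qed

lemma ln_cmod_one_minus_bound:
  assumes "cmod v \<le> 1/2"
  shows "\<bar>ln (cmod (1 - v)) + Re v\<bar> \<le> 2 * (cmod v)\<^sup>2"
proof -
  have "1 - v \<noteq> 0" using assms by auto
  then have "ln (cmod (1 - v)) + Re v = Re (Ln (1 - v) + v)" by simp
  also have "\<bar>\<dots>\<bar> \<le> cmod (Ln (1 - v) + v)" by (rule abs_Re_le_cmod)
  finally show ?thesis using Ln_one_minus_bound[OF assms] by linarith
qed

text \<open>Open discs, unlike the closed ones of \<open>ncount\<close>: they match the sums in (i),
  and the set stays the same when R is slightly decreased, so a circle can be moved off the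
  zeros.\<close>

definition zeros_in :: "(complex \<Rightarrow> nat) \<Rightarrow> real \<Rightarrow> complex set" where
  "zeros_in m R = {z. m z \<noteq> 0 \<and> cmod z < R}"

text \<open>The first Fourier coefficient, normalised so that it equals h'(0) if ln |f| = Re h on
  the circle with h holomorphic on a neighbourhood of the closed disc.\<close>

definition circle_moment :: "(complex \<Rightarrow> complex) \<Rightarrow> real \<Rightarrow> complex" where
  "circle_moment f R = integral {0..2*pi} (\<lambda>t. of_real (ln (cmod (f (R * cis t)))) * cis (- t)) / of_real (pi * R)"

text \<open>The logarithmic derivative conj a / r^2 - 1 / a at the origin is, up to sign, the source
  of the terms of \<open>balanced_sum\<close>.\<close>

lemma Blaschke_deriv_0:
  assumes "a \<noteq> 0" "r > 0"
  shows "Blaschke r a 0 \<noteq> 0"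
    "(Blaschke r a has_field_derivative Blaschke r a 0 * (cnj a / of_real (r\<^sup>2) - 1 / a)) (at 0)"
proof -
  show "Blaschke r a 0 \<noteq> 0" using assms by (simp add: Blaschke_def)
  have 1: "((\<lambda>z. of_real r * (z - a) / (of_real (r\<^sup>2) - cnj a * z)) has_field_derivative
     (of_real r * (of_real (r\<^sup>2) - cnj a * 0) - of_real r * (0 - a) * (- cnj a)) / (of_real (r\<^sup>2) - cnj a * 0)\<^sup>2) (at 0)"
    using assms by (auto intro!: derivative_eq_intros simp: power2_eq_square)
  have 2: "(of_real r * (of_real (r\<^sup>2) - cnj a * 0) - of_real r * (0 - a) * (- cnj a)) / (of_real (r\<^sup>2) - cnj a * 0)\<^sup>2
    = Blaschke r a 0 * (cnj a / of_real (r\<^sup>2) - 1 / a)"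
    using assms by (simp add: Blaschke_def field_simps power2_eq_square)
  have "Blaschke r a = (\<lambda>z. of_real r * (z - a) / (of_real (r\<^sup>2) - cnj a * z))"
    by (simp add: Blaschke_def fun_eq_iff)
  then show "(Blaschke r a has_field_derivative Blaschke r a 0 * (cnj a / of_real (r\<^sup>2) - 1 / a)) (at 0)"
    using 1 2 by simp
qed

text \<open>All three are read off from ln |f| = \<Sum> m a ln |Blaschke| + Re h. The value at 0
  gives Jensen's formula, the logarithmic derivative at 0 its first-order analogue. The third
  compares two points: \<open>h\<close> and the logarithms of the Blaschke denominators are replaced
  by their first-order expansions, with errors quadratic in |w| / R.\<close>

lemma disc_formulas:
  fixes f :: "complex \<Rightarrow> complex"
  assumes f: "f holomorphic_on UNIV" and zs: "is_zero_set m f" and f0: "f 0 \<noteq> 0" and R: "R > 0"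
    and nz: "\<And>z. cmod z = R \<Longrightarrow> f z \<noteq> 0"
  shows "integral {0..2*pi} (\<lambda>t. ln (cmod (f (R * cis t)))) = 2 * pi * (ln (cmod (f 0)) + (\<Sum>a\<in>zeros_in m R. m a * (ln R - ln (cmod a))))"
      (is ?A)
    and "circle_moment f R = deriv f 0 / f 0 + (\<Sum>a\<in>zeros_in m R. of_nat (m a) * (1 / a - cnj a / of_real (R\<^sup>2)))"
      (is ?B)
    and "\<And>x b. cmod x \<le> R / 2 \<Longrightarrow> cmod b \<le> R / 2 \<Longrightarrow> f x \<noteq> 0 \<Longrightarrow> f b \<noteq> 0 \<Longrightarrow>
       \<bar>ln (cmod (f x)) - ln (cmod (f b)) - (\<Sum>a\<in>zeros_in m R. m a * (ln (cmod (x - a)) - ln (cmod (b - a))))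
          - Re ((x - b) * (circle_moment f R + (\<Sum>a\<in>zeros_in m R. of_nat (m a) * cnj a) / of_real (R\<^sup>2)))\<bar>
       \<le> ((cmod x)\<^sup>2 + (cmod b)\<^sup>2) * (integral {0..2*pi} (\<lambda>t. \<bar>ln (cmod (f (R * cis t)))\<bar>) + 2 * (\<Sum>a\<in>zeros_in m R. real (m a))) / R\<^sup>2"
proof -
  define Z where "Z = zeros_in m R"
  define u where "u t = ln (cmod (f (R * cis t)))" for t
  define J where "J = circle_moment f R"
  have Zeq: "{a \<in> ball 0 R. f a = 0} = Z" using is_zero_set_iff(1)[OF f zs] by (auto simp: Z_def zeros_in_def)
  obtain h R' where h: "R < R'" "R' \<le> 2 * R" "h holomorphic_on ball 0 R'" and finZ: "finite Z"
    and F: "\<And>z::complex. z \<in> ball 0 R' \<Longrightarrow> f z = (\<Prod>a\<in>Z. Blaschke R a z ^ m a) * exp (h z)"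
  proof (rule Blaschke_factorization[of f "2 * R" R])
    show "f holomorphic_on ball 0 (2 * R)" by (rule holomorphic_on_subset[OF f]) simp
    show "f z \<noteq> 0" if "cmod z = R" for z using nz[OF that] .
    show "0 < R" "R < 2 * R" using R by auto
  qed (unfold is_zero_set_iff(2)[OF f zs] Zeq nat_int, rule that)
  have Zb: "cmod a < R" "a \<noteq> 0" if "a \<in> Z" for a
    using that f0 is_zero_set_iff(1)[OF f zs, of 0] by (auto simp: Z_def zeros_in_def)
  have cis: "cmod (of_real R * cis t) = R" for t using R by (simp add: norm_mult)
  have uh: "u t = Re (h (R * cis t))" for t
  proof -
    have "cmod (\<Prod>a\<in>Z. Blaschke R a (R * cis t) ^ m a) = 1"
      unfolding prod_norm[symmetric] norm_power using Blaschke_sphere[OF cis] Zb by (intro prod.neutral) auto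
    then have "cmod (f (R * cis t)) = exp (Re (h (R * cis t)))" using F[of "R * cis t"] cis[of t] h(1) by (simp add: norm_mult)
    then show ?thesis by (simp add: u_def)
  qed
  have ch: "continuous_on (cball 0 R) h" 
    by (rule holomorphic_on_imp_continuous_on[OF holomorphic_on_subset[OF h(3)]]) (use h in auto)
  have hh: "h holomorphic_on ball 0 R" by (rule holomorphic_on_subset[OF h(3)]) (use h in auto)
  have cu: "continuous_on {0..2*pi} u"
  proof -
    have "continuous_on {0..2*pi} (\<lambda>t. f (R * cis t))"
      by (rule continuous_on_compose2[OF holomorphic_on_imp_continuous_on[OF f]]) (auto intro!: continuous_intros)
    then show ?thesis unfolding u_def using nz cis by (intro continuous_intros) auto
  qed
  define M where "M = integral {0..2*pi} u / (2 * pi)"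
  have iu: "(u has_integral 2 * pi * M) {0..2*pi}"
    using integrable_integral[OF integrable_continuous_real[OF cu]] by (simp add: M_def)
  have S: "((\<lambda>t. 2 * of_real (u t) * (R * cis t / (R * cis t - w))) has_integral (2 * pi * (h w + cnj (h 0)))) {0..2*pi}"
    if "cmod w < R" for w
    using circle_Schwarz[OF ch hh that] by (simp add: uh)
  have h0: "Re (h 0) = M"
  proof -
    have "((\<lambda>t. 2 * of_real (u t)) has_integral complex_of_real (2 * pi * (2 * Re (h 0)))) {0..2*pi}"
      using S[of 0] R by (simp add: complex_add_cnj)
    moreover have "((\<lambda>t. 2 * complex_of_real (u t)) has_integral 2 * of_real (2 * pi * M)) {0..2*pi}"
      by (intro has_integral_mult_right has_integral_of_real iu)
    ultimately have "complex_of_real (2 * pi * (2 * Re (h 0))) = 2 * of_real (2 * pi * M)"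
      by (rule has_integral_unique)
    then have "complex_of_real (2 * pi * (2 * Re (h 0))) = of_real (2 * (2 * pi * M))" by simp
    then show ?thesis unfolding of_real_eq_iff by simp
  qed
  define I where "I = integral {0..2*pi} (\<lambda>t. \<bar>u t\<bar>)"
  \<comment> \<open>In the Schwarz integral, \<zeta> / (\<zeta> - w) = 1 + w / \<zeta> + w^2 /
    (\<zeta> (\<zeta> - w)). The first term accounts for h(0) + conj h(0), the second for w J, and
    |\<zeta> - w| \<ge> R / 2 bounds the third.\<close>
  have hw: "cmod (h w - h 0 - w * J) \<le> I * (cmod w)\<^sup>2 / R\<^sup>2" if w: "cmod w \<le> R / 2" for w
  proof -
    have wR: "cmod w < R" using w R by simp
    have nw: "of_real R * cis t \<noteq> w" for t using cis[of t] wR by auto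
    have nz0: "of_real R * cis t \<noteq> 0" for t using R by simp
    define E where "E t = of_real (u t) * (w\<^sup>2 / (R * cis t * (R * cis t - w)))" for t
    have cE: "continuous_on {0..2*pi} E" unfolding E_def using nw nz0 
      by (intro continuous_intros continuous_on_of_real cu) auto
    have iJ: "((\<lambda>t. of_real (u t) * cis (- t)) has_integral (pi * R * J)) {0..2*pi}"
    proof -
      have "continuous_on {0..2*pi} (\<lambda>t. of_real (u t) * cis (- t))" by (intro continuous_intros continuous_on_of_real cu)
      from integrable_integral[OF integrable_continuous_real[OF this]]
      show ?thesis using R by (simp add: J_def circle_moment_def u_def)
    qed
    have "((\<lambda>t. 2 * of_real (u t) + 2 * (w / R) * (of_real (u t) * cis (- t)) + 2 * E t)
       has_integral (2 * of_real (2 * pi * M) + 2 * (w / R) * (pi * R * J) + 2 * integral {0..2*pi} E)) {0..2*pi}"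
      by (intro has_integral_add has_integral_mult_right has_integral_of_real iu iJ
          integrable_integral integrable_continuous_real cE)
    moreover have "2 * of_real (u t) + 2 * (w / R) * (of_real (u t) * cis (- t)) + 2 * E t = 2 * of_real (u t) * (R * cis t / (R * cis t - w))" for t
    proof -
      define \<zeta> where "\<zeta> = of_real R * cis t"
      have z: "\<zeta> \<noteq> 0" "\<zeta> - w \<noteq> 0" using nz0[of t] nw[of t] by (auto simp: \<zeta>_def)
      have wz: "w / of_real R * cis (- t) = w / \<zeta>" unfolding \<zeta>_def using R by (simp add: field_simps cis_mult)
      have "2 * of_real (u t) + 2 * (w / R) * (of_real (u t) * cis (- t)) + 2 * E t = 2 * of_real (u t) * (1 + w / R * cis (- t) + w\<^sup>2 / (\<zeta> * (\<zeta> - w)))"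
        unfolding E_def \<zeta>_def[symmetric] by (simp add: algebra_simps)
      also have "w / R * cis (- t) = w / \<zeta>" by (rule wz)
      also have "1 + w / \<zeta> + w\<^sup>2 / (\<zeta> * (\<zeta> - w)) = \<zeta> / (\<zeta> - w)"
        using z by (simp add: field_simps power2_eq_square)
      finally show ?thesis by (simp add: \<zeta>_def)
    qed
    ultimately have "2 * pi * (h w + cnj (h 0)) = 2 * of_real (2 * pi * M) + 2 * (w / R) * (pi * R * J) + 2 * integral {0..2*pi} E"
      using has_integral_unique[OF S[OF wR]] by simp
    then have e1: "2 * pi * (h w + cnj (h 0)) = 2 * pi * (2 * of_real M + w * J) + 2 * integral {0..2*pi} E"
      using R by (simp add: algebra_simps)
    have Mh: "2 * of_real M = h 0 + cnj (h 0)" using h0 by (simp add: complex_add_cnj)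
    have "2 * pi * (h w - h 0 - w * J) = 2 * integral {0..2*pi} E" using e1 unfolding Mh by (simp add: algebra_simps)
    then have "cmod (2 * pi * (h w - h 0 - w * J)) = cmod (2 * integral {0..2*pi} E)" by (rule arg_cong)
    then have eq: "pi * cmod (h w - h 0 - w * J) = cmod (integral {0..2*pi} E)" by (simp add: norm_mult)
    also have "\<dots> \<le> integral {0..2*pi} (\<lambda>t. \<bar>u t\<bar> * (2 * (cmod w)\<^sup>2 / R\<^sup>2))"
    proof (rule Henstock_Kurzweil_Integration.integral_norm_bound_integral)
      show "E integrable_on {0..2*pi}" by (rule integrable_continuous_real[OF cE])
      show "(\<lambda>t. \<bar>u t\<bar> * (2 * (cmod w)\<^sup>2 / R\<^sup>2)) integrable_on {0..2*pi}"
        by (intro integrable_continuous_real continuous_intros cu) (use R in auto)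
      fix t
      have "cmod (of_real R * cis t - w) \<ge> R / 2" using norm_triangle_ineq2[of "of_real R * cis t" w] cis[of t] w by linarith
      then have "(cmod w)\<^sup>2 / (R * cmod (of_real R * cis t - w)) \<le> (cmod w)\<^sup>2 / (R * (R / 2))"
        using R by (intro divide_left_mono mult_left_mono mult_pos_pos) auto
      then have "cmod (w\<^sup>2 / (R * cis t * (R * cis t - w))) \<le> 2 * (cmod w)\<^sup>2 / R\<^sup>2"
        using R by (simp add: norm_divide norm_mult norm_power power2_eq_square mult_ac)
      then have "\<bar>u t\<bar> * cmod (w\<^sup>2 / (R * cis t * (R * cis t - w))) \<le> \<bar>u t\<bar> * (2 * (cmod w)\<^sup>2 / R\<^sup>2)"
        by (rule mult_left_mono) simp
      then show "cmod (E t) \<le> \<bar>u t\<bar> * (2 * (cmod w)\<^sup>2 / R\<^sup>2)" unfolding E_def norm_mult norm_of_real .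
    qed
    also have "\<dots> = I * (2 * (cmod w)\<^sup>2 / R\<^sup>2)" by (simp add: I_def)
    finally have "pi * cmod (h w - h 0 - w * J) \<le> 2 * (I * (cmod w)\<^sup>2 / R\<^sup>2)" by (simp add: mult_ac)
    moreover have "2 * cmod (h w - h 0 - w * J) \<le> pi * cmod (h w - h 0 - w * J)"
      using pi_ge_two by (intro mult_right_mono) auto
    ultimately show ?thesis by simp
  qed
  \<comment> \<open>The remainder just obtained is quadratic in w, so it also identifies
    \<open>J\<close> as h'(0).\<close>
  have J': "(h has_field_derivative J) (at 0)"
  proof -
    have "((\<lambda>w. (h w - h 0) / w) \<longlongrightarrow> J) (at 0)"
    proof (rule Lim_null_comparison[where g = "\<lambda>w. I * cmod w / R\<^sup>2", THEN Lim_null[THEN iffD2]])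
      show "((\<lambda>w. I * cmod w / R\<^sup>2) \<longlongrightarrow> 0) (at 0)" using R by (auto intro!: tendsto_eq_intros)
      have "\<forall>\<^sub>F w in at 0. dist w (0::complex) < R / 2" using R by (auto simp: eventually_at intro!: exI[of _ "R/2"])
      moreover have "\<forall>\<^sub>F w in at (0::complex). w \<noteq> 0" by (auto simp: eventually_at intro!: exI[of _ 1])
      ultimately show "\<forall>\<^sub>F w in at 0. cmod ((h w - h 0) / w - J) \<le> I * cmod w / R\<^sup>2"
      proof eventually_elim
        case (elim w)
        have "(h w - h 0) / w - J = (h w - h 0 - w * J) / w" using elim by (simp add: field_simps)
        then have "cmod ((h w - h 0) / w - J) = cmod (h w - h 0 - w * J) / cmod w" by (simp add: norm_divide)
        also have "\<dots> \<le> (I * (cmod w)\<^sup>2 / R\<^sup>2) / cmod w"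
          using elim hw[of w] by (intro divide_right_mono) auto
        also have "\<dots> = I * cmod w / R\<^sup>2" using elim by (simp add: power2_eq_square)
        finally show ?case .
      qed
    qed
    then show ?thesis by (simp add: has_field_derivative_iff)
  qed
  have lnf: "ln (cmod (f w)) = (\<Sum>a\<in>Z. m a * ln (cmod (Blaschke R a w))) + Re (h w)" if "cmod w < R" "f w \<noteq> 0" for w
  proof -
    have nzB: "Blaschke R a w \<noteq> 0" if "a \<in> Z" for a
    proof
      assume b0: "Blaschke R a w = 0"
      have "m a \<noteq> 0" using that by (simp add: Z_def zeros_in_def)
      then have "(\<Prod>a\<in>Z. Blaschke R a w ^ m a) = 0" using b0 that finZ by (intro prod_zero) auto
      then show False using F[of w] \<open>f w \<noteq> 0\<close> \<open>cmod w < R\<close> h(1) by simp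
    qed
    have "cmod (f w) = (\<Prod>a\<in>Z. cmod (Blaschke R a w) ^ m a) * exp (Re (h w))"
      using F[of w] that h(1) by (simp add: norm_mult prod_norm[symmetric] norm_power)
    moreover have "(\<Prod>a\<in>Z. cmod (Blaschke R a w) ^ m a) > 0" using nzB by (intro prod_pos) auto
    ultimately have "ln (cmod (f w)) = ln (\<Prod>a\<in>Z. cmod (Blaschke R a w) ^ m a) + Re (h w)"
      by (simp add: ln_mult)
    also have "ln (\<Prod>a\<in>Z. cmod (Blaschke R a w) ^ m a) = (\<Sum>a\<in>Z. ln (cmod (Blaschke R a w) ^ m a))"
      using nzB finZ by (intro ln_prod) auto
    also have "\<dots> = (\<Sum>a\<in>Z. m a * ln (cmod (Blaschke R a w)))" by (intro sum.cong refl ln_realpow)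
    finally show ?thesis .
  qed
  have lnB: "ln (cmod (Blaschke R a w)) = ln (cmod (w - a)) - ln R - ln (cmod (1 - cnj a * w / of_real (R\<^sup>2)))"
    if "cmod w < R" "a \<in> Z" "w \<noteq> a" for w a
  proof -
    have s: "cmod (cnj a * w / of_real (R\<^sup>2)) < 1"
    proof -
      have "cmod a * cmod w < R * R" using that Zb[OF that(2)] R by (intro mult_strict_mono) auto
      then show ?thesis using R by (simp add: norm_divide norm_mult power2_eq_square)
    qed
    then have n1: "1 - cnj a * w / of_real (R\<^sup>2) \<noteq> 0" by auto
    have "of_real (R\<^sup>2) - cnj a * w = of_real (R\<^sup>2) * (1 - cnj a * w / of_real (R\<^sup>2))" using R by (simp add: field_simps)
    then have "Blaschke R a w = (w - a) / (of_real R * (1 - cnj a * w / of_real (R\<^sup>2)))"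
      unfolding Blaschke_def using R n1 by (simp add: power2_eq_square del: of_real_mult) simp
    then have "cmod (Blaschke R a w) = cmod (w - a) / (R * cmod (1 - cnj a * w / of_real (R\<^sup>2)))"
      using R by (simp add: norm_divide norm_mult)
    then show ?thesis using that(3) R n1 by (simp add: ln_div ln_mult)
  qed
  have M: "M = ln (cmod (f 0)) + (\<Sum>a\<in>Z. m a * (ln R - ln (cmod a)))"
  proof -
    have "ln (cmod (f 0)) = (\<Sum>a\<in>Z. m a * (ln (cmod a) - ln R)) + M"
      using lnf[of 0] R f0 h0 lnB[of 0] Zb by (simp cong: sum.cong)
    moreover have "(\<Sum>a\<in>Z. m a * (ln R - ln (cmod a))) = - (\<Sum>a\<in>Z. m a * (ln (cmod a) - ln R))"
      by (simp add: sum_negf[symmetric] algebra_simps)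
    ultimately show ?thesis by simp
  qed
  show ?A using M unfolding M_def u_def[abs_def] Z_def[symmetric] by (simp add: field_simps)
  show ?B
  proof -
    define P where "P z = (\<Prod>a\<in>Z. Blaschke R a z ^ m a)" for z
    have P0: "P 0 \<noteq> 0" unfolding P_def using Blaschke_deriv_0(1)[OF _ R] Zb(2) finZ by (auto simp: prod_zero_iff)
    have "((\<lambda>z. \<Prod>a\<in>Z. Blaschke R a z ^ m a) has_field_derivative
       (\<Prod>a\<in>Z. Blaschke R a 0 ^ m a) * (\<Sum>a\<in>Z. (Blaschke R a 0 ^ m a * (of_nat (m a) * (cnj a / of_real (R\<^sup>2) - 1 / a))) / (Blaschke R a 0 ^ m a))) (at 0)"
    proof (rule has_field_derivative_prod')
      fix a assume a: "a \<in> Z"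
      show "Blaschke R a 0 ^ m a \<noteq> 0" using Blaschke_deriv_0(1)[OF Zb(2)[OF a] R] by simp
      have "m a \<noteq> 0" using a by (simp add: Z_def zeros_in_def)
      then have "Blaschke R a 0 ^ m a = Blaschke R a 0 ^ (m a - 1) * Blaschke R a 0" by (metis power_minus_mult neq0_conv)
      then show "((\<lambda>z. Blaschke R a z ^ m a) has_field_derivative Blaschke R a 0 ^ m a * (of_nat (m a) * (cnj a / of_real (R\<^sup>2) - 1 / a))) (at 0)"
        using DERIV_power[OF Blaschke_deriv_0(2)[OF Zb(2)[OF a] R], of "m a"] by (simp add: mult_ac)
    qed
    then have dP: "(P has_field_derivative P 0 * (\<Sum>a\<in>Z. of_nat (m a) * (cnj a / of_real (R\<^sup>2) - 1 / a))) (at 0)"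
      unfolding P_def using Blaschke_deriv_0(1)[OF _ R] Zb(2) by (simp cong: sum.cong)
    have d: "((\<lambda>z. P z * exp (h z)) has_field_derivative P 0 * (\<Sum>a\<in>Z. of_nat (m a) * (cnj a / of_real (R\<^sup>2) - 1 / a)) * exp (h 0) + P 0 * (exp (h 0) * J)) (at 0)"
      using dP J' by (auto intro!: derivative_eq_intros)
    have ev: "\<forall>\<^sub>F z in nhds 0. P z * exp (h z) = f z"
      using eventually_nhds_in_open[of "ball 0 R'" 0] R h(1) by (auto elim!: eventually_mono simp: F P_def)
    have "(f has_field_derivative P 0 * (\<Sum>a\<in>Z. of_nat (m a) * (cnj a / of_real (R\<^sup>2) - 1 / a)) * exp (h 0) + P 0 * (exp (h 0) * J)) (at 0)"
      using d DERIV_cong_ev[OF refl ev refl] by blast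
    then have "deriv f 0 = f 0 * ((\<Sum>a\<in>Z. of_nat (m a) * (cnj a / of_real (R\<^sup>2) - 1 / a)) + J)"
      using F[of 0] R h(1) by (simp add: DERIV_imp_deriv P_def algebra_simps)
    then have "deriv f 0 / f 0 = (\<Sum>a\<in>Z. of_nat (m a) * (cnj a / of_real (R\<^sup>2) - 1 / a)) + J" using f0 by simp
    moreover have "(\<Sum>a\<in>Z. of_nat (m a) * (1 / a - cnj a / of_real (R\<^sup>2))) = - (\<Sum>a\<in>Z. of_nat (m a) * (cnj a / of_real (R\<^sup>2) - 1 / a))"
      by (simp add: sum_negf[symmetric] algebra_simps)
    ultimately show ?thesis by (simp add: J_def Z_def)
  qed
  fix x b assume x: "cmod x \<le> R / 2" "f x \<noteq> 0" and b: "cmod b \<le> R / 2" "f b \<noteq> 0"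
  define T where "T = (\<Sum>a\<in>Z. of_nat (m a) * cnj a) / of_real (R\<^sup>2)"
  define n where "n = (\<Sum>a\<in>Z. real (m a))"
  \<comment> \<open>The contribution of the Blaschke denominators. Its linear part is - Re (w T), so
    that \<open>T\<close> joins \<open>J\<close> in the linear term, while the numerators form the
    logarithmic sum of the statement.\<close>
  define q where "q w = (\<Sum>a\<in>Z. m a * ln (cmod (1 - cnj a * w / of_real (R\<^sup>2))))" for w
  have q: "\<bar>q w + Re (w * T)\<bar> \<le> 2 * n * (cmod w)\<^sup>2 / R\<^sup>2" if w: "cmod w \<le> R / 2" for w
  proof -
    have "w * T = (\<Sum>a\<in>Z. of_nat (m a) * (cnj a * w / of_real (R\<^sup>2)))"
      by (simp add: T_def sum_divide_distrib sum_distrib_left mult_ac)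
    then have "Re (w * T) = (\<Sum>a\<in>Z. m a * Re (cnj a * w / of_real (R\<^sup>2)))" by simp
    then have "q w + Re (w * T) = (\<Sum>a\<in>Z. m a * (ln (cmod (1 - cnj a * w / of_real (R\<^sup>2))) + Re (cnj a * w / of_real (R\<^sup>2))))"
      by (simp add: q_def sum.distrib algebra_simps)
    also have "\<bar>\<dots>\<bar> \<le> (\<Sum>a\<in>Z. real (m a) * (2 * (cmod w)\<^sup>2 / R\<^sup>2))"
    proof (rule order_trans[OF sum_abs sum_mono])
      fix a assume a: "a \<in> Z"
      have v: "cmod (cnj a * w / of_real (R\<^sup>2)) \<le> cmod w / R"
      proof -
        have "cmod a * cmod w \<le> R * cmod w" using Zb[OF a] by (intro mult_right_mono) auto
        then have "cmod a * cmod w / (R * R) \<le> R * cmod w / (R * R)" using R by (intro divide_right_mono) auto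
        then show ?thesis using R by (simp add: norm_divide norm_mult power2_eq_square)
      qed
      also have "cmod w / R \<le> 1/2" using w R by (simp add: field_simps)
      finally have "\<bar>ln (cmod (1 - cnj a * w / of_real (R\<^sup>2))) + Re (cnj a * w / of_real (R\<^sup>2))\<bar> \<le> 2 * (cmod (cnj a * w / of_real (R\<^sup>2)))\<^sup>2"
        by (rule ln_cmod_one_minus_bound)
      also have "\<dots> \<le> 2 * (cmod w / R)\<^sup>2" using v by (intro mult_left_mono power_mono) auto
      also have "\<dots> = 2 * (cmod w)\<^sup>2 / R\<^sup>2" by (simp add: power_divide)
      finally have B: "\<bar>ln (cmod (1 - cnj a * w / of_real (R\<^sup>2))) + Re (cnj a * w / of_real (R\<^sup>2))\<bar> \<le> 2 * (cmod w)\<^sup>2 / R\<^sup>2" .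
      show "\<bar>m a * (ln (cmod (1 - cnj a * w / of_real (R\<^sup>2))) + Re (cnj a * w / of_real (R\<^sup>2)))\<bar> \<le> real (m a) * (2 * (cmod w)\<^sup>2 / R\<^sup>2)"
        unfolding abs_mult abs_of_nat by (rule mult_left_mono[OF B]) simp
    qed
    also have "\<dots> = 2 * n * (cmod w)\<^sup>2 / R\<^sup>2" by (simp only: n_def sum_distrib_right[symmetric]) (simp add: mult_ac)
    finally show ?thesis .
  qed
  have lw: "ln (cmod (f w)) = (\<Sum>a\<in>Z. m a * (ln (cmod (w - a)) - ln R)) - q w + Re (h w)" if w: "cmod w \<le> R / 2" "f w \<noteq> 0" for w
  proof -
    have wR: "cmod w < R" using w R by simp
    have "w \<noteq> a" if "a \<in> Z" for a using w(2) that is_zero_set_iff(1)[OF f zs] by (auto simp: Z_def zeros_in_def)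
    then have "ln (cmod (f w)) = (\<Sum>a\<in>Z. m a * (ln (cmod (w - a)) - ln R - ln (cmod (1 - cnj a * w / of_real (R\<^sup>2))))) + Re (h w)"
      using lnf[OF wR w(2)] lnB[OF wR] by (simp cong: sum.cong)
    then show ?thesis by (simp add: q_def sum_subtractf right_diff_distrib)
  qed
  have hb: "\<bar>Re (h w) - Re (h 0) - Re (w * J)\<bar> \<le> I * (cmod w)\<^sup>2 / R\<^sup>2" if "cmod w \<le> R / 2" for w
    using order_trans[OF abs_Re_le_cmod hw[OF that]] by simp
  have sd: "(\<Sum>a\<in>Z. m a * (ln (cmod (x - a)) - ln R)) - (\<Sum>a\<in>Z. m a * (ln (cmod (b - a)) - ln R)) = (\<Sum>a\<in>Z. m a * (ln (cmod (x - a)) - ln (cmod (b - a))))"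
    by (simp add: sum_subtractf[symmetric] algebra_simps)
  have "ln (cmod (f x)) - ln (cmod (f b)) - (\<Sum>a\<in>Z. m a * (ln (cmod (x - a)) - ln (cmod (b - a)))) - Re ((x - b) * (J + T))
     = (Re (h x) - Re (h 0) - Re (x * J)) - (Re (h b) - Re (h 0) - Re (b * J)) - (q x + Re (x * T)) + (q b + Re (b * T))"
    unfolding lw[OF x] lw[OF b] sd[symmetric] by (simp add: algebra_simps)
  also have "\<bar>\<dots>\<bar> \<le> I * (cmod x)\<^sup>2 / R\<^sup>2 + I * (cmod b)\<^sup>2 / R\<^sup>2 + 2 * n * (cmod x)\<^sup>2 / R\<^sup>2 + 2 * n * (cmod b)\<^sup>2 / R\<^sup>2"
    using hb[OF x(1)] hb[OF b(1)] q[OF x(1)] q[OF b(1)] by linarith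
  also have "\<dots> = ((cmod x)\<^sup>2 + (cmod b)\<^sup>2) * (I + 2 * n) / R\<^sup>2"
    by (simp add: add_divide_distrib distrib_left distrib_right mult_ac)
  finally show "\<bar>ln (cmod (f x)) - ln (cmod (f b)) - (\<Sum>a\<in>zeros_in m R. m a * (ln (cmod (x - a)) - ln (cmod (b - a))))
          - Re ((x - b) * (circle_moment f R + (\<Sum>a\<in>zeros_in m R. of_nat (m a) * cnj a) / of_real (R\<^sup>2)))\<bar>
       \<le> ((cmod x)\<^sup>2 + (cmod b)\<^sup>2) * (integral {0..2*pi} (\<lambda>t. \<bar>ln (cmod (f (R * cis t)))\<bar>) + 2 * (\<Sum>a\<in>zeros_in m R. real (m a))) / R\<^sup>2"
    unfolding J_def T_def I_def n_def Z_def u_def .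
qed

section \<open>Counting functions and the Tauberian argument\<close>

definition zero_count :: "(complex \<Rightarrow> nat) \<Rightarrow> real \<Rightarrow> real" where
  "zero_count m R = (\<Sum>a\<in>zeros_in m R. real (m a))"

text \<open>For m 0 = 0 this is Jensen's integral of n(t) / t over (0, R), written as a sum over the
  zeros.\<close>

definition zero_mean :: "(complex \<Rightarrow> nat) \<Rightarrow> real \<Rightarrow> real" where
  "zero_mean m R = (\<Sum>a\<in>zeros_in m R. real (m a) * (ln R - ln (cmod a)))"

definition zero_moment :: "(complex \<Rightarrow> nat) \<Rightarrow> real \<Rightarrow> complex" where
  "zero_moment m R = (\<Sum>a\<in>zeros_in m R. of_nat (m a) * cnj a) / of_real (R\<^sup>2)"

text \<open>The sum of 1 / a minus \<open>zero_moment\<close>, in the combination that the first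
  Fourier coefficient provides. A term vanishes when |a| = R, so zeros entering the disc cause no
  jump.\<close>

definition balanced_sum :: "(complex \<Rightarrow> nat) \<Rightarrow> real \<Rightarrow> complex" where
  "balanced_sum m R = (\<Sum>a\<in>zeros_in m R. of_nat (m a) * (1 / a - cnj a / of_real (R\<^sup>2)))"

text \<open>Every R is followed within a factor exp d by a good r, and slow oscillation carries the
  value at r back to R.\<close>

lemma slowly_oscillating_tendsto:
  fixes g :: "real \<Rightarrow> 'a :: real_normed_vector"
  assumes good: "\<And>e d. e > 0 \<Longrightarrow> d > 0 \<Longrightarrow> \<exists>R0. \<forall>R\<ge>R0. \<exists>r. R \<le> r \<and> r \<le> R * exp d \<and> norm (g r - D) \<le> e"
    and slow: "\<And>e. e > 0 \<Longrightarrow> \<exists>d>0. \<exists>R0. \<forall>R\<ge>R0. \<forall>r. R \<le> r \<longrightarrow> r \<le> R * exp d \<longrightarrow> norm (g r - g R) \<le> e"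
  shows "(g \<longlongrightarrow> D) at_top"
proof (rule tendstoI)
  fix e :: real assume "e > 0"
  then have e: "e / 3 > 0" by simp
  obtain d R0 where d: "d > 0" "\<And>R r. R \<ge> R0 \<Longrightarrow> R \<le> r \<Longrightarrow> r \<le> R * exp d \<Longrightarrow> norm (g r - g R) \<le> e / 3"
    using slow[OF e] by blast
  obtain R1 where R1: "\<And>R. R \<ge> R1 \<Longrightarrow> \<exists>r. R \<le> r \<and> r \<le> R * exp d \<and> norm (g r - D) \<le> e / 3"
    using good[OF e d(1)] by blast
  show "\<forall>\<^sub>F R in at_top. dist (g R) D < e"
    using eventually_ge_at_top[of "max R0 R1"]
  proof eventually_elim
    case (elim R)
    then obtain r where r: "R \<le> r" "r \<le> R * exp d" "norm (g r - D) \<le> e / 3" using R1[of R] by auto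
    have "norm (g r - g R) \<le> e / 3" using d(2)[of R r] r elim by auto
    then have "norm ((g r - D) - (g r - g R)) \<le> e / 3 + e / 3" using r(3) norm_triangle_ineq4 by (smt (verit))
    then show ?case using e by (simp add: dist_norm)
  qed
qed

context
  fixes m :: "complex \<Rightarrow> nat"
  assumes fin: "\<And>R. finite (zeros_in m R)" and m0: "m 0 = 0"
begin

lemma zeros_in_mono: "R \<le> R' \<Longrightarrow> zeros_in m R \<subseteq> zeros_in m R'"
  by (auto simp: zeros_in_def)

lemma zeros_in_pos: "a \<in> zeros_in m R \<Longrightarrow> 0 < cmod a"
  using m0 by (auto simp: zeros_in_def)

lemma zero_count_nonneg: "zero_count m R \<ge> 0"
  unfolding zero_count_def by (rule sum_nonneg) simp

lemma zero_count_mono: "R \<le> R' \<Longrightarrow> zero_count m R \<le> zero_count m R'"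
  unfolding zero_count_def by (rule sum_mono2[OF fin zeros_in_mono]) auto

lemma zero_mean_nonneg: "zero_mean m R \<ge> 0"
  unfolding zero_mean_def
proof (rule sum_nonneg)
  fix a assume a: "a \<in> zeros_in m R"
  then have "ln (cmod a) \<le> ln R" using zeros_in_pos[OF a] by (intro ln_mono) (auto simp: zeros_in_def)
  then show "0 \<le> real (m a) * (ln R - ln (cmod a))" by simp
qed

lemma zero_sum_split:
  fixes \<phi> :: "complex \<Rightarrow> 'a :: comm_monoid_add"
  assumes "R \<le> R'"
  shows "(\<Sum>a\<in>zeros_in m R'. \<phi> a) = (\<Sum>a\<in>zeros_in m R' - zeros_in m R. \<phi> a) + (\<Sum>a\<in>zeros_in m R. \<phi> a)"
  by (rule sum.subset_diff[OF zeros_in_mono[OF assms] fin])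

text \<open>The increment is the integral of the monotone count against dt / t, hence lies between
  the counts at the two ends times the logarithmic length.\<close>

lemma zero_mean_diff:
  assumes "0 < R" "R \<le> R'"
  shows "zero_count m R * (ln R' - ln R) \<le> zero_mean m R' - zero_mean m R"
    "zero_mean m R' - zero_mean m R \<le> zero_count m R' * (ln R' - ln R)"
proof -
  have eq: "zero_mean m R' - zero_mean m R = (\<Sum>a\<in>zeros_in m R' - zeros_in m R. real (m a) * (ln R' - ln (cmod a))) + zero_count m R * (ln R' - ln R)"
  proof -
    have "(\<Sum>a\<in>zeros_in m R. real (m a) * (ln R' - ln (cmod a))) - zero_mean m R = (\<Sum>a\<in>zeros_in m R. real (m a) * (ln R' - ln R))"
      unfolding zero_mean_def sum_subtractf[symmetric] by (intro sum.cong) (auto simp: algebra_simps)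
    also have "\<dots> = zero_count m R * (ln R' - ln R)" by (simp only: zero_count_def sum_distrib_right)
    finally show ?thesis unfolding zero_mean_def[of m R'] zero_sum_split[OF assms(2), of "\<lambda>a. real (m a) * (ln R' - ln (cmod a))"] by simp
  qed
  have b: "0 \<le> ln R' - ln (cmod a) \<and> ln R' - ln (cmod a) \<le> ln R' - ln R" if "a \<in> zeros_in m R' - zeros_in m R" for a
  proof -
    have "R \<le> cmod a" "cmod a < R'" "0 < cmod a" using that zeros_in_pos[of a R'] by (auto simp: zeros_in_def)
    then show ?thesis using assms by simp
  qed
  have "0 \<le> (\<Sum>a\<in>zeros_in m R' - zeros_in m R. real (m a) * (ln R' - ln (cmod a)))"
    by (rule sum_nonneg) (use b in auto)
  then show "zero_count m R * (ln R' - ln R) \<le> zero_mean m R' - zero_mean m R" using eq by simp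
  have "(\<Sum>a\<in>zeros_in m R' - zeros_in m R. real (m a) * (ln R' - ln (cmod a))) \<le> (\<Sum>a\<in>zeros_in m R' - zeros_in m R. real (m a) * (ln R' - ln R))"
    by (rule sum_mono) (use b in \<open>auto intro!: mult_left_mono\<close>)
  also have "\<dots> + zero_count m R * (ln R' - ln R) = zero_count m R' * (ln R' - ln R)"
    by (simp only: zero_count_def zero_sum_split[OF assms(2), of "\<lambda>a. real (m a)"] distrib_right sum_distrib_right)
  finally show "zero_mean m R' - zero_mean m R \<le> zero_count m R' * (ln R' - ln R)" using eq by simp
qed

lemma zero_mean_mono: "0 < R \<Longrightarrow> R \<le> R' \<Longrightarrow> zero_mean m R \<le> zero_mean m R'"
  using zero_mean_diff(1)[of R R'] mult_nonneg_nonneg[OF zero_count_nonneg[of R], of "ln R' - ln R"] ln_mono[of R R'] by simp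

text \<open>The zeros of the smaller disc contribute exactly the subtracted multiple of
  \<open>zero_moment m R\<close>. A new zero contributes a term of modulus 1 / |a| - |a| / R'^2,
  which is largest at |a| = R.\<close>

lemma balanced_sum_diff:
  assumes "0 < R" "R \<le> R'"
  shows "cmod (balanced_sum m R' - balanced_sum m R - zero_moment m R * of_real (1 - R\<^sup>2 / R'\<^sup>2))
     \<le> (zero_count m R' - zero_count m R) * ((1 - R\<^sup>2 / R'\<^sup>2) / R)"
proof -
  have R': "R' > 0" using assms by linarith
  have "balanced_sum m R' - balanced_sum m R - zero_moment m R * of_real (1 - R\<^sup>2 / R'\<^sup>2)
    = (\<Sum>a\<in>zeros_in m R' - zeros_in m R. of_nat (m a) * (1 / a - cnj a / of_real (R'\<^sup>2)))
     + ((\<Sum>a\<in>zeros_in m R. of_nat (m a) * (1 / a - cnj a / of_real (R'\<^sup>2))) - (\<Sum>a\<in>zeros_in m R. of_nat (m a) * (1 / a - cnj a / of_real (R\<^sup>2)))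
      - (\<Sum>a\<in>zeros_in m R. of_nat (m a) * cnj a) * (of_real (1 - R\<^sup>2 / R'\<^sup>2) / of_real (R\<^sup>2)))"
    unfolding balanced_sum_def zero_moment_def zero_sum_split[OF assms(2), of "\<lambda>a. of_nat (m a) * (1 / a - cnj a / of_real (R'\<^sup>2))"]
    by simp
  also have "(\<Sum>a\<in>zeros_in m R. of_nat (m a) * (1 / a - cnj a / of_real (R'\<^sup>2))) - (\<Sum>a\<in>zeros_in m R. of_nat (m a) * (1 / a - cnj a / of_real (R\<^sup>2)))
      - (\<Sum>a\<in>zeros_in m R. of_nat (m a) * cnj a) * (of_real (1 - R\<^sup>2 / R'\<^sup>2) / of_real (R\<^sup>2)) = 0"
  proof -
    have k: "complex_of_real (1 - R\<^sup>2 / R'\<^sup>2) / of_real (R\<^sup>2) = 1 / of_real (R\<^sup>2) - 1 / of_real (R'\<^sup>2)"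
      using assms R' by (simp add: field_simps)
    have *: "of_nat (m a) * (1 / a - cnj a / of_real (R'\<^sup>2)) - of_nat (m a) * (1 / a - cnj a / of_real (R\<^sup>2))
       = of_nat (m a) * cnj a * (complex_of_real (1 - R\<^sup>2 / R'\<^sup>2) / of_real (R\<^sup>2))" for a
      unfolding k by (simp add: algebra_simps)
    show ?thesis by (simp only: sum_subtractf[symmetric] sum_distrib_right *) simp
  qed
  finally have eq: "balanced_sum m R' - balanced_sum m R - zero_moment m R * of_real (1 - R\<^sup>2 / R'\<^sup>2)
    = (\<Sum>a\<in>zeros_in m R' - zeros_in m R. of_nat (m a) * (1 / a - cnj a / of_real (R'\<^sup>2)))" by simp
  have "cmod (\<Sum>a\<in>zeros_in m R' - zeros_in m R. of_nat (m a) * (1 / a - cnj a / of_real (R'\<^sup>2)))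
     \<le> (\<Sum>a\<in>zeros_in m R' - zeros_in m R. real (m a) * ((1 - R\<^sup>2 / R'\<^sup>2) / R))"
  proof (rule order_trans[OF norm_sum sum_mono])
    fix a assume a: "a \<in> zeros_in m R' - zeros_in m R"
    have ca: "R \<le> cmod a" "cmod a < R'" "0 < cmod a" using a zeros_in_pos[of a R'] by (auto simp: zeros_in_def)
    have "1 / a = cnj a / of_real ((cmod a)\<^sup>2)"
      unfolding complex_norm_square using ca by simp
    then have "1 / a - cnj a / of_real (R'\<^sup>2) = cnj a * of_real (1 / (cmod a)\<^sup>2 - 1 / R'\<^sup>2)"
      by (simp add: algebra_simps)
    then have "cmod (1 / a - cnj a / of_real (R'\<^sup>2)) = cmod a * \<bar>1 / (cmod a)\<^sup>2 - 1 / R'\<^sup>2\<bar>"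
      by (simp only: norm_mult complex_mod_cnj norm_of_real)
    also have "\<bar>1 / (cmod a)\<^sup>2 - 1 / R'\<^sup>2\<bar> = 1 / (cmod a)\<^sup>2 - 1 / R'\<^sup>2"
    proof -
      have "(cmod a)\<^sup>2 \<le> R'\<^sup>2" using ca by (intro power_mono) auto
      then have "1 / R'\<^sup>2 \<le> 1 / (cmod a)\<^sup>2" using ca R' by (intro divide_left_mono) auto
      then show ?thesis by simp
    qed
    also have "cmod a * \<dots> = 1 / cmod a - cmod a / R'\<^sup>2" using ca by (simp add: field_simps power2_eq_square)
    also have "\<dots> \<le> 1 / R - R / R'\<^sup>2" using ca assms R' by (intro diff_mono divide_left_mono divide_right_mono) auto
    also have "\<dots> = (1 - R\<^sup>2 / R'\<^sup>2) / R" using assms R' by (simp add: field_simps power2_eq_square)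
    finally show "cmod (of_nat (m a) * (1 / a - cnj a / of_real (R'\<^sup>2))) \<le> real (m a) * ((1 - R\<^sup>2 / R'\<^sup>2) / R)"
      unfolding norm_mult norm_of_nat by (intro mult_left_mono) auto
  qed
  also have "\<dots> = (zero_count m R' - zero_count m R) * ((1 - R\<^sup>2 / R'\<^sup>2) / R)"
    by (simp only: zero_count_def zero_sum_split[OF assms(2), of "\<lambda>a. real (m a)"] add_diff_cancel_right' sum_distrib_right)
  finally show ?thesis unfolding eq .
qed

lemma cmod_zero_moment:
  assumes "R > 0"
  shows "cmod (zero_moment m R) \<le> zero_count m R / R"
proof -
  have "cmod (\<Sum>a\<in>zeros_in m R. of_nat (m a) * cnj a) \<le> (\<Sum>a\<in>zeros_in m R. real (m a) * R)"
    by (rule order_trans[OF norm_sum sum_mono]) (auto simp: norm_mult zeros_in_def intro!: mult_left_mono)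
  also have "\<dots> = zero_count m R * R" by (simp add: zero_count_def sum_distrib_right)
  finally have "cmod (\<Sum>a\<in>zeros_in m R. of_nat (m a) * cnj a) / R\<^sup>2 \<le> zero_count m R * R / R\<^sup>2" by (intro divide_right_mono) auto
  then show ?thesis using assms by (simp only: zero_moment_def norm_divide norm_of_real) (simp add: power2_eq_square)
qed

context
  fixes D :: real and L :: complex
  assumes good: "\<And>e d. e > 0 \<Longrightarrow> d > 0 \<Longrightarrow> \<exists>R0. \<forall>R\<ge>R0. \<exists>r. R \<le> r \<and> r \<le> R * exp d \<and>
      \<bar>zero_mean m r / r - D\<bar> \<le> e \<and> cmod (balanced_sum m r - L) \<le> e"
begin

text \<open>Monotonicity of \<open>zero_mean\<close> carries the bound from good radii to all radii.
  Then \<open>zero_count m R\<close> is at most \<open>zero_mean\<close> at R e, because the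
  logarithmic length from R to R e is 1.\<close>

lemma zero_count_linear_bound:
  obtains C R0 where "C > 0" "R0 > 0" "\<And>R. R \<ge> R0 \<Longrightarrow> zero_mean m R \<le> C * R" "\<And>R. R \<ge> R0 \<Longrightarrow> zero_count m R \<le> C * R"
proof -
  obtain R1 where R1: "\<And>R. R \<ge> R1 \<Longrightarrow> \<exists>r. R \<le> r \<and> r \<le> R * exp 1 \<and> \<bar>zero_mean m r / r - D\<bar> \<le> 1 \<and> cmod (balanced_sum m r - L) \<le> 1"
    using good[OF zero_less_one zero_less_one] by blast
  define R0 where "R0 = max R1 1"
  define C1 where "C1 = (\<bar>D\<bar> + 1) * exp 1"
  have C1: "C1 > 0" by (simp add: C1_def add_nonneg_pos)
  have mean: "zero_mean m R \<le> C1 * R" if R: "R \<ge> R0" for R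
  proof -
    have R0: "R > 0" "R \<ge> R1" using R by (auto simp: R0_def)
    obtain r where r: "R \<le> r" "r \<le> R * exp 1" "\<bar>zero_mean m r / r - D\<bar> \<le> 1" using R1[OF R0(2)] by blast
    have rp: "r > 0" using r R0 by linarith
    have "zero_mean m R \<le> zero_mean m r" by (rule zero_mean_mono[OF R0(1) r(1)])
    also have "zero_mean m r / r \<le> \<bar>D\<bar> + 1" using r(3) by linarith
    then have "zero_mean m r \<le> (\<bar>D\<bar> + 1) * r" using rp by (simp add: field_simps)
    also have "(\<bar>D\<bar> + 1) * r \<le> (\<bar>D\<bar> + 1) * (R * exp 1)" using r by (intro mult_left_mono) auto
    finally show ?thesis by (simp add: C1_def mult_ac)
  qed
  define C where "C = C1 * exp 1"
  have CC: "C1 \<le> C" "C > 0" using C1 by (simp_all add: C_def)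
  have "zero_count m R \<le> C * R" if R: "R \<ge> R0" for R
  proof -
    have R0: "R > 0" using R by (auto simp: R0_def)
    have le: "R \<le> R * exp 1" using R0 by simp
    have "zero_count m R * (ln (R * exp 1) - ln R) \<le> zero_mean m (R * exp 1) - zero_mean m R" by (rule zero_mean_diff(1)[OF R0 le])
    then have "zero_count m R \<le> zero_mean m (R * exp 1)" using R0 zero_mean_nonneg[of R] by (simp add: ln_mult)
    also have "\<dots> \<le> C1 * (R * exp 1)" by (rule mean) (use le R in linarith)
    finally show ?thesis by (simp add: C_def mult_ac)
  qed
  moreover have "zero_mean m R \<le> C * R" if R: "R \<ge> R0" for R
  proof -
    have "R > 0" using R by (auto simp: R0_def)
    then have "C1 * R \<le> C * R" using CC by (intro mult_right_mono) auto
    then show ?thesis using mean[OF R] by linarith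
  qed
  moreover have "R0 > 0" by (simp add: R0_def)
  ultimately show thesis using that CC by blast
qed

text \<open>Between R and r \<le> R exp d the numerator grows by at most C r d and the factor 1 / r
  drops by a proportion of at most d. The change of the quotient is a difference of two terms in
  [0, C d].\<close>

lemma zero_mean_asymp: "((\<lambda>R. zero_mean m R / R) \<longlongrightarrow> D) at_top"
proof (rule slowly_oscillating_tendsto)
  show "\<exists>R0. \<forall>R\<ge>R0. \<exists>r. R \<le> r \<and> r \<le> R * exp d \<and> norm (zero_mean m r / r - D) \<le> e" if "e > 0" "d > 0" for e d
    using good[OF that] unfolding real_norm_def by blast
  fix e :: real assume e: "e > 0"
  obtain C R0 where C: "C > 0" "R0 > 0" "\<And>R. R \<ge> R0 \<Longrightarrow> zero_mean m R \<le> C * R" "\<And>R. R \<ge> R0 \<Longrightarrow> zero_count m R \<le> C * R"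
    by (rule zero_count_linear_bound) (rule that)
  define d where "d = e / (2 * C)"
  have d: "d > 0" using e C by (simp add: d_def)
  have "norm (zero_mean m r / r - zero_mean m R / R) \<le> e" if R: "R \<ge> R0" "R \<le> r" "r \<le> R * exp d" for R r
  proof -
    have p: "R > 0" "r > 0" "r \<ge> R0" using R C by linarith+
    have ld: "0 \<le> ln r - ln R" "ln r - ln R \<le> d"
    proof -
      have "ln r \<le> ln (R * exp d)" using p R by simp
      then show "ln r - ln R \<le> d" using p by (simp add: ln_mult)
    qed (use p R in simp)
    have rr: "0 \<le> 1 - R / r" "1 - R / r \<le> d"
    proof -
      have "exp (- d) \<le> R / r" using R p by (simp add: exp_minus field_simps)
      then show "1 - R / r \<le> d" using exp_ge_add_one_self[of "- d"] by linarith
    qed (use p R in simp)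
    have eq: "zero_mean m r / r - zero_mean m R / R = (zero_mean m r - zero_mean m R) / r - (zero_mean m R / R) * (1 - R / r)"
      using p by (simp add: field_simps)
    have "zero_mean m r - zero_mean m R \<le> zero_count m r * (ln r - ln R)" by (rule zero_mean_diff(2)) (use p R in auto)
    also have "\<dots> \<le> (C * r) * d" using ld C p zero_count_nonneg by (intro mult_mono) auto
    finally have "(zero_mean m r - zero_mean m R) / r \<le> C * d" using p by (simp add: field_simps)
    moreover have "0 \<le> (zero_mean m r - zero_mean m R) / r" using zero_mean_mono[of R r] p R by simp
    moreover have "zero_mean m R / R \<le> C" using C(3)[OF R(1)] p by (simp add: field_simps)
    then have "(zero_mean m R / R) * (1 - R / r) \<le> C * d" using rr C by (intro mult_mono) auto
    moreover have "0 \<le> (zero_mean m R / R) * (1 - R / r)" using rr p zero_mean_nonneg[of R] by simp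
    moreover have "C * d \<le> e" using C e by (simp add: d_def)
    ultimately show ?thesis unfolding eq real_norm_def by linarith
  qed
  then show "\<exists>d>0. \<exists>R0. \<forall>R\<ge>R0. \<forall>r. R \<le> r \<longrightarrow> r \<le> R * exp d \<longrightarrow> norm (zero_mean m r / r - zero_mean m R / R) \<le> e"
    using d by blast
qed

text \<open>A monotone density argument: d times the count at R lies between the increments of
  \<open>zero_mean\<close> over [R e^{-d}, R] and [R, R e^d]. After division by R d, R tends to
  infinity first and d to 0 afterwards.\<close>

lemma zero_count_asymp: "((\<lambda>R. zero_count m R / R) \<longlongrightarrow> D) at_top"
proof -
  have scale: "filterlim (\<lambda>R. R * exp d) at_top at_top" for d :: real
    by (rule filterlim_at_top_mult_tendsto_pos[OF tendsto_const _ filterlim_ident]) simp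
  have lim: "((\<lambda>R. zero_mean m (R * exp d) / R) \<longlongrightarrow> D * exp d) at_top" for d
  proof -
    have "((\<lambda>R. zero_mean m (R * exp d) / (R * exp d) * exp d) \<longlongrightarrow> D * exp d) at_top"
      by (intro tendsto_mult_right filterlim_compose[OF zero_mean_asymp scale])
    then show ?thesis by simp
  qed
  have diff1: "((\<lambda>d::real. (exp d - 1) / d) \<longlongrightarrow> 1) (at_right 0)"
    by (rule tendsto_mono[OF at_le[OF subset_UNIV]]) (use DERIV_exp[of "0::real"] in \<open>simp add: has_field_derivative_iff\<close>)
  have diff2: "((\<lambda>d::real. (1 - exp (- d)) / d) \<longlongrightarrow> 1) (at_right 0)"
  proof -
    have "((\<lambda>d::real. - exp (- d)) has_field_derivative 1) (at 0)" by (auto intro!: derivative_eq_intros)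
    then have "((\<lambda>d::real. (1 - exp (- d)) / d) \<longlongrightarrow> 1) (at 0)" unfolding has_field_derivative_iff by simp
    then show ?thesis by (rule tendsto_mono[OF at_le[OF subset_UNIV]])
  qed
  show ?thesis
  proof (rule order_tendstoI)
    fix a assume "a < D"
    have "((\<lambda>d. D * ((1 - exp (- d)) / d)) \<longlongrightarrow> D * 1) (at_right 0)" by (intro tendsto_mult_left diff2)
    then have "\<forall>\<^sub>F d in at_right 0. D * ((1 - exp (- d)) / d) > a" using \<open>a < D\<close> by (intro order_tendstoD) auto
    then obtain b where b: "b > 0" "\<And>d. 0 < d \<Longrightarrow> d < b \<Longrightarrow> D * ((1 - exp (- d)) / d) > a" by (auto simp: eventually_at_right_field)
    define d where "d = b / 2"
    have d0: "d > 0" "d < b" using b by (auto simp: d_def)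
    note d = d0(1) b(2)[OF d0]
    have "((\<lambda>R. (zero_mean m R / R - zero_mean m (R * exp (- d)) / R) / d) \<longlongrightarrow> (D - D * exp (- d)) / d) at_top"
      using d by (intro tendsto_intros lim zero_mean_asymp) auto
    moreover have "(D - D * exp (- d)) / d = D * ((1 - exp (- d)) / d)" by (simp add: algebra_simps)
    ultimately have "\<forall>\<^sub>F R in at_top. (zero_mean m R / R - zero_mean m (R * exp (- d)) / R) / d > a"
      using d by (intro order_tendstoD) auto
    then show "\<forall>\<^sub>F R in at_top. zero_count m R / R > a"
      using eventually_gt_at_top[of 0]
    proof eventually_elim
      case (elim R)
      have "zero_mean m R - zero_mean m (R * exp (- d)) \<le> zero_count m R * (ln R - ln (R * exp (- d)))"
        using elim d by (intro zero_mean_diff(2)) auto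
      also have "ln R - ln (R * exp (- d)) = d" using elim by (simp add: ln_mult)
      finally have "(zero_mean m R - zero_mean m (R * exp (- d))) / (R * d) \<le> zero_count m R * d / (R * d)"
        using elim d by (intro divide_right_mono) auto
      then have "(zero_mean m R / R - zero_mean m (R * exp (- d)) / R) / d \<le> zero_count m R / R"
        using elim d by (simp add: diff_divide_distrib)
      then show ?case using elim by linarith
    qed
  next
    fix a assume "D < a"
    have "((\<lambda>d. D * ((exp d - 1) / d)) \<longlongrightarrow> D * 1) (at_right 0)" by (intro tendsto_mult_left diff1)
    then have "\<forall>\<^sub>F d in at_right 0. D * ((exp d - 1) / d) < a" using \<open>D < a\<close> by (intro order_tendstoD) auto
    then obtain b where b: "b > 0" "\<And>d. 0 < d \<Longrightarrow> d < b \<Longrightarrow> D * ((exp d - 1) / d) < a" by (auto simp: eventually_at_right_field)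
    define d where "d = b / 2"
    have d0: "d > 0" "d < b" using b by (auto simp: d_def)
    note d = d0(1) b(2)[OF d0]
    have "((\<lambda>R. (zero_mean m (R * exp d) / R - zero_mean m R / R) / d) \<longlongrightarrow> (D * exp d - D) / d) at_top"
      using d by (intro tendsto_intros lim zero_mean_asymp) auto
    moreover have "(D * exp d - D) / d = D * ((exp d - 1) / d)" by (simp add: algebra_simps)
    ultimately have "\<forall>\<^sub>F R in at_top. (zero_mean m (R * exp d) / R - zero_mean m R / R) / d < a"
      using d by (intro order_tendstoD) auto
    then show "\<forall>\<^sub>F R in at_top. zero_count m R / R < a"
      using eventually_gt_at_top[of 0]
    proof eventually_elim
      case (elim R)
      have "zero_count m R * (ln (R * exp d) - ln R) \<le> zero_mean m (R * exp d) - zero_mean m R"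
        using elim d by (intro zero_mean_diff(1)) auto
      moreover have "ln (R * exp d) - ln R = d" using elim by (simp add: ln_mult)
      ultimately have "zero_count m R * d / (R * d) \<le> (zero_mean m (R * exp d) - zero_mean m R) / (R * d)"
        using elim d by (intro divide_right_mono) auto
      then have "zero_count m R / R \<le> (zero_mean m (R * exp d) / R - zero_mean m R / R) / d"
        using elim d by (simp add: diff_divide_distrib)
      then show ?case using elim by linarith
    qed
  qed
qed

text \<open>By \<open>balanced_sum_diff\<close> the oscillation over [R, R e^d] is at most q / R
  times the count at r, with q \<le> 2 d; this is at most 8 C d because e^d \<le> 4 for d \<le>
  1.\<close>

lemma balanced_sum_asymp: "(balanced_sum m \<longlongrightarrow> L) at_top"
proof (rule slowly_oscillating_tendsto)
  show "\<exists>R0. \<forall>R\<ge>R0. \<exists>r. R \<le> r \<and> r \<le> R * exp d \<and> norm (balanced_sum m r - L) \<le> e" if "e > 0" "d > 0" for e d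
    using good[OF that] by blast
  fix e :: real assume e: "e > 0"
  obtain C R0 where C: "C > 0" "R0 > 0" "\<And>R. R \<ge> R0 \<Longrightarrow> zero_mean m R \<le> C * R" "\<And>R. R \<ge> R0 \<Longrightarrow> zero_count m R \<le> C * R"
    by (rule zero_count_linear_bound) (rule that)
  define d where "d = min 1 (e / (8 * C))"
  have d: "d > 0" "d \<le> 1" "8 * C * d \<le> e" using e C by (auto simp: d_def min_def field_simps)
  have "cmod (balanced_sum m r - balanced_sum m R) \<le> e" if R: "R \<ge> R0" "R \<le> r" "r \<le> R * exp d" for R r
  proof -
    have p: "R > 0" "r > 0" "r \<ge> R0" using R C by linarith+
    define q where "q = 1 - R\<^sup>2 / r\<^sup>2"
    have q: "0 \<le> q" "q \<le> 2 * d"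
    proof -
      have "R\<^sup>2 \<le> r\<^sup>2" using p R by (intro power_mono) auto
      then show "0 \<le> q" using p by (simp add: q_def)
      have "exp (- d) \<le> R / r" using R p by (simp add: exp_minus field_simps)
      then have "(exp (- d))\<^sup>2 \<le> (R / r)\<^sup>2" by (intro power_mono) auto
      then have "exp (- (2 * d)) \<le> R\<^sup>2 / r\<^sup>2" by (simp add: power_divide exp_double[symmetric] mult.commute flip: exp_of_nat_mult)
      then show "q \<le> 2 * d" using exp_ge_add_one_self[of "- (2 * d)"] unfolding q_def by linarith
    qed
    have "cmod (balanced_sum m r - balanced_sum m R) \<le> cmod (balanced_sum m r - balanced_sum m R - zero_moment m R * of_real q) + cmod (zero_moment m R * of_real q)"
      using norm_triangle_ineq[of "balanced_sum m r - balanced_sum m R - zero_moment m R * of_real q" "zero_moment m R * of_real q"] by simp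
    also have "\<dots> \<le> (zero_count m r - zero_count m R) * (q / R) + zero_count m R / R * q"
    proof (rule add_mono)
      show "cmod (balanced_sum m r - balanced_sum m R - zero_moment m R * of_real q) \<le> (zero_count m r - zero_count m R) * (q / R)"
        unfolding q_def by (rule balanced_sum_diff[OF p(1) R(2)])
      show "cmod (zero_moment m R * of_real q) \<le> zero_count m R / R * q"
        using cmod_zero_moment[OF p(1)] q by (simp add: norm_mult mult_right_mono del: times_divide_eq_left)
    qed
    also have "\<dots> = zero_count m r * q / R" using p by (simp add: field_simps)
    also have "\<dots> \<le> (C * (R * exp d)) * (2 * d) / R"
    proof -
      have "zero_count m r \<le> C * r" by (rule C(4)[OF p(3)])
      also have "\<dots> \<le> C * (R * exp d)" using R C by (intro mult_left_mono) auto
      finally show ?thesis using q p zero_count_nonneg[of r] C by (intro divide_right_mono mult_mono) auto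
    qed
    also have "\<dots> = 2 * C * d * exp d" using p by simp
    also have "\<dots> \<le> 2 * C * d * 4"
    proof -
      have "exp d \<le> exp 1" using d by simp
      also have "exp 1 \<le> (4::real)" using exp_le by simp
      finally show ?thesis using C d by (intro mult_left_mono) auto
    qed
    also have "\<dots> \<le> e" using d by simp
    finally show ?thesis .
  qed
  then show "\<exists>d>0. \<exists>R0. \<forall>R\<ge>R0. \<forall>r. R \<le> r \<longrightarrow> r \<le> R * exp d \<longrightarrow> norm (balanced_sum m r - balanced_sum m R) \<le> e"
    using d by blast
qed

text \<open>\<open>zero_moment\<close> governs the rate of change of the convergent
  \<open>balanced_sum\<close>. Dividing the increment formula by q bounds it by the increment of
  \<open>balanced_sum\<close> over q, which tends to 0 for fixed d, plus the increment of the count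
  over R, which tends to D (e^d - 1). The last limit rests on the existence of the density D; a
  linear bound on the count would not give it.\<close>

lemma zero_moment_asymp: "(zero_moment m \<longlongrightarrow> 0) at_top"
proof (rule tendstoI)
  fix e :: real assume e: "e > 0"
  have scale: "filterlim (\<lambda>R. R * exp d) at_top at_top" for d :: real
    by (rule filterlim_at_top_mult_tendsto_pos[OF tendsto_const _ filterlim_ident]) simp
  have "((\<lambda>d. D * (exp d - 1)) \<longlongrightarrow> D * (exp 0 - 1)) (at_right 0)" by (intro tendsto_intros)
  then have "\<forall>\<^sub>F d in at_right 0. D * (exp d - 1) < e" using e by (intro order_tendstoD) auto
  then obtain b where b: "b > 0" "\<And>d. 0 < d \<Longrightarrow> d < b \<Longrightarrow> D * (exp d - 1) < e" by (auto simp: eventually_at_right_field)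
  define d where "d = b / 2"
  have d0: "d > 0" "d < b" using b by (auto simp: d_def)
  note d = d0(1) b(2)[OF d0]
  define q where "q = 1 - exp (- (2 * d))"
  have q: "q > 0" using d by (simp add: q_def)
  have "((\<lambda>R. cmod (balanced_sum m (R * exp d) - balanced_sum m R) / q + (zero_count m (R * exp d) / (R * exp d) * exp d - zero_count m R / R)) \<longlongrightarrow> cmod (L - L) / q + (D * exp d - D)) at_top"
    using q by (intro tendsto_intros balanced_sum_asymp zero_count_asymp filterlim_compose[OF balanced_sum_asymp scale] filterlim_compose[OF zero_count_asymp scale]) auto
  moreover have "cmod (L - L) / q + (D * exp d - D) = D * (exp d - 1)" by (simp add: algebra_simps)
  ultimately have "\<forall>\<^sub>F R in at_top. cmod (balanced_sum m (R * exp d) - balanced_sum m R) / q + (zero_count m (R * exp d) / (R * exp d) * exp d - zero_count m R / R) < e"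
    using d by (intro order_tendstoD) auto
  then show "\<forall>\<^sub>F R in at_top. dist (zero_moment m R) 0 < e"
    using eventually_gt_at_top[of 0]
  proof eventually_elim
    case (elim R)
    have qeq: "1 - R\<^sup>2 / (R * exp d)\<^sup>2 = q"
      using elim by (simp add: q_def power_mult_distrib exp_minus exp_double[symmetric] divide_inverse mult.commute flip: exp_of_nat_mult)
    have "cmod (zero_moment m R * of_real q) \<le> cmod (balanced_sum m (R * exp d) - balanced_sum m R) + (zero_count m (R * exp d) - zero_count m R) * (q / R)"
      using balanced_sum_diff[of R "R * exp d"] elim d
        norm_triangle_ineq4[of "balanced_sum m (R * exp d) - balanced_sum m R" "balanced_sum m (R * exp d) - balanced_sum m R - zero_moment m R * of_real q"]
      unfolding qeq by simp
    then have "cmod (zero_moment m R) * q / q \<le> (cmod (balanced_sum m (R * exp d) - balanced_sum m R) + (zero_count m (R * exp d) - zero_count m R) * (q / R)) / q"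
      using q by (intro divide_right_mono) (auto simp: norm_mult)
    also have "\<dots> = cmod (balanced_sum m (R * exp d) - balanced_sum m R) / q + (zero_count m (R * exp d) / (R * exp d) * exp d - zero_count m R / R)"
      using q elim by (simp add: field_simps)
    finally show ?case using elim q by simp
  qed
qed

end

end

section \<open>Limits of the Fourier coefficients of orders zero and one\<close>

lemma integral_circle_fold:
  fixes g :: "real \<Rightarrow> complex"
  assumes c: "continuous_on UNIV g" and per: "\<And>t. g (t + 2 * pi) = g t"
  shows "integral {0..2*pi} g = integral {0..pi} g + integral {0..pi} (\<lambda>t. g (- t))"
proof -
  have "integral {0..2*pi} g = integral {0..pi} g + integral {pi..2*pi} g"
    by (rule Henstock_Kurzweil_Integration.integral_combine[symmetric]) 
       (auto intro!: integrable_continuous_real continuous_on_subset[OF c])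
  also have "integral {pi..2*pi} g = integral {-(2*pi)..-pi} (\<lambda>t. g (- t))"
    by (rule Henstock_Kurzweil_Integration.integral_reflect_real[symmetric])
  also have "\<dots> = integral {0..pi} ((\<lambda>t. g (- t)) \<circ> (+) (- (2*pi)))"
    using integral_shift_Icc_real[of 0 pi "\<lambda>t. g (- t)" "- (2*pi)"] by simp
  also have "(\<lambda>t. g (- t)) \<circ> (+) (- (2*pi)) = (\<lambda>t. g (- t))"
    using per[of "- t" for t] by (simp add: fun_eq_iff add.commute)
  finally show ?thesis .
qed

text \<open>Meant for \<psi> = 1 and \<psi> t = e^{-it}. The lower half-circle is reached through t
  to - t, so that both half-circles are compared with a multiple of sin t on [0, pi].\<close>

lemma circle_integral_approx:
  fixes u :: "real \<Rightarrow> real" and \<psi> :: "real \<Rightarrow> complex"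
  assumes cu: "continuous_on UNIV u" "\<And>t. u (t + 2 * pi) = u t"
    and c\<psi>: "continuous_on UNIV \<psi>" "\<And>t. \<psi> (t + 2 * pi) = \<psi> t" "\<And>t. cmod (\<psi> t) \<le> 1"
    and e: "integral {0..pi} (\<lambda>t. \<bar>u t - s1 * sin t\<bar>) \<le> e" "integral {0..pi} (\<lambda>t. \<bar>u (- t) - s2 * sin t\<bar>) \<le> e"
  shows "cmod (integral {0..2*pi} (\<lambda>t. of_real (u t) * \<psi> t)
     - (of_real s1 * integral {0..pi} (\<lambda>t. of_real (sin t) * \<psi> t) + of_real s2 * integral {0..pi} (\<lambda>t. of_real (sin t) * \<psi> (- t)))) \<le> 2 * e"
proof -
  have cu': "continuous_on A (\<lambda>t. u (- t))" "continuous_on A u" for A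
    by (auto intro!: continuous_on_compose2[OF cu(1)] continuous_intros)
  have c\<psi>': "continuous_on A (\<lambda>t. \<psi> (- t))" "continuous_on A \<psi>" for A
    by (auto intro!: continuous_on_compose2[OF c\<psi>(1)] continuous_intros)
  have part: "cmod (integral {0..pi} (\<lambda>t. of_real (v t) * \<phi> t) - of_real s * integral {0..pi} (\<lambda>t. of_real (sin t) * \<phi> t)) \<le> integral {0..pi} (\<lambda>t. \<bar>v t - s * sin t\<bar>)"
    if [continuous_intros]: "continuous_on {0..pi} v" "continuous_on {0..pi} \<phi>" and \<phi>: "\<And>t. cmod (\<phi> t) \<le> 1" for v :: "real \<Rightarrow> real" and \<phi> :: "real \<Rightarrow> complex" and s
  proof -
    have "integral {0..pi} (\<lambda>t. of_real (v t) * \<phi> t) - of_real s * integral {0..pi} (\<lambda>t. of_real (sin t) * \<phi> t)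
       = integral {0..pi} (\<lambda>t. of_real (v t) * \<phi> t) - integral {0..pi} (\<lambda>t. of_real s * (of_real (sin t) * \<phi> t))"
      by simp
    also have "\<dots> = integral {0..pi} (\<lambda>t. of_real (v t) * \<phi> t - of_real s * (of_real (sin t) * \<phi> t))"
      by (rule Henstock_Kurzweil_Integration.integral_diff[symmetric]) (auto intro!: integrable_continuous_real continuous_intros)
    also have "cmod \<dots> \<le> integral {0..pi} (\<lambda>t. \<bar>v t - s * sin t\<bar>)"
    proof (rule Henstock_Kurzweil_Integration.integral_norm_bound_integral)
      show "(\<lambda>t. of_real (v t) * \<phi> t - of_real s * (of_real (sin t) * \<phi> t)) integrable_on {0..pi}"
        by (auto intro!: integrable_continuous_real continuous_intros)
      show "(\<lambda>t. \<bar>v t - s * sin t\<bar>) integrable_on {0..pi}" by (auto intro!: integrable_continuous_real continuous_intros)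
      fix t
      have "of_real (v t) * \<phi> t - of_real s * (of_real (sin t) * \<phi> t) = of_real (v t - s * sin t) * \<phi> t"
        by (simp add: algebra_simps)
      then have "cmod (of_real (v t) * \<phi> t - of_real s * (of_real (sin t) * \<phi> t)) = \<bar>v t - s * sin t\<bar> * cmod (\<phi> t)"
        by (simp only: norm_mult norm_of_real)
      then show "cmod (of_real (v t) * \<phi> t - of_real s * (of_real (sin t) * \<phi> t)) \<le> \<bar>v t - s * sin t\<bar>"
        using mult_left_mono[OF \<phi>[of t], of "\<bar>v t - s * sin t\<bar>"] by simp
    qed
    finally show ?thesis .
  qed
  have "integral {0..2*pi} (\<lambda>t. of_real (u t) * \<psi> t) = integral {0..pi} (\<lambda>t. of_real (u t) * \<psi> t) + integral {0..pi} (\<lambda>t. of_real (u (- t)) * \<psi> (- t))"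
    by (rule integral_circle_fold) (auto intro!: continuous_intros cu c\<psi> simp: cu(2) c\<psi>(2))
  then have "integral {0..2*pi} (\<lambda>t. of_real (u t) * \<psi> t)
     - (of_real s1 * integral {0..pi} (\<lambda>t. of_real (sin t) * \<psi> t) + of_real s2 * integral {0..pi} (\<lambda>t. of_real (sin t) * \<psi> (- t)))
    = (integral {0..pi} (\<lambda>t. of_real (u t) * \<psi> t) - of_real s1 * integral {0..pi} (\<lambda>t. of_real (sin t) * \<psi> t))
    + (integral {0..pi} (\<lambda>t. of_real (u (- t)) * \<psi> (- t)) - of_real s2 * integral {0..pi} (\<lambda>t. of_real (sin t) * \<psi> (- t)))"
    by simp
  also have "cmod \<dots> \<le> e + e"
    using norm_triangle_le[OF add_mono[OF order_trans[OF part[OF cu'(2) c\<psi>'(2) c\<psi>(3)] e(1)] order_trans[OF part[OF cu'(1) c\<psi>'(1) c\<psi>(3)] e(2)]]] .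
  finally show ?thesis by simp
qed

text \<open>The vanishing real parts are integrals of sin t cos t over [0, pi]. They are the origin
  of the relation Re (L + f'(0) / f(0)) = 0.\<close>

lemma integral_sin_cis:
  "integral {0..pi} (\<lambda>t. of_real (sin t)) = (2::complex)"
  "Re (integral {0..pi} (\<lambda>t. of_real (sin t) * cis (- t))) = 0"
  "Re (integral {0..pi} (\<lambda>t. of_real (sin t) * cis t)) = 0"
proof -
  have "(sin has_integral (- cos pi - (- cos 0))) {0..pi}"
    by (rule fundamental_theorem_of_calculus) (auto intro!: derivative_eq_intros simp: has_real_derivative_iff_has_vector_derivative[symmetric])
  then have "((\<lambda>t. of_real (sin t)) has_integral complex_of_real 2) {0..pi}"
    by (intro has_integral_of_real) simp
  then show "integral {0..pi} (\<lambda>t. of_real (sin t)) = (2::complex)" by (simp add: integral_unique)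
  have sc: "((\<lambda>t. sin t * cos t) has_integral ((sin pi)\<^sup>2 / 2 - (sin 0)\<^sup>2 / 2)) {0..pi}"
    by (rule fundamental_theorem_of_calculus) (auto intro!: derivative_eq_intros simp: has_real_derivative_iff_has_vector_derivative[symmetric])
  have re: "Re (integral {0..pi} g) = integral {0..pi} (\<lambda>t. Re (g t))" if "continuous_on {0..pi} g" for g :: "real \<Rightarrow> complex"
    using integral_linear[OF integrable_continuous_real[OF that] bounded_linear_Re] by (simp add: o_def)
  show "Re (integral {0..pi} (\<lambda>t. of_real (sin t) * cis (- t))) = 0"
    by (subst re) (use sc in \<open>auto intro!: continuous_intros simp: integral_unique\<close>)
  show "Re (integral {0..pi} (\<lambda>t. of_real (sin t) * cis t)) = 0"
    by (subst re) (use sc in \<open>auto intro!: continuous_intros simp: integral_unique\<close>)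
qed

lemma cartwright_zero_asymptotics:
  fixes f :: "complex \<Rightarrow> complex"
  assumes f: "f holomorphic_on UNIV" and A: "A \<ge> 1" "B \<ge> 0" "\<And>z. cmod (f z) \<le> A * exp (B * cmod z)"
    and int: "integrable lborel (\<lambda>t. ln (max 1 (cmod (f (of_real t)))) / (1 + t\<^sup>2))"
    and zs: "is_zero_set m f" and f0: "f 0 \<noteq> 0" and fin: "\<And>R. finite (zeros_in m R)"
  shows "\<exists>D L. Re (L + deriv f 0 / f 0) = 0 \<and> ((\<lambda>R. zero_count m R / R) \<longlongrightarrow> D) at_top
     \<and> (balanced_sum m \<longlongrightarrow> L) at_top \<and> (zero_moment m \<longlongrightarrow> 0) at_top"
proof -
  have m0: "m 0 = 0" using is_zero_set_iff(1)[OF f zs, of 0] f0 by simp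
  have "{z. f z = 0} = (\<Union>n::nat. zeros_in m n)"
    using is_zero_set_iff(1)[OF f zs] reals_Archimedean2 by (auto simp: zeros_in_def)
  then have cz: "countable {z. f z = 0}" using countable_finite[OF fin] by simp
  obtain \<sigma>1 \<sigma>2 where \<sigma>: "\<And>\<epsilon> \<delta>. \<epsilon> > 0 \<Longrightarrow> \<delta> > 0 \<Longrightarrow> \<exists>R0>0. \<forall>R\<ge>R0. \<exists>r. R \<le> r \<and> r \<le> R * exp \<delta> \<and> (\<forall>z. cmod z = r \<longrightarrow> f z \<noteq> 0) \<and>
      integral {0..pi} (\<lambda>t. \<bar>ln (cmod (f (r * cis t))) - \<sigma>1 * (r * sin t)\<bar>) \<le> \<epsilon> * r \<and>
      integral {0..pi} (\<lambda>t. \<bar>ln (cmod (f (r * cis (- t)))) - \<sigma>2 * (r * sin t)\<bar>) \<le> \<epsilon> * r"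
    using cartwright_good_radii[OF f A int cz] by blast
  define \<kappa> where "\<kappa> = deriv f 0 / f 0"
  define c0 where "c0 = ln (cmod (f 0))"
  \<comment> \<open>By Jensen's formula 2 pi \<open>zero_mean m r\<close> is approximately 2 r
    (\<sigma>1 + \<sigma>2) on good radii, since sin has integral 2 over [0, pi].\<close>
  define D where "D = (\<sigma>1 + \<sigma>2) / pi"
  \<comment> \<open>The limit of \<open>circle_moment f r\<close> along good radii; removing f'(0) /
    f(0) leaves the limit \<open>L\<close> of \<open>balanced_sum\<close>.\<close>
  define L1 where "L1 = (of_real \<sigma>1 * integral {0..pi} (\<lambda>t. of_real (sin t) * cis (- t)) + of_real \<sigma>2 * integral {0..pi} (\<lambda>t. of_real (sin t) * cis t)) / of_real pi"
  define L where "L = L1 - \<kappa>"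
  have "Re L1 = 0" unfolding L1_def Re_divide_of_real plus_complex.sel times_complex.sel Re_complex_of_real Im_complex_of_real integral_sin_cis by simp
  then have ReL: "Re (L + \<kappa>) = 0" by (simp add: L_def)
  have good: "\<exists>R0. \<forall>R\<ge>R0. \<exists>r. R \<le> r \<and> r \<le> R * exp d \<and> \<bar>zero_mean m r / r - D\<bar> \<le> e \<and> cmod (balanced_sum m r - L) \<le> e"
    if e: "e > 0" and d: "d > 0" for e d
  proof -
    obtain R0 where R0: "R0 > 0" "\<And>R. R \<ge> R0 \<Longrightarrow> \<exists>r. R \<le> r \<and> r \<le> R * exp d \<and> (\<forall>z. cmod z = r \<longrightarrow> f z \<noteq> 0) \<and>
      integral {0..pi} (\<lambda>t. \<bar>ln (cmod (f (r * cis t))) - \<sigma>1 * (r * sin t)\<bar>) \<le> e * r \<and>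
      integral {0..pi} (\<lambda>t. \<bar>ln (cmod (f (r * cis (- t)))) - \<sigma>2 * (r * sin t)\<bar>) \<le> e * r"
      using \<sigma>[OF e d] by blast
    show ?thesis
    proof (rule exI[of _ "max R0 (2 * \<bar>c0\<bar> / e)"], intro allI impI)
      fix R assume R: "R \<ge> max R0 (2 * \<bar>c0\<bar> / e)"
      then obtain r where r: "R \<le> r" "r \<le> R * exp d" "\<And>z. cmod z = r \<Longrightarrow> f z \<noteq> 0"
        and i1: "integral {0..pi} (\<lambda>t. \<bar>ln (cmod (f (r * cis t))) - \<sigma>1 * (r * sin t)\<bar>) \<le> e * r"
        and i2: "integral {0..pi} (\<lambda>t. \<bar>ln (cmod (f (r * cis (- t)))) - \<sigma>2 * (r * sin t)\<bar>) \<le> e * r"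
        using R0(2)[of R] by auto
      have rp: "r > 0" using R R0 r by auto
      define u where "u t = ln (cmod (f (r * cis t)))" for t
      have nzu: "f (r * cis t) \<noteq> 0" for t by (rule r(3)) (use rp in \<open>simp add: norm_mult\<close>)
      have "continuous_on UNIV (\<lambda>t. f (r * cis t))"
        by (rule continuous_on_compose2[OF holomorphic_on_imp_continuous_on[OF f]]) (auto intro!: continuous_intros)
      then have cu: "continuous_on UNIV u" unfolding u_def using nzu by (intro continuous_intros) auto
      have per: "cis (t + 2 * pi) = cis t" for t by (simp add: complex_eq_iff)
      have pu: "u (t + 2 * pi) = u t" for t by (simp add: u_def per)
      have j: "integral {0..pi} (\<lambda>t. \<bar>u t - (\<sigma>1 * r) * sin t\<bar>) \<le> e * r" "integral {0..pi} (\<lambda>t. \<bar>u (- t) - (\<sigma>2 * r) * sin t\<bar>) \<le> e * r"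
        using i1 i2 by (simp_all add: u_def mult.assoc)
      have df: "integral {0..2*pi} u = 2 * pi * (c0 + zero_mean m r)"
        "circle_moment f r = \<kappa> + balanced_sum m r"
        using disc_formulas(1,2)[OF f zs f0 rp r(3)] unfolding u_def c0_def \<kappa>_def zero_mean_def balanced_sum_def by simp_all
      have "cmod (integral {0..2*pi} (\<lambda>t. of_real (u t) * 1)
         - (of_real (\<sigma>1 * r) * integral {0..pi} (\<lambda>t. of_real (sin t) * 1) + of_real (\<sigma>2 * r) * integral {0..pi} (\<lambda>t. of_real (sin t) * 1))) \<le> 2 * (e * r)"
        by (rule circle_integral_approx[OF cu pu _ _ _ j]) auto
      moreover have "integral {0..2*pi} (\<lambda>t. of_real (u t)) = complex_of_real (integral {0..2*pi} u)"
        using integral_linear[OF integrable_continuous_real[OF continuous_on_subset[OF cu]] bounded_linear_of_real] by (simp add: o_def)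
      ultimately have "cmod (of_real (2 * pi * (c0 + zero_mean m r)) - (of_real (\<sigma>1 * r) * 2 + of_real (\<sigma>2 * r) * 2)) \<le> 2 * (e * r)"
        unfolding mult_1_right integral_sin_cis df by simp
      moreover have "complex_of_real (2 * pi * (c0 + zero_mean m r)) - (of_real (\<sigma>1 * r) * 2 + of_real (\<sigma>2 * r) * 2) = of_real (2 * pi * (c0 + zero_mean m r) - 2 * r * (\<sigma>1 + \<sigma>2))"
        by (simp add: algebra_simps)
      ultimately have b1: "\<bar>2 * pi * (c0 + zero_mean m r) - 2 * r * (\<sigma>1 + \<sigma>2)\<bar> \<le> 2 * (e * r)" by (simp only: norm_of_real)
      have "zero_mean m r / r - D = (2 * pi * (c0 + zero_mean m r) - 2 * r * (\<sigma>1 + \<sigma>2)) / (2 * pi * r) - c0 / r"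
        using rp by (simp add: D_def field_simps)
      also have "\<bar>\<dots>\<bar> \<le> \<bar>2 * pi * (c0 + zero_mean m r) - 2 * r * (\<sigma>1 + \<sigma>2)\<bar> / (2 * pi * r) + \<bar>c0\<bar> / r"
        using rp abs_triangle_ineq4[of "(2 * pi * (c0 + zero_mean m r) - 2 * r * (\<sigma>1 + \<sigma>2)) / (2 * pi * r)" "c0 / r"] by (simp add: abs_mult)
      also have "\<dots> \<le> e / 2 + e / 2"
      proof (rule add_mono)
        have "\<bar>2 * pi * (c0 + zero_mean m r) - 2 * r * (\<sigma>1 + \<sigma>2)\<bar> / (2 * pi * r) \<le> 2 * (e * r) / (2 * pi * r)"
          using b1 rp by (intro divide_right_mono) auto
        also have "\<dots> = e / pi" using rp by simp
        also have "\<dots> \<le> e / 2" using e pi_ge_two by (intro divide_left_mono) auto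
        finally show "\<bar>2 * pi * (c0 + zero_mean m r) - 2 * r * (\<sigma>1 + \<sigma>2)\<bar> / (2 * pi * r) \<le> e / 2" .
        have "2 * \<bar>c0\<bar> / e \<le> r" using R r by simp
        then show "\<bar>c0\<bar> / r \<le> e / 2" using e rp by (simp add: field_simps)
      qed
      finally have g1: "\<bar>zero_mean m r / r - D\<bar> \<le> e" by simp
      have "cmod (integral {0..2*pi} (\<lambda>t. of_real (u t) * cis (- t))
         - (of_real (\<sigma>1 * r) * integral {0..pi} (\<lambda>t. of_real (sin t) * cis (- t)) + of_real (\<sigma>2 * r) * integral {0..pi} (\<lambda>t. of_real (sin t) * cis (- (- t))))) \<le> 2 * (e * r)"
        by (rule circle_integral_approx[OF cu pu _ _ _ j]) (auto intro!: continuous_intros simp: complex_eq_iff cos_diff sin_diff)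
      moreover have "integral {0..2*pi} (\<lambda>t. of_real (u t) * cis (- t)) = of_real (pi * r) * circle_moment f r"
        using rp by (simp add: circle_moment_def u_def)
      moreover have "of_real (\<sigma>1 * r) * integral {0..pi} (\<lambda>t. of_real (sin t) * cis (- t)) + of_real (\<sigma>2 * r) * integral {0..pi} (\<lambda>t. of_real (sin t) * cis (- (- t))) = of_real (pi * r) * L1"
      proof -
        have "of_real (pi * r) * L1 = of_real r * (of_real \<sigma>1 * integral {0..pi} (\<lambda>t. of_real (sin t) * cis (- t)) + of_real \<sigma>2 * integral {0..pi} (\<lambda>t. of_real (sin t) * cis t))"
          by (simp add: L1_def)
        then show ?thesis by (simp add: algebra_simps)
      qed
      ultimately have "cmod (of_real (pi * r) * circle_moment f r - of_real (pi * r) * L1) \<le> 2 * (e * r)" by simp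
      then have "pi * r * cmod (circle_moment f r - L1) \<le> 2 * (e * r)"
        using rp by (simp add: right_diff_distrib[symmetric] norm_mult del: of_real_mult) 
      moreover have "circle_moment f r - L1 = balanced_sum m r - L" by (simp add: df L_def)
      ultimately have "r * (pi * cmod (balanced_sum m r - L)) \<le> r * (2 * e)" by (simp add: mult_ac)
      then have "pi * cmod (balanced_sum m r - L) \<le> 2 * e" using rp by (rule mult_left_le_imp_le)
      moreover have "2 * cmod (balanced_sum m r - L) \<le> pi * cmod (balanced_sum m r - L)" using pi_ge_two by (rule mult_right_mono) simp
      ultimately have "cmod (balanced_sum m r - L) \<le> e" by linarith
      then show "\<exists>r. R \<le> r \<and> r \<le> R * exp d \<and> \<bar>zero_mean m r / r - D\<bar> \<le> e \<and> cmod (balanced_sum m r - L) \<le> e"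
        using r g1 by blast
    qed
  qed
  show ?thesis
    using ReL zero_count_asymp[OF fin m0 good] balanced_sum_asymp[OF fin m0 good] zero_moment_asymp[OF fin m0 good]
    unfolding \<kappa>_def by blast
qed

text \<open>In the third disc formula the linear term tends to the real part of (x - b) (L + f'(0) /
  f(0)), which is 0 because x - b is real. The remaining error is O(R) / R^2.\<close>

lemma cartwright_value_limit:
  fixes f :: "complex \<Rightarrow> complex" and x b :: real
  assumes f: "f holomorphic_on UNIV" and A: "A \<ge> 1" "B \<ge> 0" "\<And>z. cmod (f z) \<le> A * exp (B * cmod z)"
    and zs: "is_zero_set m f" and f0: "f 0 \<noteq> 0" and fin: "\<And>R. finite (zeros_in m R)"
    and asy: "Re (L + deriv f 0 / f 0) = 0" "((\<lambda>R. zero_count m R / R) \<longlongrightarrow> D) at_top"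
      "(balanced_sum m \<longlongrightarrow> L) at_top" "(zero_moment m \<longlongrightarrow> 0) at_top"
    and x: "f (of_real x) \<noteq> 0" "f (of_real b) \<noteq> 0"
  shows "((\<lambda>R. \<Sum>a\<in>zeros_in m R. m a * (ln (cmod (of_real x - a)) - ln (cmod (of_real b - a)))) \<longlongrightarrow> ln (cmod (f (of_real x))) - ln (cmod (f (of_real b)))) at_top"
proof -
  have m0: "m 0 = 0" using is_zero_set_iff(1)[OF f zs, of 0] f0 by simp
  define \<kappa> where "\<kappa> = deriv f 0 / f 0"
  define c0 where "c0 = ln (cmod (f 0))"
  define V where "V = ln (cmod (f (of_real x))) - ln (cmod (f (of_real b)))"
  define \<Psi> where "\<Psi> R = (\<Sum>a\<in>zeros_in m R. m a * (ln (cmod (of_real x - a)) - ln (cmod (of_real b - a))))" for R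
  define C where "C = (cmod (of_real x))\<^sup>2 + (cmod (of_real b))\<^sup>2"
  define \<Phi> where "\<Phi> R = \<bar>Re ((of_real x - of_real b) * (\<kappa> + balanced_sum m R + zero_moment m R))\<bar>
      + C * (4 * pi * (ln A / R + B) + 2 * pi * \<bar>c0\<bar> / R + 2 * (zero_count m R / R)) / R" for R
  have "(\<Phi> \<longlongrightarrow> \<bar>Re ((of_real x - of_real b) * (\<kappa> + L + 0))\<bar> + 0) at_top"
    unfolding \<Phi>_def
  proof (rule tendsto_add)
    show "((\<lambda>R. \<bar>Re ((of_real x - of_real b) * (\<kappa> + balanced_sum m R + zero_moment m R))\<bar>) \<longlongrightarrow> \<bar>Re ((of_real x - of_real b) * (\<kappa> + L + 0))\<bar>) at_top"
      by (intro tendsto_intros asy)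
    have inv: "((\<lambda>R::real. c / R) \<longlongrightarrow> 0) at_top" for c
      by (intro tendsto_divide_0[OF tendsto_const] filterlim_at_top_imp_at_infinity filterlim_ident)
    have "((\<lambda>R. C * (4 * pi * (ln A / R + B) + 2 * pi * \<bar>c0\<bar> / R + 2 * (zero_count m R / R))) \<longlongrightarrow> C * (4 * pi * (0 + B) + 0 + 2 * D)) at_top"
      by (intro tendsto_intros inv asy)
    then show "((\<lambda>R. C * (4 * pi * (ln A / R + B) + 2 * pi * \<bar>c0\<bar> / R + 2 * (zero_count m R / R)) / R) \<longlongrightarrow> 0) at_top"
      by (rule tendsto_divide_0) (intro filterlim_at_top_imp_at_infinity filterlim_ident)
  qed
  moreover have "Re ((of_real x - of_real b) * (\<kappa> + L + 0)) = 0"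
  proof -
    have "(of_real x - of_real b) * (\<kappa> + L + 0) = of_real (x - b) * (L + \<kappa>)" by simp
    then show ?thesis using asy(1) unfolding \<kappa>_def[symmetric] by (simp only: times_complex.sel Re_complex_of_real Im_complex_of_real)
  qed
  ultimately have "(\<Phi> \<longlongrightarrow> \<bar>0\<bar> + 0) at_top" by (simp only:)
  then have \<Phi>0: "(\<Phi> \<longlongrightarrow> 0) at_top" by simp
  have main: "\<bar>V - \<Psi> R\<bar> \<le> \<Phi> R" if R: "R > 0" "R \<ge> 2 * \<bar>x\<bar>" "R \<ge> 2 * \<bar>b\<bar>" and nz: "\<And>z. cmod z = R \<Longrightarrow> f z \<noteq> 0" for R
  proof -
    define u where "u t = ln (cmod (f (R * cis t)))" for t
    define s where "s = ln A + B * R"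
    have nzu: "f (R * cis t) \<noteq> 0" for t by (rule nz) (use R in \<open>simp add: norm_mult\<close>)
    have "continuous_on {0..2*pi} (\<lambda>t. f (R * cis t))"
      by (rule continuous_on_compose2[OF holomorphic_on_imp_continuous_on[OF f]]) (auto intro!: continuous_intros)
    then have cu: "continuous_on {0..2*pi} u" unfolding u_def using nzu by (intro continuous_intros) auto
    have us: "u t \<le> s" for t
    proof -
      have "cmod (f (R * cis t)) \<le> A * exp (B * R)" using A(3)[of "R * cis t"] R by (simp add: norm_mult)
      then have "u t \<le> ln (A * exp (B * R))" unfolding u_def using nzu[of t] A by (subst ln_le_cancel_iff) auto
      then show ?thesis using A by (simp add: s_def ln_mult)
    qed
    have s0: "s \<ge> 0" using A R by (simp add: s_def)
    \<comment> \<open>From u \<le> s and s \<ge> 0 follows |u| \<le> 2 s - u. Jensen's formula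
      bounds the mean of u from below, so the upper bound on |f| alone controls the mean of |ln
      |f||.\<close>
    have "integral {0..2*pi} (\<lambda>t. \<bar>u t\<bar>) \<le> integral {0..2*pi} (\<lambda>t. 2 * s - u t)"
    proof (rule integral_le)
      show "\<bar>u t\<bar> \<le> 2 * s - u t" for t using us[of t] s0 by linarith
    qed (auto intro!: integrable_continuous_real continuous_intros cu)
    also have "\<dots> = 4 * pi * s - integral {0..2*pi} u"
      by (subst Henstock_Kurzweil_Integration.integral_diff) (auto intro!: integrable_continuous_real continuous_intros cu)
    also have "integral {0..2*pi} u = 2 * pi * (c0 + zero_mean m R)"
      using disc_formulas(1)[OF f zs f0 R(1) nz] unfolding u_def c0_def zero_mean_def by simp
    also have "4 * pi * s - 2 * pi * (c0 + zero_mean m R) \<le> 4 * pi * s + 2 * pi * \<bar>c0\<bar>"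
    proof -
      have "2 * pi * (- \<bar>c0\<bar>) \<le> 2 * pi * (c0 + zero_mean m R)"
        using zero_mean_nonneg[OF fin m0, of R] by (intro mult_left_mono) auto
      then show ?thesis by simp
    qed
    finally have I: "integral {0..2*pi} (\<lambda>t. \<bar>u t\<bar>) \<le> 4 * pi * s + 2 * pi * \<bar>c0\<bar>" .
    have cm: "circle_moment f R = \<kappa> + balanced_sum m R"
      using disc_formulas(2)[OF f zs f0 R(1) nz] unfolding \<kappa>_def balanced_sum_def by simp
    have "\<bar>V - \<Psi> R - Re ((of_real x - of_real b) * (circle_moment f R + zero_moment m R))\<bar> \<le> C * (integral {0..2*pi} (\<lambda>t. \<bar>u t\<bar>) + 2 * zero_count m R) / R\<^sup>2"
      unfolding V_def \<Psi>_def C_def u_def zero_moment_def zero_count_def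
      by (rule disc_formulas(3)[OF f zs f0 R(1) nz]) (use R x in auto)
    also have "\<dots> \<le> C * ((4 * pi * s + 2 * pi * \<bar>c0\<bar>) + 2 * zero_count m R) / R\<^sup>2"
      using I by (intro divide_right_mono mult_left_mono) (auto simp: C_def)
    also have "\<dots> = C * (4 * pi * (ln A / R + B) + 2 * pi * \<bar>c0\<bar> / R + 2 * (zero_count m R / R)) / R"
      using R by (simp add: s_def field_simps power2_eq_square)
    finally show ?thesis unfolding \<Phi>_def cm by linarith
  qed
  show ?thesis
    unfolding V_def[symmetric] \<Psi>_def[symmetric]
  proof (rule tendstoI)
    fix e :: real assume "e > 0"
    then have "\<forall>\<^sub>F R in at_top. \<Phi> R < e" using \<Phi>0 by (simp add: order_tendstoD)
    then obtain R1 where R1: "\<And>R. R \<ge> R1 \<Longrightarrow> \<Phi> R < e" unfolding eventually_at_top_linorder by blast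
    define R2 where "R2 = max R1 (max 1 (max (2 * \<bar>x\<bar>) (2 * \<bar>b\<bar>)))"
    show "\<forall>\<^sub>F R in at_top. dist (\<Psi> R) V < e"
      using eventually_ge_at_top[of "R2 + 1"]
    proof eventually_elim
      case (elim R)
      \<comment> \<open>A radius r < R beyond the moduli of all zeros in the open disc gives the
        same finite sum and has no zero on its circle. Including R - 1 keeps r above
        \<open>R2\<close> and \<open>X\<close> nonempty.\<close>
      define X where "X = insert (R - 1) (cmod ` zeros_in m R)"
      have X: "finite X" "X \<noteq> {}" using fin by (auto simp: X_def)
      have "Max X < R" using X by (subst Max_less_iff) (auto simp: X_def zeros_in_def)
      define r where "r = (Max X + R) / 2"
      have r: "Max X < r" "r < R" using \<open>Max X < R\<close> by (auto simp: r_def)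
      have "R - 1 \<le> Max X" using X by (intro Max_ge) (auto simp: X_def)
      then have rR: "R2 \<le> r" using r elim by linarith
      have zr: "cmod a < r" if "a \<in> zeros_in m R" for a
      proof -
        have "cmod a \<le> Max X" using X that by (intro Max_ge) (auto simp: X_def)
        then show ?thesis using r by linarith
      qed
      have eq: "zeros_in m r = zeros_in m R"
        using zr r by (auto simp: zeros_in_def)
      have nzr: "f z \<noteq> 0" if "cmod z = r" for z
      proof
        assume "f z = 0"
        then have "z \<in> zeros_in m R" using that r is_zero_set_iff(1)[OF f zs] by (auto simp: zeros_in_def)
        then show False using zr that by fastforce
      qed
      have "\<bar>V - \<Psi> r\<bar> \<le> \<Phi> r" by (rule main[OF _ _ _ nzr]) (use rR in \<open>auto simp: R2_def\<close>)
      also have "\<dots> < e" by (rule R1) (use rR in \<open>auto simp: R2_def\<close>)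
      finally show ?case by (simp add: \<Psi>_def eq dist_real_def abs_minus_commute)
    qed
  qed
qed

section \<open>The truncated integral\<close>

lemma finite_zeros_in_disc:
  assumes "no_finite_limit_points m"
  shows "finite {z. m z \<noteq> 0 \<and> cmod (z - c) \<le> t}"
proof -
  have "finite (cball c t \<inter> {w. m w \<noteq> 0})"
    by (rule finite_not_islimpt_in_compact) (use assms in \<open>auto simp: no_finite_limit_points_def\<close>)
  moreover have "{z. m z \<noteq> 0 \<and> cmod (z - c) \<le> t} = cball c t \<inter> {w. m w \<noteq> 0}"
    by (auto simp: dist_norm norm_minus_commute)
  ultimately show ?thesis by simp
qed

lemma finite_zeros_in:
  assumes "no_finite_limit_points m"
  shows "finite (zeros_in m R)"
  by (rule finite_subset[OF _ finite_zeros_in_disc[OF assms, of 0 R]]) (auto simp: zeros_in_def)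

text \<open>A zero at distance s from c contributes the integral of 1 / t over [s, T]. Since c
  itself is not a zero, the integrand vanishes near t = 0.\<close>

lemma ncount_integral:
  assumes nl: "no_finite_limit_points m" and c: "m c = 0"
  shows "set_integrable lborel {0<..T} (\<lambda>t. real (ncount m c t) / t)"
    "(LINT t:{0<..T}|lborel. real (ncount m c t) / t) = (\<Sum>a\<in>{a. m a \<noteq> 0 \<and> cmod (a - c) \<le> T}. m a * (ln T - ln (cmod (a - c))))"
proof -
  define B where "B = {a. m a \<noteq> 0 \<and> cmod (a - c) \<le> T}"
  have finB: "finite B" unfolding B_def by (rule finite_zeros_in_disc[OF nl])
  have Bp: "0 < cmod (a - c)" "cmod (a - c) \<le> T" if "a \<in> B" for a using that c by (auto simp: B_def)
  have pt: "indicator {0<..T} t *\<^sub>R (real (ncount m c t) / t) = (\<Sum>a\<in>B. real (m a) * (indicator {cmod (a - c)..T} t *\<^sub>R (1 / t)))" for t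
  proof (cases "t \<in> {0<..T}")
    case True
    have sub: "{z. m z \<noteq> 0 \<and> cmod (z - c) \<le> t} = {a \<in> B. cmod (a - c) \<le> t}" using True by (auto simp: B_def)
    have "ncount m c t = (\<Sum>a\<in>B. if cmod (a - c) \<le> t then m a else 0)"
      unfolding ncount_def sub by (rule sum.inter_filter[OF finB])
    then have "real (ncount m c t) / t = (\<Sum>a\<in>B. real (if cmod (a - c) \<le> t then m a else 0) / t)"
      by (simp add: sum_divide_distrib)
    also have "\<dots> = (\<Sum>a\<in>B. real (m a) * (indicator {cmod (a - c)..T} t *\<^sub>R (1 / t)))"
      using True by (intro sum.cong) (auto simp: indicator_def)
    finally show ?thesis using True by simp
  next
    case False
    have "indicator {cmod (a - c)..T} t = (0::real)" if "a \<in> B" for a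
    proof -
      have "t \<notin> {cmod (a - c)..T}"
      proof
        assume t: "t \<in> {cmod (a - c)..T}"
        then have "0 < t" using less_le_trans[OF Bp(1)[OF that], of t] by simp
        then show False using t False by simp
      qed
      then show ?thesis by simp
    qed
    then show ?thesis using False by simp
  qed
  have int1: "integrable lborel (\<lambda>t. indicator {cmod (a - c)..T} t *\<^sub>R (1 / t))" if "a \<in> B" for a
  proof -
    have "continuous_on {cmod (a - c)..T} (\<lambda>t. 1 / t)" using Bp[OF that] by (auto intro!: continuous_intros)
    from borel_integrable_atLeastAtMost'[OF this] show ?thesis unfolding set_integrable_def .
  qed
  have val1: "(LINT t|lborel. indicator {cmod (a - c)..T} t *\<^sub>R (1 / t)) = ln T - ln (cmod (a - c))" if "a \<in> B" for a
  proof (rule integral_FTC_atLeastAtMost)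
    show "cmod (a - c) \<le> T" by (rule Bp[OF that])
    show "(ln has_vector_derivative 1 / t) (at t within {cmod (a - c)..T})" if t: "cmod (a - c) \<le> t" for t
    proof -
      have "t > 0" using Bp(1)[OF \<open>a \<in> B\<close>] t by linarith
      then have "(ln has_real_derivative 1 / t) (at t within {cmod (a - c)..T})" by (auto intro!: derivative_eq_intros)
      then show ?thesis by (simp add: has_real_derivative_iff_has_vector_derivative)
    qed
    show "continuous_on {cmod (a - c)..T} (\<lambda>t. 1 / t)" using Bp[OF that] by (auto intro!: continuous_intros)
  qed
  show "set_integrable lborel {0<..T} (\<lambda>t. real (ncount m c t) / t)"
    unfolding set_integrable_def pt by (intro Bochner_Integration.integrable_sum integrable_mult_right int1)
  have "(LINT t:{0<..T}|lborel. real (ncount m c t) / t) = (\<Sum>a\<in>B. LINT t|lborel. real (m a) * (indicator {cmod (a - c)..T} t *\<^sub>R (1 / t)))"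
    unfolding set_lebesgue_integral_def pt by (intro Bochner_Integration.integral_sum integrable_mult_right int1)
  also have "\<dots> = (\<Sum>a\<in>B. m a * (ln T - ln (cmod (a - c))))"
    using val1 by (intro sum.cong refl) (simp only: integral_mult_right_zero)
  finally show "(LINT t:{0<..T}|lborel. real (ncount m c t) / t) = (\<Sum>a\<in>{a. m a \<noteq> 0 \<and> cmod (a - c) \<le> T}. m a * (ln T - ln (cmod (a - c))))"
    by (simp add: B_def)
qed

lemma inner_trunc_eq:
  assumes nl: "no_finite_limit_points m" and "m (of_real b) = 0" "m (of_real x) = 0"
  shows "inner_trunc m b x T = (\<Sum>a\<in>{a. m a \<noteq> 0 \<and> cmod (a - of_real b) \<le> T}. m a * (ln T - ln (cmod (a - of_real b))))
     - (\<Sum>a\<in>{a. m a \<noteq> 0 \<and> cmod (a - of_real x) \<le> T}. m a * (ln T - ln (cmod (a - of_real x))))"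
  unfolding inner_trunc_def diff_divide_distrib
  by (subst set_integral_diff) (simp_all add: ncount_integral[OF nl] assms)

lemma ncount_mono:
  assumes "no_finite_limit_points m" "s \<le> t"
  shows "ncount m c s \<le> ncount m c t"
  unfolding ncount_def by (rule sum_mono2[OF finite_zeros_in_disc[OF assms(1)]]) (use assms(2) in auto)

text \<open>Hypothesis (iii) concerns annuli of width 1. An annulus of width 2 |K| is covered by a
  fixed number of them, each shifted by a constant, and such shifts do not affect o(T).\<close>

lemma annulus_count_small:
  assumes nl: "no_finite_limit_points m"
    and iii: "(\<lambda>t. real (ncount m 0 (t + 1)) - real (ncount m 0 t)) \<in> o(\<lambda>t. t)"
  shows "((\<lambda>T. (real (ncount m 0 (T + K)) - real (ncount m 0 (T - K))) / T) \<longlongrightarrow> 0) at_top"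
proof -
  define n where "n t = real (ncount m 0 t)" for t
  have "((\<lambda>t. (n (t + 1) - n t) / t) \<longlongrightarrow> 0) at_top" unfolding n_def by (rule smalloD_tendsto[OF iii])
  then have sh: "((\<lambda>T. (n (T + c + 1) - n (T + c)) / T) \<longlongrightarrow> 0) at_top" for c
  proof -
    have f: "filterlim (\<lambda>T::real. T + c) at_top at_top"
      using filterlim_tendsto_add_at_top[OF tendsto_const filterlim_ident, of c] by (simp add: add.commute)
    have "((\<lambda>T. (n (T + c + 1) - n (T + c)) / (T + c) * (1 + c / T)) \<longlongrightarrow> 0 * (1 + 0)) at_top"
      by (intro tendsto_mult tendsto_add tendsto_const filterlim_compose[OF \<open>((\<lambda>t. (n (t + 1) - n t) / t) \<longlongrightarrow> 0) at_top\<close> f]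
          tendsto_divide_0[OF tendsto_const] filterlim_at_top_imp_at_infinity filterlim_ident)
    moreover have "\<forall>\<^sub>F T in at_top. (n (T + c + 1) - n (T + c)) / (T + c) * (1 + c / T) = (n (T + c + 1) - n (T + c)) / T"
      using eventually_gt_at_top[of "\<bar>c\<bar>"]
    proof eventually_elim
      case (elim T)
      have p: "T > 0" "T + c > 0" using elim by linarith+
      then have "1 + c / T = (T + c) / T" by (simp add: field_simps)
      then show ?case using p by simp
    qed
    ultimately show ?thesis by (simp add: tendsto_cong)
  qed
  define j where "j = nat \<lceil>2 * \<bar>K\<bar>\<rceil>"
  have tele: "(\<Sum>i<j. n (T + (real i - \<bar>K\<bar>) + 1) - n (T + (real i - \<bar>K\<bar>))) = n (T + (real j - \<bar>K\<bar>)) - n (T - \<bar>K\<bar>)" for T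
    by (induction j) (auto simp: algebra_simps)
  have up: "((\<lambda>T. \<Sum>i<j. (n (T + (real i - \<bar>K\<bar>) + 1) - n (T + (real i - \<bar>K\<bar>))) / T) \<longlongrightarrow> (\<Sum>i<j. 0)) at_top"
    by (intro tendsto_sum sh)
  have up': "((\<lambda>T. (n (T + (real j - \<bar>K\<bar>)) - n (T - \<bar>K\<bar>)) / T) \<longlongrightarrow> 0) at_top"
    using up unfolding sum_divide_distrib[symmetric] tele by simp
  have b: "\<bar>(n (T + K) - n (T - K)) / T\<bar> \<le> (n (T + (real j - \<bar>K\<bar>)) - n (T - \<bar>K\<bar>)) / T" if "T > 0" for T
  proof -
    have mono: "n s \<le> n t" if "s \<le> t" for s t using ncount_mono[OF nl that] by (simp add: n_def)
    have jj: "2 * \<bar>K\<bar> \<le> real j" unfolding j_def by linarith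
    have "n (T + K) \<le> n (T + (real j - \<bar>K\<bar>))" "n (T - K) \<le> n (T + (real j - \<bar>K\<bar>))"
      "n (T - \<bar>K\<bar>) \<le> n (T + K)" "n (T - \<bar>K\<bar>) \<le> n (T - K)" by (rule mono, use jj in linarith)+
    then have "\<bar>n (T + K) - n (T - K)\<bar> \<le> n (T + (real j - \<bar>K\<bar>)) - n (T - \<bar>K\<bar>)" by linarith
    then show ?thesis using that by (simp add: abs_divide divide_right_mono)
  qed
  show ?thesis unfolding n_def[symmetric]
  proof (rule Lim_null_comparison[OF _ up'])
    show "\<forall>\<^sub>F T in at_top. norm ((n (T + K) - n (T - K)) / T) \<le> (n (T + (real j - \<bar>K\<bar>)) - n (T - \<bar>K\<bar>)) / T"
      using eventually_gt_at_top[of 0] by (rule eventually_mono) (simp only: real_norm_def b)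
  qed
qed

text \<open>The discs |a - c| \<le> T and |a| < T differ only inside T - K \<le> |a| \<le> T + K.
  There ln (T / |a - c|) is O(K / T), and by (iii) the number of such zeros is o(T).\<close>

lemma shifted_log_sum:
  assumes nl: "no_finite_limit_points m" and c: "m c = 0"
    and iii: "(\<lambda>t. real (ncount m 0 (t + 1)) - real (ncount m 0 t)) \<in> o(\<lambda>t. t)"
  shows "((\<lambda>T. (\<Sum>a\<in>{a. m a \<noteq> 0 \<and> cmod (a - c) \<le> T}. m a * (ln T - ln (cmod (a - c))))
      - (\<Sum>a\<in>zeros_in m T. m a * (ln T - ln (cmod (a - c))))) \<longlongrightarrow> 0) at_top"
proof -
  define K where "K = cmod c + 1"
  have K: "K > 0" "cmod c < K" by (simp_all add: K_def add_nonneg_pos)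
  define n where "n t = real (ncount m 0 t)" for t
  have lim: "((\<lambda>T. (n (T + K) - n (T - K)) / T * (4 * K)) \<longlongrightarrow> 0) at_top"
    unfolding n_def by (intro tendsto_mult_left_zero annulus_count_small nl iii)
  show ?thesis
  proof (rule Lim_null_comparison[OF _ lim])
    show "\<forall>\<^sub>F T in at_top. norm ((\<Sum>a\<in>{a. m a \<noteq> 0 \<and> cmod (a - c) \<le> T}. m a * (ln T - ln (cmod (a - c))))
      - (\<Sum>a\<in>zeros_in m T. m a * (ln T - ln (cmod (a - c))))) \<le> (n (T + K) - n (T - K)) / T * (4 * K)"
      \<comment> \<open>For T \<ge> 4 K the zeros of the annulus satisfy |a - c| \<ge> T - 2 K \<ge>
        T / 2.\<close>
      using eventually_ge_at_top[of "4 * K"]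
    proof eventually_elim
      case (elim T)
      have T: "T > 0" using elim K by linarith
      define g where "g a = real (m a) * (ln T - ln (cmod (a - c)))" for a
      define U where "U = {a. m a \<noteq> 0 \<and> cmod (a - c) \<le> T}"
      define V where "V = zeros_in m T"
      define X where "X = {z. m z \<noteq> 0 \<and> cmod (z - 0) \<le> T + K} - {z. m z \<noteq> 0 \<and> cmod (z - 0) \<le> T - K}"
      have fins: "finite U" "finite V" "finite X"
        unfolding U_def V_def X_def
        by (rule finite_zeros_in_disc[OF nl] finite_zeros_in[OF nl] finite_Diff)+
      have tri: "cmod (a - c) \<le> cmod a + cmod c" "cmod a \<le> cmod (a - c) + cmod c" for a
        using norm_triangle_ineq4[of a c] norm_triangle_sub[of a c] by auto
      have UX: "U - V \<subseteq> X" "V - U \<subseteq> X"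
      proof -
        show "U - V \<subseteq> X"
        proof
          fix a assume "a \<in> U - V"
          then have "m a \<noteq> 0" "cmod (a - c) \<le> T" "T \<le> cmod a" by (auto simp: U_def V_def zeros_in_def)
          then show "a \<in> X" using tri[of a] K by (auto simp: X_def)
        qed
        show "V - U \<subseteq> X"
        proof
          fix a assume "a \<in> V - U"
          then have "m a \<noteq> 0" "cmod (a - c) > T" "cmod a < T" by (auto simp: U_def V_def zeros_in_def)
          then show "a \<in> X" using tri[of a] K by (auto simp: X_def)
        qed
      qed
      have gX: "\<bar>g a\<bar> \<le> real (m a) * (2 * K / (T / 2))" if a: "a \<in> X" for a
      proof -
        have ca: "T - K \<le> cmod a" "cmod a \<le> T + K" using a by (auto simp: X_def)
        define s where "s = cmod (a - c)"
        have s: "\<bar>T - s\<bar> \<le> 2 * K" using tri[of a] ca K unfolding s_def by linarith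
        then have s2: "s \<ge> T / 2" using elim by linarith
        have "\<bar>ln T - ln s\<bar> \<le> 2 * K / (T / 2)"
        proof -
          have sp: "s > 0" using s2 T by linarith
          have "ln T - ln s \<le> (T - s) / s" using ln_diff_le[of T s] T sp by simp
          also have "\<dots> \<le> 2 * K / (T / 2)" using s s2 T K by (intro frac_le) auto
          finally have 1: "ln T - ln s \<le> 2 * K / (T / 2)" .
          have "ln s - ln T \<le> (s - T) / T" using ln_diff_le[of s T] T sp by simp
          also have "\<dots> \<le> 2 * K / (T / 2)" using s T K by (intro frac_le) auto
          finally show ?thesis using 1 by linarith
        qed
        then show ?thesis unfolding g_def s_def[symmetric] abs_mult abs_of_nat by (rule mult_left_mono) simp
      qed
      have "sum g U - sum g V = sum g (U - V) - sum g (V - U)"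
      proof -
        have "sum g U = sum g (U - V) + sum g (U \<inter> V)" using sum.Int_Diff[OF fins(1), of g V] by simp
        moreover have "sum g V = sum g (V - U) + sum g (U \<inter> V)" using sum.Int_Diff[OF fins(2), of g U] by (simp add: Int_commute)
        ultimately show ?thesis by simp
      qed
      also have "\<bar>\<dots>\<bar> \<le> (\<Sum>a\<in>U - V. \<bar>g a\<bar>) + (\<Sum>a\<in>V - U. \<bar>g a\<bar>)"
        using sum_abs[of g "U - V"] sum_abs[of g "V - U"] by linarith
      also have "\<dots> = (\<Sum>a\<in>(U - V) \<union> (V - U). \<bar>g a\<bar>)"
        using fins by (intro sum.union_disjoint[symmetric]) auto
      also have "\<dots> \<le> (\<Sum>a\<in>X. \<bar>g a\<bar>)" using UX fins by (intro sum_mono2) auto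
      also have "\<dots> \<le> (\<Sum>a\<in>X. real (m a) * (2 * K / (T / 2)))" by (rule sum_mono[OF gX])
      also have "\<dots> = (\<Sum>a\<in>X. real (m a)) * (2 * K / (T / 2))" by (simp only: sum_distrib_right)
      also have "(\<Sum>a\<in>X. real (m a)) = n (T + K) - n (T - K)"
        unfolding n_def ncount_def X_def of_nat_sum
        using finite_zeros_in_disc[OF nl, of 0] K by (subst sum_diff) auto
      also have "(n (T + K) - n (T - K)) * (2 * K / (T / 2)) = (n (T + K) - n (T - K)) / T * (4 * K)" by simp
      finally show ?case unfolding g_def U_def V_def by simp
    qed
  qed
qed

text \<open>Once both discs are recentred at 0 the two sums run over the same zeros and the terms ln
  T cancel.\<close>

lemma inner_trunc_tendsto:
  assumes nl: "no_finite_limit_points m" and b: "m (of_real b) = 0" and x: "m (of_real x) = 0"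
    and iii: "(\<lambda>t. real (ncount m 0 (t + 1)) - real (ncount m 0 t)) \<in> o(\<lambda>t. t)"
    and lim: "((\<lambda>R. \<Sum>a\<in>zeros_in m R. m a * (ln (cmod (of_real x - a)) - ln (cmod (of_real b - a)))) \<longlongrightarrow> V) at_top"
  shows "((\<lambda>T. inner_trunc m b x T) \<longlongrightarrow> V) at_top"
proof -
  define S where "S c T = (\<Sum>a\<in>zeros_in m T. m a * (ln T - ln (cmod (a - c))))" for c T
  define U where "U c T = (\<Sum>a\<in>{a. m a \<noteq> 0 \<and> cmod (a - c) \<le> T}. m a * (ln T - ln (cmod (a - c))))" for c T
  have "((\<lambda>T. (U (of_real b) T - S (of_real b) T) - (U (of_real x) T - S (of_real x) T)
     + (\<Sum>a\<in>zeros_in m T. m a * (ln (cmod (of_real x - a)) - ln (cmod (of_real b - a))))) \<longlongrightarrow> 0 - 0 + V) at_top"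
    unfolding U_def S_def by (intro tendsto_intros shifted_log_sum nl b x iii lim)
  moreover have "(\<Sum>a\<in>zeros_in m T. m a * (ln (cmod (of_real x - a)) - ln (cmod (of_real b - a)))) = S (of_real b) T - S (of_real x) T" for T
    unfolding S_def sum_subtractf[symmetric] by (intro sum.cong) (auto simp: algebra_simps norm_minus_commute)
  ultimately have "((\<lambda>T. U (of_real b) T - U (of_real x) T) \<longlongrightarrow> V) at_top" by simp
  then show ?thesis using inner_trunc_eq[OF nl b x] by (simp add: U_def)
qed

section \<open>The canonical product\<close>

text \<open>The local factorisation determines \<open>zorder\<close>, which must equal the order of
  the first nonvanishing derivative. Such a derivative exists because g is not identically zero: the
  factor q has no zero near a.\<close>

lemma is_zero_setI:
  assumes g: "g holomorphic_on UNIV"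
    and loc: "\<And>a. \<exists>S q. open S \<and> a \<in> S \<and> q holomorphic_on S \<and> q a \<noteq> 0 \<and> (\<forall>w\<in>S. g w = q w * (w - a) ^ m a)"
  shows "is_zero_set m g"
  unfolding is_zero_set_def
proof
  fix a
  obtain S q where S: "open S" "a \<in> S" "q holomorphic_on S" "q a \<noteq> 0" "\<And>w. w \<in> S \<Longrightarrow> g w = q w * (w - a) ^ m a"
    using loc[of a] by blast
  have z1: "zorder g a = int (m a)"
    by (rule zorder_eqI[OF S(1-4)]) (simp add: S(5) power_int_def)
  have "\<exists>n. (deriv ^^ n) g a \<noteq> 0"
  proof (rule ccontr)
    assume "\<not> ?thesis"
    then have g0: "g w = 0" for w
      using holomorphic_fun_eq_0_on_connected[OF g open_UNIV connected_UNIV, of a] by auto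
    have "continuous_on S q" by (rule holomorphic_on_imp_continuous_on[OF S(3)])
    then have "open (S \<inter> q -` (- {0}))" using S(1) by (intro continuous_open_preimage) auto
    moreover have "a \<in> S \<inter> q -` (- {0})" using S by auto
    ultimately have "a islimpt (S \<inter> q -` (- {0}))" by (rule interior_limit_point[OF interiorI]) simp
    then obtain w where w: "w \<in> S \<inter> q -` (- {0})" "w \<noteq> a" by (auto elim: islimptE[of _ _ UNIV])
    then show False using S(5)[of w] g0[of w] by simp
  qed
  then have l: "(deriv ^^ (LEAST n. (deriv ^^ n) g a \<noteq> 0)) g a \<noteq> 0" by (rule LeastI_ex)
  define n where "n = (LEAST n. (deriv ^^ n) g a \<noteq> 0)"
  have n: "(deriv ^^ n) g a \<noteq> 0" "\<And>j. j < n \<Longrightarrow> (deriv ^^ j) g a = 0"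
    using l not_less_Least[of _ "\<lambda>n. (deriv ^^ n) g a \<noteq> 0"] unfolding n_def by blast+
  have "zorder g a = int n" by (rule zorder_zero_eqI[OF g]) (use n in auto)
  then have "n = m a" using z1 by simp
  then show "(\<forall>j<m a. (deriv ^^ j) g a = 0) \<and> (deriv ^^ m a) g a \<noteq> 0" using n by blast
qed

context
  fixes m :: "complex \<Rightarrow> nat" and C :: real and L :: complex
  assumes fin: "\<And>R. finite (zeros_in m R)" and m0: "m 0 = 0"
    and C: "\<And>R. R > 0 \<Longrightarrow> zero_count m R \<le> C * R"
    and lim: "((\<lambda>R. \<Sum>a\<in>zeros_in m R. of_nat (m a) / a) \<longlongrightarrow> L) at_top"
begin

private lemma C_nonneg: "C \<ge> 0"
  using C[of 1] zero_count_nonneg[OF fin m0, of 1] by simp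

text \<open>Halving the radius costs at most C times the current radius, as ln 2 < 1. The costs form
  a geometric series with sum at most 2 C R, and the process ends when the disc contains no
  zero.\<close>

private lemma zero_mean_le: 
  assumes R: "R > 0"
  shows "zero_mean m R \<le> 2 * C * R"
proof -
  have step: "zero_mean m R \<le> C * R + zero_mean m (R / 2)" if R: "R > 0" for R
  proof -
    have "zero_mean m R - zero_mean m (R / 2) \<le> zero_count m R * (ln R - ln (R / 2))"
      by (rule zero_mean_diff(2)[OF fin m0]) (use R in auto)
    also have "ln R - ln (R / 2) = ln 2" using R by (simp add: ln_div)
    also have "zero_count m R * ln 2 \<le> (C * R) * 1"
      using C[OF R] zero_count_nonneg[OF fin m0, of R] ln_2_less_1 by (intro mult_mono) auto
    finally show ?thesis by simp
  qed
  have it: "zero_mean m R \<le> 2 * C * R * (1 - (1/2) ^ j) + zero_mean m (R / 2 ^ j)" for j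
  proof (induction j)
    case (Suc j)
    have "zero_mean m (R / 2 ^ j) \<le> C * (R / 2 ^ j) + zero_mean m (R / 2 ^ j / 2)" by (rule step) (use R in simp)
    also have "C * (R / 2 ^ j) = 2 * C * R * (1/2) ^ Suc j" by (simp add: power_one_over field_simps)
    finally show ?case using Suc by (simp add: algebra_simps)
  qed simp
  define X where "X = insert R (cmod ` zeros_in m R)"
  have X: "finite X" "X \<noteq> {}" using fin by (auto simp: X_def)
  have "Min X > 0" using X zeros_in_pos[OF fin m0] R by (subst Min_gr_iff) (auto simp: X_def)
  obtain j where j: "(1/2) ^ j < Min X / R" using real_arch_pow_inv[of "Min X / R" "1/2"] \<open>Min X > 0\<close> R by auto
  have "zeros_in m (R / 2 ^ j) = {}"
  proof (rule ccontr)
    assume "zeros_in m (R / 2 ^ j) \<noteq> {}"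
    then obtain a where a: "a \<in> zeros_in m (R / 2 ^ j)" by blast
    have le: "R / 2 ^ j \<le> R / 1" using R by (intro divide_left_mono) auto
    have "a \<in> zeros_in m R" using zeros_in_mono[OF fin m0 le] a by auto
    then have "Min X \<le> cmod a" using X by (intro Min_le) (auto simp: X_def)
    moreover have "cmod a < R / 2 ^ j" using a by (simp add: zeros_in_def)
    moreover have "R / 2 ^ j < Min X" using j R by (simp add: power_one_over field_simps)
    ultimately show False by linarith
  qed
  then have "zero_mean m (R / 2 ^ j) = 0" by (simp add: zero_mean_def)
  then have "zero_mean m R \<le> 2 * C * R * (1 - (1/2) ^ j)" using it[of j] by simp
  also have "\<dots> \<le> 2 * C * R * 1" using C_nonneg R by (intro mult_left_mono) auto
  finally show ?thesis by simp
qed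

text \<open>A dyadic annulus s \<le> |a| < 2 s holds at most 2 C s zeros and contributes at most 2 C
  / s; these bounds form a geometric series.\<close>

private lemma inverse_square_tail:
  assumes R: "R > 0"
  shows "(\<Sum>a\<in>zeros_in m R' - zeros_in m R. real (m a) / (cmod a)\<^sup>2) \<le> 4 * C / R"
proof -
  define T where "T s t = (\<Sum>a\<in>zeros_in m t - zeros_in m s. real (m a) / (cmod a)\<^sup>2)" for s t
  have step: "T s (2 * s) \<le> 2 * C / s" if s: "s > 0" for s
  proof -
    have "T s (2 * s) \<le> (\<Sum>a\<in>zeros_in m (2 * s) - zeros_in m s. real (m a) / s\<^sup>2)"
      unfolding T_def
    proof (rule sum_mono)
      fix a assume "a \<in> zeros_in m (2 * s) - zeros_in m s"
      then have "s \<le> cmod a" by (auto simp: zeros_in_def)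
      then have "s\<^sup>2 \<le> (cmod a)\<^sup>2" "0 < cmod a" using s by (auto intro: power_mono)
      then show "real (m a) / (cmod a)\<^sup>2 \<le> real (m a) / s\<^sup>2" using s by (intro divide_left_mono mult_pos_pos) auto
    qed
    also have "\<dots> \<le> (\<Sum>a\<in>zeros_in m (2 * s). real (m a) / s\<^sup>2)" by (intro sum_mono2 fin) auto
    also have "\<dots> = zero_count m (2 * s) / s\<^sup>2" by (simp only: zero_count_def sum_divide_distrib)
    also have "\<dots> \<le> C * (2 * s) / s\<^sup>2" using C[of "2 * s"] s by (intro divide_right_mono) auto
    also have "\<dots> = 2 * C / s" using s by (simp add: power2_eq_square)
    finally show ?thesis .
  qed
  have it: "T R (2 ^ j * R) \<le> 4 * C / R * (1 - (1/2) ^ j)" for j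
  proof (induction j)
    case (Suc j)
    have le: "2 ^ j * R \<le> 2 ^ Suc j * R" "R \<le> 2 ^ j * R" using R by auto
    have "zeros_in m (2 ^ Suc j * R) - zeros_in m R = (zeros_in m (2 ^ Suc j * R) - zeros_in m (2 ^ j * R)) \<union> (zeros_in m (2 ^ j * R) - zeros_in m R)"
      using zeros_in_mono[OF fin m0 le(1)] zeros_in_mono[OF fin m0 le(2)] by blast
    then have "T R (2 ^ Suc j * R) = T (2 ^ j * R) (2 ^ Suc j * R) + T R (2 ^ j * R)"
      unfolding T_def using fin by (simp only:) (rule sum.union_disjoint, auto)
    also have "T (2 ^ j * R) (2 ^ Suc j * R) \<le> 2 * C / (2 ^ j * R)" using step[of "2 ^ j * R"] R by (simp add: mult.assoc)
    also have "2 * C / (2 ^ j * R) = 4 * C / R * (1/2) ^ Suc j" using R by (simp add: power_one_over field_simps)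
    finally have le: "T R (2 ^ Suc j * R) \<le> 4 * C / R * (1/2) ^ Suc j + T R (2 ^ j * R)" by simp
    have "X * (1/2) ^ Suc j + X * (1 - (1/2) ^ j) = X * (1 - (1/2) ^ Suc j)" for X :: real by (simp add: algebra_simps)
    from this[of "4 * C / R"] le Suc show ?case by linarith
  qed (simp add: T_def)
  obtain j where j: "R' / R < 2 ^ j" using real_arch_pow[of 2 "R' / R"] by auto
  then have "R' \<le> 2 ^ j * R" using R by (simp add: field_simps)
  then have "T R R' \<le> T R (2 ^ j * R)" unfolding T_def
    using zeros_in_mono[OF fin m0, of R' "2 ^ j * R"] fin by (intro sum_mono2) auto
  also have "\<dots> \<le> 4 * C / R * (1 - (1/2) ^ j)" by (rule it)
  also have "\<dots> \<le> 4 * C / R * 1" using C_nonneg R by (intro mult_left_mono) auto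
  finally show ?thesis by (simp add: T_def)
qed

private definition "partial_prod R z = (\<Prod>a\<in>zeros_in m R. (1 - z / a) ^ m a)" for R and z :: complex
text \<open>The logarithm of the factors with |a| \<ge> 2 K. For |z| \<le> K they have |z / a| \<le>
  1/2, so the principal branch is holomorphic there; the other factors stay outside as a polynomial
  and carry the zeros.\<close>

private definition "log_tail K R z = (\<Sum>a\<in>zeros_in m R - zeros_in m (2 * K). of_nat (m a) * Ln (1 - z / a))" for K R :: real and z :: complex
private definition "partial_sum R = (\<Sum>a\<in>zeros_in m R. of_nat (m a) / a)" for R

private lemma far_zero:
  assumes "a \<in> zeros_in m R' - zeros_in m R" "2 * K \<le> R" "K > 0" "cmod z \<le> K"
  shows "cmod (z / a) \<le> 1/2" "1 - z / a \<notin> \<real>\<^sub>\<le>\<^sub>0" "1 - z / a \<noteq> 0" "a \<noteq> 0"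
proof -
  have a: "2 * K \<le> cmod a" "a \<noteq> 0" using assms m0 by (auto simp: zeros_in_def)
  then have "cmod z \<le> 1/2 * cmod a" using assms by linarith
  then show c: "cmod (z / a) \<le> 1/2" using a by (simp add: norm_divide field_simps)
  have "Re (1 - z / a) > 0" using c abs_Re_le_cmod[of "z / a"] by simp
  then show "1 - z / a \<notin> \<real>\<^sub>\<le>\<^sub>0" "1 - z / a \<noteq> 0" by (auto simp: complex_nonpos_Reals_iff)
  show "a \<noteq> 0" by (rule a)
qed

private lemma partial_prod_eq:
  assumes "K > 0" "2 * K \<le> R" "cmod z \<le> K"
  shows "partial_prod R z = partial_prod (2 * K) z * exp (log_tail K R z)"
proof -
  have "exp (log_tail K R z) = (\<Prod>a\<in>zeros_in m R - zeros_in m (2 * K). (1 - z / a) ^ m a)"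
    unfolding log_tail_def using fin far_zero(3)[OF _ order_refl assms(1,3)]
    by (subst exp_sum) (auto intro!: prod.cong simp: exp_of_nat_mult)
  then show ?thesis unfolding partial_prod_def
    using prod.subset_diff[OF zeros_in_mono[OF fin m0 assms(2)] fin, of "\<lambda>a. (1 - z / a) ^ m a"] by (simp add: mult.commute)
qed

text \<open>Ln (1 - z / a) is - z / a up to a quadratic error. The errors are summed absolutely with
  \<open>inverse_square_tail\<close>, while the linear parts, which need not be absolutely summable,
  are handled through the convergence of \<open>partial_sum\<close>, that is, (i).\<close>

private lemma log_tail_Cauchy:
  assumes K: "K > 0" "2 * K \<le> R" "R \<le> R'" and z: "cmod z \<le> K"
  shows "cmod (log_tail K R' z - log_tail K R z) \<le> 8 * K\<^sup>2 * C / R + K * (cmod (partial_sum R' - L) + cmod (partial_sum R - L))"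
proof -
  define D where "D = zeros_in m R' - zeros_in m R"
  have finD: "finite D" using fin by (simp add: D_def)
  have R: "R > 0" using K by linarith
  have "log_tail K R' z - log_tail K R z = (\<Sum>a\<in>D. of_nat (m a) * Ln (1 - z / a))"
  proof -
    have "zeros_in m R' - zeros_in m (2 * K) = D \<union> (zeros_in m R - zeros_in m (2 * K))"
      using zeros_in_mono[OF fin m0 K(2)] zeros_in_mono[OF fin m0 K(3)] by (auto simp: D_def)
    then have "log_tail K R' z = (\<Sum>a\<in>D. of_nat (m a) * Ln (1 - z / a)) + log_tail K R z"
      unfolding log_tail_def using fin finD by (simp only:) (rule sum.union_disjoint, auto simp: D_def)
    then show ?thesis by simp
  qed
  also have "\<dots> = (\<Sum>a\<in>D. of_nat (m a) * (Ln (1 - z / a) + z / a)) - z * (partial_sum R' - partial_sum R)"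
  proof -
    have "partial_sum R' - partial_sum R = (\<Sum>a\<in>D. of_nat (m a) / a)"
      unfolding partial_sum_def D_def using sum.subset_diff[OF zeros_in_mono[OF fin m0 K(3)] fin, of "\<lambda>a. of_nat (m a) / a"] by simp
    then have "z * (partial_sum R' - partial_sum R) = (\<Sum>a\<in>D. of_nat (m a) * (z / a))" by (simp add: sum_distrib_left mult_ac)
    then show ?thesis by (simp add: distrib_left sum.distrib)
  qed
  also have "cmod \<dots> \<le> cmod (\<Sum>a\<in>D. of_nat (m a) * (Ln (1 - z / a) + z / a)) + cmod (z * (partial_sum R' - partial_sum R))" by (rule norm_triangle_ineq4)
  also have "\<dots> \<le> 8 * K\<^sup>2 * C / R + K * (cmod (partial_sum R' - L) + cmod (partial_sum R - L))"
  proof (rule add_mono)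
    have "cmod (\<Sum>a\<in>D. of_nat (m a) * (Ln (1 - z / a) + z / a)) \<le> (\<Sum>a\<in>D. 2 * K\<^sup>2 * (real (m a) / (cmod a)\<^sup>2))"
    proof (rule order_trans[OF norm_sum sum_mono])
      fix a assume a: "a \<in> D"
      note fz = far_zero[OF a[unfolded D_def] K(2,1) z]
      have "cmod (Ln (1 - z / a) + z / a) \<le> 2 * (cmod (z / a))\<^sup>2" by (rule Ln_one_minus_bound[OF fz(1)])
      also have "\<dots> \<le> 2 * (K / cmod a)\<^sup>2" using z fz(4) by (intro mult_left_mono power_mono) (auto simp: norm_divide divide_right_mono)
      also have "\<dots> = 2 * K\<^sup>2 / (cmod a)\<^sup>2" by (simp add: power_divide)
      finally have "real (m a) * cmod (Ln (1 - z / a) + z / a) \<le> real (m a) * (2 * K\<^sup>2 / (cmod a)\<^sup>2)" by (rule mult_left_mono) simp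
      then show "cmod (of_nat (m a) * (Ln (1 - z / a) + z / a)) \<le> 2 * K\<^sup>2 * (real (m a) / (cmod a)\<^sup>2)"
        by (simp add: norm_mult mult_ac)
    qed
    also have "\<dots> = 2 * K\<^sup>2 * (\<Sum>a\<in>D. real (m a) / (cmod a)\<^sup>2)" by (simp add: sum_distrib_left)
    also have "\<dots> \<le> 2 * K\<^sup>2 * (4 * C / R)" unfolding D_def by (intro mult_left_mono inverse_square_tail R) auto
    finally show "cmod (\<Sum>a\<in>D. of_nat (m a) * (Ln (1 - z / a) + z / a)) \<le> 8 * K\<^sup>2 * C / R" by simp
    have "cmod (partial_sum R' - partial_sum R) \<le> cmod (partial_sum R' - L) + cmod (partial_sum R - L)"
      using norm_triangle_ineq4[of "partial_sum R' - L" "partial_sum R - L"] by simp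
    then show "cmod (z * (partial_sum R' - partial_sum R)) \<le> K * (cmod (partial_sum R' - L) + cmod (partial_sum R - L))"
      unfolding norm_mult using z K by (intro mult_mono) auto
  qed
  finally show ?thesis .
qed

private lemma tail_bound_tendsto: "((\<lambda>R. 8 * K\<^sup>2 * C / R + K * (c + cmod (partial_sum R - L))) \<longlongrightarrow> K * c) at_top"
proof -
  have "(partial_sum \<longlongrightarrow> L) at_top" using lim unfolding partial_sum_def[abs_def] .
  then have "((\<lambda>R. 8 * K\<^sup>2 * C / R + K * (c + cmod (partial_sum R - L))) \<longlongrightarrow> 0 + K * (c + cmod (L - L))) at_top"
    by (intro tendsto_intros tendsto_divide_0[OF tendsto_const] filterlim_at_top_imp_at_infinity filterlim_ident)
  then show ?thesis by simp
qed

text \<open>The rate is explicit and uniform in |z| \<le> K. It yields holomorphy of the limit, and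
  at R = 2 K, where \<open>log_tail\<close> is an empty sum, it is a bound on the limit itself, as
  the exponential type requires.\<close>

private lemma log_tail_limit:
  assumes K: "K > 0"
  shows "\<exists>q. \<forall>R\<ge>2*K. \<forall>z. cmod z \<le> K \<longrightarrow> cmod (q z - log_tail K R z) \<le> 8 * K\<^sup>2 * C / R + K * cmod (partial_sum R - L)"
proof -
  have sL: "(partial_sum \<longlongrightarrow> L) at_top" using lim unfolding partial_sum_def[abs_def] .
  have "Cauchy (\<lambda>n. log_tail K (real n) z)" if z: "cmod z \<le> K" for z
  proof (rule metric_CauchyI)
    fix e :: real assume e: "e > 0"
    then have e2: "e / (4 * K) > 0" using K by simp
    have "\<forall>\<^sub>F R in at_top. 8 * K\<^sup>2 * C / R + K * (0 + cmod (partial_sum R - L)) < e / 2"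
      using tail_bound_tendsto[of K 0] e by (intro order_tendstoD) auto
    then obtain R1 where R1: "\<And>R. R \<ge> R1 \<Longrightarrow> 8 * K\<^sup>2 * C / R + K * (0 + cmod (partial_sum R - L)) < e / 2" unfolding eventually_at_top_linorder by blast
    have pos: "8 * K\<^sup>2 * C / R \<ge> 0" if "R \<ge> 2 * K" for R using that K C_nonneg by simp
    obtain N :: nat where N: "real N \<ge> max R1 (2 * K)" using real_arch_simple by blast
    have le: "dist (log_tail K (real n') z) (log_tail K (real n) z) < e" if "n \<ge> N" "n' \<ge> n" for n n'
    proof -
      have n: "2 * K \<le> real n" "real n \<le> real n'" "R1 \<le> real n" "R1 \<le> real n'" "2 * K \<le> real n'"
        using N that by auto
      have "dist (log_tail K (real n') z) (log_tail K (real n) z) \<le> 8 * K\<^sup>2 * C / real n + K * (cmod (partial_sum (real n') - L) + cmod (partial_sum (real n) - L))"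
        unfolding dist_norm by (rule log_tail_Cauchy[OF K n(1,2) z])
      also have "\<dots> < e" using R1[OF n(3)] R1[OF n(4)] pos[OF n(5)] by (simp add: distrib_left)
      finally show ?thesis .
    qed
    show "\<exists>M. \<forall>m\<ge>M. \<forall>n\<ge>M. dist (log_tail K (real m) z) (log_tail K (real n) z) < e"
    proof (intro exI allI impI)
      fix m n assume "m \<ge> N" "n \<ge> N"
      then show "dist (log_tail K (real m) z) (log_tail K (real n) z) < e"
        using le[of m n] le[of n m] by (cases "m \<le> n") (auto simp: dist_commute)
    qed
  qed
  then have "\<forall>z. \<exists>l. cmod z \<le> K \<longrightarrow> (\<lambda>n. log_tail K (real n) z) \<longlonglongrightarrow> l" using Cauchy_convergent unfolding convergent_def by blast
  then obtain q where q: "\<And>z. cmod z \<le> K \<Longrightarrow> (\<lambda>n. log_tail K (real n) z) \<longlonglongrightarrow> q z" by metis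
  have "cmod (q z - log_tail K R z) \<le> 8 * K\<^sup>2 * C / R + K * cmod (partial_sum R - L)" if R: "R \<ge> 2 * K" and z: "cmod z \<le> K" for R z
  proof (rule tendsto_le[OF sequentially_bot])
    show "(\<lambda>n. cmod (log_tail K (real n) z - log_tail K R z)) \<longlonglongrightarrow> cmod (q z - log_tail K R z)" by (intro tendsto_intros q z)
    have "(\<lambda>n. partial_sum (real n)) \<longlonglongrightarrow> L" by (rule filterlim_compose[OF sL filterlim_real_sequentially])
    then have "(\<lambda>n. 8 * K\<^sup>2 * C / R + K * (cmod (partial_sum (real n) - L) + cmod (partial_sum R - L))) \<longlonglongrightarrow> 8 * K\<^sup>2 * C / R + K * (cmod (L - L) + cmod (partial_sum R - L))"
      by (intro tendsto_intros)
    then show "(\<lambda>n. 8 * K\<^sup>2 * C / R + K * (cmod (partial_sum (real n) - L) + cmod (partial_sum R - L))) \<longlonglongrightarrow> 8 * K\<^sup>2 * C / R + K * cmod (partial_sum R - L)" by simp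
    show "\<forall>\<^sub>F n in sequentially. cmod (log_tail K (real n) z - log_tail K R z) \<le> 8 * K\<^sup>2 * C / R + K * (cmod (partial_sum (real n) - L) + cmod (partial_sum R - L))"
      using eventually_ge_at_top[of "nat \<lceil>R\<rceil>"]
    proof eventually_elim
      case (elim n)
      then have "R \<le> real n" by linarith
      then show ?case by (rule log_tail_Cauchy[OF K R _ z])
    qed
  qed
  then show ?thesis by blast
qed

text \<open>The last clause is the logarithm of a quotient of partial products: the terms ln |a|
  cancel between x and b, and the products converge to nonzero values there.\<close>

lemma canonical_product:
  obtains g where "g holomorphic_on UNIV" "is_zero_set m g" "\<exists>A B. \<forall>z. cmod (g z) \<le> A * exp (B * cmod z)"
    "\<And>x b. m x = 0 \<Longrightarrow> m b = 0 \<Longrightarrow> ((\<lambda>R. \<Sum>a\<in>zeros_in m R. m a * (ln (cmod (x - a)) - ln (cmod (b - a)))) \<longlongrightarrow> ln (cmod (g x)) - ln (cmod (g b))) at_top"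
proof -
  have "\<forall>K. \<exists>q. K > 0 \<longrightarrow> (\<forall>R\<ge>2*K. \<forall>z. cmod z \<le> K \<longrightarrow> cmod (q z - log_tail K R z) \<le> 8 * K\<^sup>2 * C / R + K * cmod (partial_sum R - L))"
    using log_tail_limit by blast
  then obtain q where q: "\<And>K R z. K > 0 \<Longrightarrow> R \<ge> 2 * K \<Longrightarrow> cmod z \<le> K \<Longrightarrow> cmod (q K z - log_tail K R z) \<le> 8 * K\<^sup>2 * C / R + K * cmod (partial_sum R - L)"
    by metis
  have err0: "((\<lambda>R. 8 * K\<^sup>2 * C / R + K * cmod (partial_sum R - L)) \<longlongrightarrow> 0) at_top" for K
    using tail_bound_tendsto[of K 0] by simp
  have qlim: "uniform_limit (cball 0 K) (log_tail K) (q K) at_top" if K: "K > 0" for K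
  proof (rule uniform_limitI)
    fix e :: real assume "e > 0"
    then have "\<forall>\<^sub>F R in at_top. 8 * K\<^sup>2 * C / R + K * cmod (partial_sum R - L) < e" using err0 by (intro order_tendstoD) auto
    then show "\<forall>\<^sub>F R in at_top. \<forall>z\<in>cball 0 K. dist (log_tail K R z) (q K z) < e"
      using eventually_ge_at_top[of "2 * K"]
    proof eventually_elim
      case (elim R)
      show ?case
      proof
        fix z assume "z \<in> cball (0::complex) K"
        then have "cmod (q K z - log_tail K R z) \<le> 8 * K\<^sup>2 * C / R + K * cmod (partial_sum R - L)" using q[OF K elim(2), of z] by simp
        then show "dist (log_tail K R z) (q K z) < e" using elim(1) by (simp add: dist_norm norm_minus_commute)
      qed
    qed
  qed
  have qhol: "q K holomorphic_on ball 0 K" if K: "K > 0" for K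
  proof (rule holomorphic_uniform_limit[OF _ qlim[OF K]])
    have h: "log_tail K R holomorphic_on cball 0 K" for R
      unfolding log_tail_def using far_zero(2,4)[OF _ order_refl K] by (intro holomorphic_intros) auto
    show "\<forall>\<^sub>F R in at_top. continuous_on (cball 0 K) (log_tail K R) \<and> log_tail K R holomorphic_on ball 0 K"
      using h holomorphic_on_imp_continuous_on holomorphic_on_subset ball_subset_cball by (intro always_eventually) blast
  qed auto
  have Plim: "((\<lambda>R. partial_prod R z) \<longlongrightarrow> partial_prod (2 * K) z * exp (q K z)) at_top" if K: "K > 0" and z: "cmod z \<le> K" for K z
  proof -
    have "((\<lambda>R. log_tail K R z) \<longlongrightarrow> q K z) at_top" by (rule tendsto_uniform_limitI[OF qlim[OF K]]) (use z in simp)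
    then have "((\<lambda>R. partial_prod (2 * K) z * exp (log_tail K R z)) \<longlongrightarrow> partial_prod (2 * K) z * exp (q K z)) at_top" by (intro tendsto_intros)
    moreover have "\<forall>\<^sub>F R in at_top. partial_prod (2 * K) z * exp (log_tail K R z) = partial_prod R z"
      by (rule eventually_mono[OF eventually_ge_at_top[of "2 * K"]]) (rule partial_prod_eq[OF K _ z, symmetric])
    ultimately show ?thesis by (rule Lim_transform_eventually)
  qed
  \<comment> \<open>K = |z| + 1 merely selects one admissible K for each z. By \<open>geq\<close>
    every K \<ge> |z| with K > 0 gives the same value, as all these expressions are limits of the
    same partial products.\<close>
  define g where "g z = partial_prod (2 * (cmod z + 1)) z * exp (q (cmod z + 1) z)" for z
  have glim: "((\<lambda>R. partial_prod R z) \<longlongrightarrow> g z) at_top" for z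
    unfolding g_def by (rule Plim) (auto simp: add_nonneg_pos)
  have geq: "g z = partial_prod (2 * K) z * exp (q K z)" if "K > 0" "cmod z \<le> K" for K z
    by (rule tendsto_unique[OF _ glim Plim[OF that]]) simp
  have Phol: "partial_prod R holomorphic_on A" for R A unfolding partial_prod_def using m0 by (intro holomorphic_intros) (auto simp: zeros_in_def)
  have gholK: "g holomorphic_on ball 0 K" if K: "K > 0" for K
  proof -
    have "(\<lambda>z. partial_prod (2 * K) z * exp (q K z)) holomorphic_on ball 0 K" by (intro holomorphic_intros Phol qhol K)
    then show ?thesis by (rule holomorphic_transform) (simp add: geq[OF K])
  qed
  have ghol: "g holomorphic_on UNIV"
  proof -
    have "UNIV = (\<Union>K\<in>{0<..}. ball (0::complex) K)"
    proof -
      have "z \<in> (\<Union>K\<in>{0<..}. ball (0::complex) K)" for z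
        by (rule UN_I[of "cmod z + 1"]) (auto simp: add_nonneg_pos)
      then show ?thesis by blast
    qed
    moreover have "g holomorphic_on (\<Union>K\<in>{0<..}. ball 0 K)" by (rule holomorphic_on_UN_open) (auto intro: gholK)
    ultimately show ?thesis by simp
  qed
  have zset: "is_zero_set m g"
  proof (rule is_zero_setI[OF ghol])
    fix a :: complex
    define K where "K = cmod a + 1"
    have K: "K > 0" "cmod a < K" by (simp_all add: K_def add_nonneg_pos)
    define Z where "Z = zeros_in m (2 * K)"
    have Z: "finite Z" "0 \<notin> Z" using fin m0 by (auto simp: Z_def zeros_in_def)
    \<comment> \<open>If a is a zero, its factor (1 - w / a)^m splits as (-1 / a)^m (w - a)^m;
      \<open>p\<close> collects everything else, and none of it vanishes at a.\<close>
    define p where "p w = (if m a = 0 then 1 else (- 1 / a) ^ m a) * (\<Prod>c\<in>Z - {a}. (1 - w / c) ^ m c) * exp (q K w)" for w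
    have "g w = p w * (w - a) ^ m a" if w: "w \<in> ball 0 K" for w
    proof -
      have "partial_prod (2 * K) w = (if m a = 0 then 1 else (- 1 / a) ^ m a) * (\<Prod>c\<in>Z - {a}. (1 - w / c) ^ m c) * (w - a) ^ m a"
      proof (cases "m a = 0")
        case True
        then have "a \<notin> Z" by (simp add: Z_def zeros_in_def)
        then show ?thesis using True by (simp add: partial_prod_def Z_def)
      next
        case False
        then have aZ: "a \<in> Z" using K by (simp add: Z_def zeros_in_def)
        then have "a \<noteq> 0" using Z by auto
        then have "(1 - w / a) = (- 1 / a) * (w - a)" by (simp add: field_simps)
        then show ?thesis using False prod.remove[OF Z(1) aZ, of "\<lambda>c. (1 - w / c) ^ m c"]
          by (simp add: partial_prod_def Z_def power_mult_distrib[symmetric] mult_ac)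
      qed
      then show ?thesis using geq[OF K(1), of w] w by (simp add: p_def)
    qed
    moreover have "p holomorphic_on ball 0 K" unfolding p_def using Z qhol[OF K(1)] by (intro holomorphic_intros) auto
    moreover have "p a \<noteq> 0"
    proof -
      have "a \<noteq> 0" if "m a \<noteq> 0" using that m0 by auto
      moreover have "(\<Prod>c\<in>Z - {a}. (1 - a / c) ^ m c) \<noteq> 0" using Z by (auto simp: prod_zero_iff)
      ultimately show ?thesis by (auto simp: p_def)
    qed
    ultimately show "\<exists>S q. open S \<and> a \<in> S \<and> q holomorphic_on S \<and> q a \<noteq> 0 \<and> (\<forall>w\<in>S. g w = q w * (w - a) ^ m a)"
      using K by (intro exI[of _ "ball 0 K"] exI[of _ p]) auto
  qed
  have expt: "\<exists>A B. \<forall>z. cmod (g z) \<le> A * exp (B * cmod z)"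
  proof -
    have "(partial_sum \<longlongrightarrow> L) at_top" using lim unfolding partial_sum_def[abs_def] .
    then have "\<forall>\<^sub>F R in at_top. dist (partial_sum R) L < 1" by (rule tendstoD) simp
    then obtain R0 where R0: "\<And>R. R \<ge> R0 \<Longrightarrow> cmod (partial_sum R - L) < 1" unfolding eventually_at_top_linorder dist_norm by blast
    \<comment> \<open>A bound valid for all R: above \<open>R0\<close> the partial sums are close to
      L, below \<open>R0\<close> they are bounded by the finite sum of moduli.\<close>
    define M where "M = 1 + (\<Sum>a\<in>zeros_in m R0. cmod (of_nat (m a) / a)) + cmod L"
    have sM: "cmod (partial_sum R - L) \<le> M" for R
    proof (cases "R \<ge> R0")
      case True
      have "0 \<le> (\<Sum>a\<in>zeros_in m R0. cmod (of_nat (m a) / a))" by (rule sum_nonneg) simp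
      then show ?thesis using R0[OF True] norm_ge_zero[of L] unfolding M_def by linarith
    next
      case False
      have "cmod (partial_sum R) \<le> (\<Sum>a\<in>zeros_in m R. cmod (of_nat (m a) / a))" unfolding partial_sum_def by (rule norm_sum)
      also have "\<dots> \<le> (\<Sum>a\<in>zeros_in m R0. cmod (of_nat (m a) / a))"
        using False by (intro sum_mono2 fin zeros_in_mono[OF fin m0]) auto
      finally show ?thesis using norm_triangle_ineq4[of "partial_sum R" L] unfolding M_def by linarith
    qed
    \<comment> \<open>With K = |z| + 1, the near factors are at most exp (6 C K) by
      \<open>zero_mean_le\<close> at radius 3 K, and the tail limit is at most (4 C + M) K in
      modulus.\<close>
    define B where "B = 6 * C + 4 * C + M"
    have "cmod (g z) \<le> exp B * exp (B * cmod z)" for z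
    proof -
      define K where "K = cmod z + 1"
      have K: "K > 0" "cmod z \<le> K" by (simp_all add: K_def add_nonneg_pos)
      have "cmod (partial_prod (2 * K) z) \<le> exp (zero_mean m (3 * K))"
      proof -
        have "cmod (partial_prod (2 * K) z) = (\<Prod>a\<in>zeros_in m (2 * K). cmod (1 - z / a) ^ m a)"
          by (simp add: partial_prod_def prod_norm[symmetric] norm_power)
        also have "\<dots> \<le> (\<Prod>a\<in>zeros_in m (2 * K). exp (real (m a) * (ln (3 * K) - ln (cmod a))))"
        proof (rule prod_mono)
          fix a assume a: "a \<in> zeros_in m (2 * K)"
          have ca: "0 < cmod a" "cmod a < 2 * K" using zeros_in_pos[OF fin m0 a] a by (auto simp: zeros_in_def)
          have "cmod (1 - z / a) \<le> 1 + cmod z / cmod a" using norm_triangle_ineq4[of 1 "z / a"] by (simp add: norm_divide)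
          also have "\<dots> = (cmod a + cmod z) / cmod a" using ca by (simp add: field_simps)
          also have "\<dots> \<le> 3 * K / cmod a" using ca K by (intro divide_right_mono) auto
          also have "\<dots> = exp (ln (3 * K) - ln (cmod a))" using ca K by (simp add: exp_diff)
          finally have "cmod (1 - z / a) ^ m a \<le> exp (ln (3 * K) - ln (cmod a)) ^ m a" by (intro power_mono) auto
          then show "0 \<le> cmod (1 - z / a) ^ m a \<and> cmod (1 - z / a) ^ m a \<le> exp (real (m a) * (ln (3 * K) - ln (cmod a)))"
            by (simp add: exp_of_nat_mult)
        qed
        also have "\<dots> = exp (\<Sum>a\<in>zeros_in m (2 * K). real (m a) * (ln (3 * K) - ln (cmod a)))" using fin by (simp add: exp_sum)
        also have "\<dots> \<le> exp (zero_mean m (3 * K))"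
        proof -
          have "(\<Sum>a\<in>zeros_in m (2 * K). real (m a) * (ln (3 * K) - ln (cmod a))) \<le> zero_mean m (3 * K)"
            unfolding zero_mean_def
          proof (rule sum_mono2[OF fin])
            show "zeros_in m (2 * K) \<subseteq> zeros_in m (3 * K)" by (rule zeros_in_mono[OF fin m0]) (use K in simp)
            fix a assume "a \<in> zeros_in m (3 * K) - zeros_in m (2 * K)"
            then have "0 < cmod a" "cmod a < 3 * K" using zeros_in_pos[OF fin m0, of a "3 * K"] by (auto simp: zeros_in_def)
            then have "ln (cmod a) \<le> ln (3 * K)" by (intro ln_mono) auto
            then show "0 \<le> real (m a) * (ln (3 * K) - ln (cmod a))" by simp
          qed
          then show ?thesis by simp
        qed
        finally show ?thesis .
      qed
      also have "\<dots> \<le> exp (6 * C * K)" using zero_mean_le[of "3 * K"] K by (simp add: mult_ac)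
      finally have b1: "cmod (partial_prod (2 * K) z) \<le> exp (6 * C * K)" .
      have "log_tail K (2 * K) z = 0" by (simp add: log_tail_def)
      then have "cmod (q K z) \<le> 8 * K\<^sup>2 * C / (2 * K) + K * cmod (partial_sum (2 * K) - L)" using q[OF K(1) order_refl K(2)] by simp
      also have "8 * K\<^sup>2 * C / (2 * K) = 4 * C * K" using K by (simp add: power2_eq_square)
      also have "K * cmod (partial_sum (2 * K) - L) \<le> K * M" using sM K by (intro mult_left_mono) auto
      finally have "Re (q K z) \<le> 4 * C * K + K * M" using complex_Re_le_cmod[of "q K z"] by linarith
      then have "cmod (exp (q K z)) \<le> exp (4 * C * K + K * M)" by simp
      then have "cmod (g z) \<le> exp (6 * C * K) * exp (4 * C * K + K * M)"
        unfolding geq[OF K] norm_mult using b1 by (intro mult_mono) auto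
      also have "\<dots> = exp (B * K)" by (simp add: B_def algebra_simps flip: exp_add)
      also have "\<dots> = exp B * exp (B * cmod z)" by (simp add: K_def algebra_simps flip: exp_add)
      finally show ?thesis .
    qed
    then show ?thesis by blast
  qed
  have "((\<lambda>R. \<Sum>a\<in>zeros_in m R. m a * (ln (cmod (x - a)) - ln (cmod (b - a)))) \<longlongrightarrow> ln (cmod (g x)) - ln (cmod (g b))) at_top"
    if x: "m x = 0" and b: "m b = 0" for x b
  proof -
    have lnP: "ln (cmod (partial_prod R w)) = (\<Sum>a\<in>zeros_in m R. m a * (ln (cmod (w - a)) - ln (cmod a)))" if "m w = 0" for R w
    proof -
      have nz: "1 - w / a \<noteq> 0" "a \<noteq> 0" "w \<noteq> a" if "a \<in> zeros_in m R" for a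
        using that m0 \<open>m w = 0\<close> by (auto simp: zeros_in_def)
      have "ln (cmod (partial_prod R w)) = ln (\<Prod>a\<in>zeros_in m R. cmod (1 - w / a) ^ m a)"
        by (simp add: partial_prod_def prod_norm[symmetric] norm_power)
      also have "\<dots> = (\<Sum>a\<in>zeros_in m R. ln (cmod (1 - w / a) ^ m a))"
        using nz fin by (intro ln_prod) auto
      also have "\<dots> = (\<Sum>a\<in>zeros_in m R. m a * (ln (cmod (w - a)) - ln (cmod a)))"
      proof (rule sum.cong[OF refl])
        fix a assume a: "a \<in> zeros_in m R"
        have "1 - w / a = (a - w) / a" using nz[OF a] by (simp add: field_simps)
        then have "cmod (1 - w / a) = cmod (w - a) / cmod a" by (simp only: norm_divide norm_minus_commute)
        then show "ln (cmod (1 - w / a) ^ m a) = m a * (ln (cmod (w - a)) - ln (cmod a))"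
          using nz[OF a] by (simp add: ln_realpow ln_div)
      qed
      finally show ?thesis .
    qed
    have nzg: "g w \<noteq> 0" if "m w = 0" for w using is_zero_set_iff(1)[OF ghol zset] that by simp
    have "((\<lambda>R. ln (cmod (partial_prod R x)) - ln (cmod (partial_prod R b))) \<longlongrightarrow> ln (cmod (g x)) - ln (cmod (g b))) at_top"
      using nzg[OF x] nzg[OF b] by (intro tendsto_intros glim) auto
    moreover have "ln (cmod (partial_prod R x)) - ln (cmod (partial_prod R b)) = (\<Sum>a\<in>zeros_in m R. m a * (ln (cmod (x - a)) - ln (cmod (b - a))))" for R
      unfolding lnP[OF x] lnP[OF b] sum_subtractf[symmetric] by (intro sum.cong) (auto simp: algebra_simps)
    ultimately show ?thesis by simp
  qed
  then show thesis using that ghol zset expt by blast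
qed

end

section \<open>Zero sets with convergent logarithmic integral\<close>

lemma nn_integral_inverse_one_plus_square:
  fixes c :: real
  assumes "c \<ge> 0"
  shows "(\<integral>\<^sup>+x. ennreal (c / (1 + x\<^sup>2)) \<partial>lborel) < \<infinity>"
proof -
  have d: "(1 + x\<^sup>2 :: real) > 0" for x by (simp add: add_pos_nonneg)
  have half: "(\<integral>\<^sup>+x. ennreal (1 / (1 + x\<^sup>2)) * indicator {0..} x \<partial>lborel) = ennreal (pi / 2 - arctan 0)"
  proof (rule nn_integral_FTC_atLeast)
    show "(\<lambda>x::real. 1 / (1 + x\<^sup>2)) \<in> borel_measurable borel" by measurable
    show "(arctan has_real_derivative 1 / (1 + x\<^sup>2)) (at x)" for x
      by (auto intro!: derivative_eq_intros simp: inverse_eq_divide)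
    show "(arctan \<longlongrightarrow> pi / 2) at_top" by (rule tendsto_arctan_at_top)
  qed (simp add: less_imp_le[OF d])
  have "(\<integral>\<^sup>+x. ennreal (1 / (1 + x\<^sup>2)) \<partial>lborel) \<le> (\<integral>\<^sup>+x. ennreal (1 / (1 + x\<^sup>2)) * indicator {0..} x + ennreal (1 / (1 + (0 + -1 * x)\<^sup>2)) * indicator {0..} (0 + -1 * x) \<partial>lborel)"
    by (intro nn_integral_mono) (auto simp: indicator_def)
  also have "\<dots> = (\<integral>\<^sup>+x. ennreal (1 / (1 + x\<^sup>2)) * indicator {0..} x \<partial>lborel) + (\<integral>\<^sup>+x. ennreal (1 / (1 + (0 + -1 * x)\<^sup>2)) * indicator {0..} (0 + -1 * x) \<partial>lborel)"
    by (rule nn_integral_add) auto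
  also have "(\<integral>\<^sup>+x. ennreal (1 / (1 + (0 + -1 * x)\<^sup>2)) * indicator {0..} (0 + -1 * x) \<partial>lborel) = (\<integral>\<^sup>+x. ennreal (1 / (1 + x\<^sup>2)) * indicator {0..} x \<partial>lborel)"
    by (subst nn_integral_real_affine[of "\<lambda>x. ennreal (1 / (1 + x\<^sup>2)) * indicator {0..} x" "-1" 0]) auto
  also have "(\<integral>\<^sup>+x. ennreal (1 / (1 + x\<^sup>2)) * indicator {0..} x \<partial>lborel) + (\<integral>\<^sup>+x. ennreal (1 / (1 + x\<^sup>2)) * indicator {0..} x \<partial>lborel) < \<infinity>"
    unfolding half by simp
  finally have fin: "(\<integral>\<^sup>+x. ennreal (1 / (1 + x\<^sup>2)) \<partial>lborel) < \<infinity>" .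
  have "(\<integral>\<^sup>+x. ennreal (c / (1 + x\<^sup>2)) \<partial>lborel) = (\<integral>\<^sup>+x. ennreal c * ennreal (1 / (1 + x\<^sup>2)) \<partial>lborel)"
    using assms by (intro nn_integral_cong) (simp flip: ennreal_mult add: less_imp_le[OF d])
  also have "\<dots> = ennreal c * (\<integral>\<^sup>+x. ennreal (1 / (1 + x\<^sup>2)) \<partial>lborel)" by (rule nn_integral_cmult) simp
  also have "\<dots> < \<infinity>" using fin by (simp add: ennreal_mult_less_top)
  finally show ?thesis .
qed

text \<open>Passes between log^+ |f| and the positive part of log |f x / f b|, which differ by at
  most a constant. In one direction \<open>u\<close> is the function I of (iv), known only almost
  everywhere; \<open>v\<close> is a measurable representative of it.\<close>

lemma log_integral_shift:
  fixes u v :: "real \<Rightarrow> real"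
  assumes u: "(\<integral>\<^sup>+x. ennreal (max 0 (u x) / (1 + x\<^sup>2)) \<partial>lborel) < \<infinity>"
    and v: "v \<in> borel_measurable borel" and ae: "AE x in lborel. u x = v x" and le: "\<And>x. w x \<le> \<bar>v x + c\<bar> \<and> w x \<le> max 0 (v x + c)"
  shows "(\<integral>\<^sup>+x. ennreal (max 0 (w x) / (1 + x\<^sup>2)) \<partial>lborel) < \<infinity>"
proof -
  note [measurable] = v
  have d: "(1 + x\<^sup>2 :: real) > 0" for x by (simp add: add_pos_nonneg)
  have "(\<integral>\<^sup>+x. ennreal (max 0 (w x) / (1 + x\<^sup>2)) \<partial>lborel) \<le> (\<integral>\<^sup>+x. ennreal (max 0 (v x) / (1 + x\<^sup>2)) + ennreal (\<bar>c\<bar> / (1 + x\<^sup>2)) \<partial>lborel)"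
  proof (rule nn_integral_mono)
    fix x :: real
    have "max 0 (w x) / (1 + x\<^sup>2) \<le> (max 0 (v x) + \<bar>c\<bar>) / (1 + x\<^sup>2)"
      using le[of x] d[of x] by (intro divide_right_mono) auto
    then have "ennreal (max 0 (w x) / (1 + x\<^sup>2)) \<le> ennreal (max 0 (v x) / (1 + x\<^sup>2) + \<bar>c\<bar> / (1 + x\<^sup>2))"
      by (intro ennreal_leI) (simp add: add_divide_distrib)
    then show "ennreal (max 0 (w x) / (1 + x\<^sup>2)) \<le> ennreal (max 0 (v x) / (1 + x\<^sup>2)) + ennreal (\<bar>c\<bar> / (1 + x\<^sup>2))"
      using d[of x] by (subst ennreal_plus[symmetric]) (auto simp: less_imp_le)
  qed
  also have "\<dots> = (\<integral>\<^sup>+x. ennreal (max 0 (v x) / (1 + x\<^sup>2)) \<partial>lborel) + (\<integral>\<^sup>+x. ennreal (\<bar>c\<bar> / (1 + x\<^sup>2)) \<partial>lborel)"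
    by (rule nn_integral_add) auto
  also have "(\<integral>\<^sup>+x. ennreal (max 0 (v x) / (1 + x\<^sup>2)) \<partial>lborel) = (\<integral>\<^sup>+x. ennreal (max 0 (u x) / (1 + x\<^sup>2)) \<partial>lborel)"
    by (rule nn_integral_cong_AE) (use ae in eventually_elim, simp)
  also have "\<dots> + (\<integral>\<^sup>+x. ennreal (\<bar>c\<bar> / (1 + x\<^sup>2)) \<partial>lborel) < \<infinity>"
    using u nn_integral_inverse_one_plus_square[of "\<bar>c\<bar>"] by simp
  finally show ?thesis .
qed

lemma real_zeros_countable:
  assumes "no_finite_limit_points m"
  shows "countable {x::real. m (of_real x) \<noteq> 0}"
proof -
  have "{x::real. m (of_real x) \<noteq> 0} = (\<Union>n::nat. {x. of_real x \<in> zeros_in m (real n)})"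
    using reals_Archimedean2 by (auto simp: zeros_in_def)
  moreover have "finite {x::real. complex_of_real x \<in> zeros_in m (real n)}" for n
    using finite_vimageI[OF finite_zeros_in[OF assms, of "real n"] inj_of_real] by (simp add: vimage_def)
  ultimately show ?thesis by (simp add: countable_finite)
qed

lemma AE_not_real_zero:
  assumes "no_finite_limit_points m"
  shows "AE x in lborel. m (complex_of_real x) = 0 \<and> x \<noteq> 0"
proof -
  have "countable ({x::real. m (of_real x) \<noteq> 0} \<union> {0})" using real_zeros_countable[OF assms] by simp
  then have "AE x in lborel. x \<notin> {x::real. m (of_real x) \<noteq> 0} \<union> {0}"
    by (intro AE_not_in) (rule countable_imp_null_set_lborel)
  then show ?thesis by eventually_elim auto
qed

section \<open>Splitting off a zero at the origin\<close>

lemma no_finite_limit_points_remove_0: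
  assumes "no_finite_limit_points m"
  shows "no_finite_limit_points (m(0 := 0))"
proof -
  have "{w. (m(0 := 0)) w \<noteq> 0} \<subseteq> {w. m w \<noteq> 0}" by auto
  then show ?thesis using assms islimpt_subset unfolding no_finite_limit_points_def by blast
qed

lemma zeros_in_remove_0: "zeros_in (m(0 := 0)) R = {z. m z \<noteq> 0 \<and> 0 < cmod z \<and> cmod z < R}"
  by (auto simp: zeros_in_def)

lemma log_sum_remove_0:
  fixes \<phi> :: "complex \<Rightarrow> real"
  assumes nl: "no_finite_limit_points m" and R: "R > 0"
  shows "(\<Sum>a\<in>zeros_in m R. m a * \<phi> a) = m 0 * \<phi> 0 + (\<Sum>a\<in>zeros_in (m(0 := 0)) R. real ((m(0 := 0)) a) * \<phi> a)"
proof (cases "m 0 = 0")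
  case True
  then have "m(0 := 0) = m" by (simp add: fun_upd_idem)
  then show ?thesis using True by (simp del: fun_upd_apply)
next
  case False
  have eq: "zeros_in m R = insert 0 (zeros_in (m(0 := 0)) R)" using False R by (auto simp: zeros_in_def)
  have "(\<Sum>a\<in>zeros_in (m(0 := 0)) R. m a * \<phi> a) = (\<Sum>a\<in>zeros_in (m(0 := 0)) R. real ((m(0 := 0)) a) * \<phi> a)"
    by (intro sum.cong) (auto simp: zeros_in_def)
  then show ?thesis unfolding eq using finite_zeros_in[OF no_finite_limit_points_remove_0[OF nl], of R]
    by (subst sum.insert) (auto simp: zeros_in_def)
qed

text \<open>The radius t + 1 makes up for the closed disc in \<open>ncount\<close> against the open
  one in \<open>zero_count\<close>; on the scale of t the shift is invisible.\<close>

lemma ncount_zero_count: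
  assumes nl: "no_finite_limit_points m" and t: "t > 0"
  shows "real (m 0) + zero_count (m(0 := 0)) t \<le> real (ncount m 0 t)"
    "real (ncount m 0 t) \<le> real (m 0) + zero_count (m(0 := 0)) (t + 1)"
proof -
  have e: "(\<Sum>a\<in>zeros_in m R. real (m a)) = real (m 0) + zero_count (m(0 := 0)) R" if "R > 0" for R
    using log_sum_remove_0[OF nl that, of "\<lambda>_. 1"] by (simp add: zero_count_def del: fun_upd_apply)
  have n: "real (ncount m 0 t) = (\<Sum>a\<in>{z. m z \<noteq> 0 \<and> cmod (z - 0) \<le> t}. real (m a))" by (simp add: ncount_def)
  have "(\<Sum>a\<in>zeros_in m t. real (m a)) \<le> real (ncount m 0 t)" unfolding n
    by (rule sum_mono2[OF finite_zeros_in_disc[OF nl]]) (auto simp: zeros_in_def)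
  then show "real (m 0) + zero_count (m(0 := 0)) t \<le> real (ncount m 0 t)" using e[OF t] by simp
  have "real (ncount m 0 t) \<le> (\<Sum>a\<in>zeros_in m (t + 1). real (m a))" unfolding n
    by (rule sum_mono2[OF finite_zeros_in[OF nl]]) (auto simp: zeros_in_def)
  then show "real (ncount m 0 t) \<le> real (m 0) + zero_count (m(0 := 0)) (t + 1)" using e[of "t + 1"] t by simp
qed

lemma power_mult_is_zero_set:
  assumes g: "g holomorphic_on UNIV" and zs: "is_zero_set (m(0 := 0)) g"
  shows "is_zero_set m (\<lambda>z. z ^ m 0 * g z)"
proof (rule is_zero_setI)
  show "(\<lambda>z. z ^ m 0 * g z) holomorphic_on UNIV" by (intro holomorphic_intros g)
  fix a :: complex
  show "\<exists>S q. open S \<and> a \<in> S \<and> q holomorphic_on S \<and> q a \<noteq> 0 \<and> (\<forall>w\<in>S. w ^ m 0 * g w = q w * (w - a) ^ m a)"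
  proof (cases "a = 0")
    case True
    have "g 0 \<noteq> 0" using is_zero_set_iff(1)[OF g zs, of 0] by simp
    then show ?thesis using True g by (intro exI[of _ UNIV] exI[of _ g]) (auto simp: mult.commute)
  next
    case False
    have nz: "\<exists>w\<in>UNIV. g w \<noteq> 0" using is_zero_set_iff(1)[OF g zs, of 0] by auto
    obtain r where r: "r > 0" "zor_poly g a holomorphic_on cball a r"
      "\<And>w. w \<in> cball a r \<Longrightarrow> g w = zor_poly g a w * (w - a) ^ nat (zorder g a) \<and> zor_poly g a w \<noteq> 0"
      using zorder_exist_zero[OF g open_UNIV connected_UNIV UNIV_I nz, of a] by blast
    have "zorder g a = int (m a)" using is_zero_set_iff(2)[OF g zs, of a] False by simp
    then have "\<forall>w\<in>ball a r. w ^ m 0 * g w = (w ^ m 0 * zor_poly g a w) * (w - a) ^ m a" using r(3) by auto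
    moreover have "(\<lambda>w. w ^ m 0 * zor_poly g a w) holomorphic_on ball a r"
      by (intro holomorphic_intros holomorphic_on_subset[OF r(2)]) auto
    moreover have "a ^ m 0 * zor_poly g a a \<noteq> 0" using False r(3)[of a] r(1) by auto
    ultimately show ?thesis using r(1) by (intro exI[of _ "ball a r"] exI[of _ "\<lambda>w. w ^ m 0 * zor_poly g a w"]) auto
  qed
qed

lemma divide_power_is_zero_set:
  assumes f: "f holomorphic_on UNIV" and zs: "is_zero_set m f"
  obtains g where "g holomorphic_on UNIV" "is_zero_set (m(0 := 0)) g" "\<And>z. f z = z ^ m 0 * g z"
proof -
  have nz: "\<exists>w\<in>UNIV. f w \<noteq> 0"
  proof (rule ccontr)
    assume "\<not> ?thesis"
    then have "f = (\<lambda>_. 0)" by auto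
    then have "(deriv ^^ m 0) f 0 = 0" by simp
    then show False using zs by (auto simp: is_zero_set_def)
  qed
  have ord: "zorder f a = int (m a)" "f a = 0 \<longleftrightarrow> m a \<noteq> 0" for a using is_zero_set_iff[OF f zs] by auto
  obtain r where r: "r > 0" "zor_poly f 0 holomorphic_on cball 0 r"
      "\<And>w. w \<in> cball 0 r \<Longrightarrow> f w = zor_poly f 0 w * (w - 0) ^ nat (zorder f 0) \<and> zor_poly f 0 w \<noteq> 0"
    using zorder_exist_zero[OF f open_UNIV connected_UNIV UNIV_I nz, of 0] by blast
  \<comment> \<open>The singularity of f / z^(m 0) at the origin is removed by inserting the value
    of \<open>zor_poly\<close>, with which the quotient agrees near 0.\<close>
  define g where "g z = (if z = 0 then zor_poly f 0 0 else f z / z ^ m 0)" for z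
  have gball: "g w = zor_poly f 0 w" if "w \<in> ball 0 r" for w
    using that r(3)[of w] by (auto simp: g_def ord)
  have "g holomorphic_on ball 0 r"
    by (rule holomorphic_transform[OF holomorphic_on_subset[OF r(2) ball_subset_cball]]) (simp add: gball)
  moreover have "g holomorphic_on - {0}"
  proof -
    have "(\<lambda>z. f z / z ^ m 0) holomorphic_on - {0}" by (intro holomorphic_intros holomorphic_on_subset[OF f]) auto
    then show ?thesis by (rule holomorphic_transform) (auto simp: g_def)
  qed
  ultimately have "g holomorphic_on ball 0 r \<union> - {0}" by (intro holomorphic_on_Un) auto
  moreover have "ball 0 r \<union> - {0} = (UNIV :: complex set)" using r(1) by auto
  ultimately have g: "g holomorphic_on UNIV" by simp
  have fg: "f z = z ^ m 0 * g z" for z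
    using r(3)[of 0] r(1) by (cases "z = 0") (auto simp: g_def ord)
  have "is_zero_set (m(0 := 0)) g"
  proof (rule is_zero_setI[OF g])
    fix a :: complex
    show "\<exists>S q. open S \<and> a \<in> S \<and> q holomorphic_on S \<and> q a \<noteq> 0 \<and> (\<forall>w\<in>S. g w = q w * (w - a) ^ (m(0 := 0)) a)"
    proof (cases "a = 0")
      case True
      have "g 0 \<noteq> 0" using r(3)[of 0] r(1) by (simp add: g_def)
      then show ?thesis using True g by (intro exI[of _ UNIV] exI[of _ g]) auto
    next
      case False
      obtain \<rho> where \<rho>: "\<rho> > 0" "zor_poly f a holomorphic_on cball a \<rho>"
        "\<And>w. w \<in> cball a \<rho> \<Longrightarrow> f w = zor_poly f a w * (w - a) ^ nat (zorder f a) \<and> zor_poly f a w \<noteq> 0"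
        using zorder_exist_zero[OF f open_UNIV connected_UNIV UNIV_I nz, of a] by blast
      define S where "S = ball a \<rho> - {0}"
      have "\<forall>w\<in>S. g w = (zor_poly f a w / w ^ m 0) * (w - a) ^ (m(0 := 0)) a"
        using \<rho>(3) False by (auto simp: S_def g_def ord)
      moreover have "(\<lambda>w. zor_poly f a w / w ^ m 0) holomorphic_on S"
        by (intro holomorphic_intros holomorphic_on_subset[OF \<rho>(2)]) (auto simp: S_def)
      moreover have "zor_poly f a a / a ^ m 0 \<noteq> 0" using False \<rho>(3)[of a] \<rho>(1) by auto
      moreover have "open S" "a \<in> S" using \<rho>(1) False by (auto simp: S_def)
      ultimately show ?thesis by blast
    qed
  qed
  then show thesis using that g fg by blast
qed

lemma exponential_type_constants:
  assumes "exponential_type f"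
  obtains A B where "A \<ge> 1" "B \<ge> 0" "\<And>z. cmod (f z) \<le> A * exp (B * cmod z)"
proof -
  obtain A B where AB: "\<And>z. cmod (f z) \<le> A * exp (B * cmod z)" using assms unfolding exponential_type_def by blast
  have "cmod (f z) \<le> max A 1 * exp (max B 0 * cmod z)" for z
  proof -
    have "A * exp (B * cmod z) \<le> max A 1 * exp (max B 0 * cmod z)"
      by (intro mult_mono) (auto simp: mult_right_mono)
    then show ?thesis using AB[of z] by linarith
  qed
  then show thesis by (rule that[rotated 2]) auto
qed

section \<open>The two implications\<close>

text \<open>The asymptotics are established for g = f / z^(m 0), with g 0 \<noteq> 0, and
  transferred back. Both (ii) and (iii) follow from the convergence of n(0, t) / t, and (iv) holds
  with I x = ln |f x| - ln |f b|.\<close>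

lemma cartwright_forward:
  assumes nl: "no_finite_limit_points m" and f: "f holomorphic_on UNIV" and zs: "is_zero_set m f" and et: "exponential_type f"
    and int: "(\<integral>\<^sup>+ x. ennreal (max 0 (ln (cmod (f (of_real x)))) / (1 + x\<^sup>2)) \<partial>lborel) < \<infinity>"
  shows "\<exists>L. ((\<lambda>R::real. \<Sum>z\<in>{z. m z \<noteq> 0 \<and> 0 < cmod z \<and> cmod z < R}. of_nat (m z) / z) \<longlongrightarrow> L) at_top"
    and "(\<lambda>t. real (ncount m 0 t)) \<in> O(\<lambda>t. t)"
    and "(\<lambda>t. real (ncount m 0 (t + 1)) - real (ncount m 0 t)) \<in> o(\<lambda>t. t)"
    and "\<exists>b::real. m (of_real b) = 0 \<and>
               (\<exists>I::real \<Rightarrow> real.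
                  (AE x in lborel. ((\<lambda>T. inner_trunc m b x T) \<longlongrightarrow> I x) at_top) \<and>
                  (\<integral>\<^sup>+ x. ennreal (max 0 (I x) / (1 + x\<^sup>2)) \<partial>lborel) < \<infinity>)"
proof -
  define m' where "m' = m(0 := 0)"
  obtain g where g: "g holomorphic_on UNIV" "is_zero_set m' g" "\<And>z. f z = z ^ m 0 * g z"
    using divide_power_is_zero_set[OF f zs] unfolding m'_def by blast
  have nl': "no_finite_limit_points m'" unfolding m'_def by (rule no_finite_limit_points_remove_0[OF nl])
  have fin: "finite (zeros_in m' R)" for R by (rule finite_zeros_in[OF nl'])
  have m'0: "m' 0 = 0" by (simp add: m'_def)
  have g0: "g 0 \<noteq> 0" using is_zero_set_iff(1)[OF g(1,2), of 0] m'0 by simp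
  obtain A B where A: "A \<ge> 1" "B \<ge> 0" "\<And>z. cmod (f z) \<le> A * exp (B * cmod z)" by (rule exponential_type_constants[OF et]) (rule that)
  obtain M where M: "\<And>z. cmod z \<le> 1 \<Longrightarrow> cmod (g z) \<le> M"
  proof -
    have "compact (g ` cball 0 1)"
      by (intro compact_continuous_image holomorphic_on_imp_continuous_on[OF holomorphic_on_subset[OF g(1)]]) auto
    then have "bounded (g ` cball 0 1)" by (rule compact_imp_bounded)
    then obtain M where "\<forall>y\<in>g ` cball 0 1. cmod y \<le> M" unfolding bounded_iff by blast
    then show ?thesis by (intro that[of M]) auto
  qed
  have gf: "cmod (g z) \<le> cmod (f z)" if "cmod z \<ge> 1" for z
  proof -
    have "1 * cmod (g z) \<le> cmod z ^ m 0 * cmod (g z)" using that by (intro mult_right_mono one_le_power) auto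
    then show ?thesis unfolding g(3) norm_mult norm_power by simp
  qed
  \<comment> \<open>Division by z^(m 0) does not increase the modulus for |z| \<ge> 1, and on the
    unit disc g is bounded by \<open>M\<close>.\<close>
  define A' where "A' = max A M"
  have A': "A' \<ge> 1" using A by (simp add: A'_def)
  have gA: "cmod (g z) \<le> A' * exp (B * cmod z)" for z
  proof (cases "cmod z \<ge> 1")
    case True
    have "A * exp (B * cmod z) \<le> A' * exp (B * cmod z)" by (intro mult_right_mono) (auto simp: A'_def)
    then show ?thesis using gf[OF True] A(3)[of z] by linarith
  next
    case False
    have "A' * 1 \<le> A' * exp (B * cmod z)" using A A' by (intro mult_left_mono) auto
    moreover have "cmod (g z) \<le> A'" using M[of z] False by (simp add: A'_def)
    ultimately show ?thesis by linarith
  qed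
  have contg: "continuous_on UNIV (\<lambda>t. g (of_real t))" and contf: "continuous_on UNIV (\<lambda>t. f (of_real t))"
    by (auto intro!: continuous_on_compose2[OF holomorphic_on_imp_continuous_on[OF g(1)]] continuous_on_compose2[OF holomorphic_on_imp_continuous_on[OF f]] continuous_intros)
  note [measurable] = borel_measurable_continuous_onI[OF contg] borel_measurable_continuous_onI[OF contf]
  have intg: "integrable lborel (\<lambda>t. ln (max 1 (cmod (g (of_real t)))) / (1 + t\<^sup>2))"
  proof (rule integrableI_bounded)
    have d: "(1 + t\<^sup>2 :: real) > 0" for t by (simp add: add_pos_nonneg)
    have le: "ln (max 1 (cmod (g (of_real t)))) \<le> max 0 (ln (cmod (f (of_real t)))) + ln (max 1 M)" for t :: real
    proof (cases "\<bar>t\<bar> \<ge> 1")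
      case True
      then have "cmod (g (of_real t)) \<le> cmod (f (of_real t))" by (intro gf) simp
      then have "ln (max 1 (cmod (g (of_real t)))) \<le> ln (max 1 (cmod (f (of_real t))))" by (subst ln_le_cancel_iff) auto
      also have "\<dots> \<le> max 0 (ln (cmod (f (of_real t))))" by (auto simp: max_def)
      finally show ?thesis by (simp add: add_increasing2)
    next
      case False
      then have "cmod (g (of_real t)) \<le> M" by (intro M) simp
      then have "ln (max 1 (cmod (g (of_real t)))) \<le> ln (max 1 M)" by (subst ln_le_cancel_iff) auto
      then show ?thesis by linarith
    qed
    have "(\<integral>\<^sup>+t. ennreal (norm (ln (max 1 (cmod (g (of_real t)))) / (1 + t\<^sup>2))) \<partial>lborel)
       \<le> (\<integral>\<^sup>+t. ennreal (max 0 (ln (cmod (f (of_real t)))) / (1 + t\<^sup>2)) + ennreal (ln (max 1 M) / (1 + t\<^sup>2)) \<partial>lborel)"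
    proof (rule nn_integral_mono)
      fix t :: real
      have "norm (ln (max 1 (cmod (g (of_real t)))) / (1 + t\<^sup>2)) = ln (max 1 (cmod (g (of_real t)))) / (1 + t\<^sup>2)"
        using d[of t] by simp
      also have "\<dots> \<le> max 0 (ln (cmod (f (of_real t)))) / (1 + t\<^sup>2) + ln (max 1 M) / (1 + t\<^sup>2)"
        unfolding add_divide_distrib[symmetric] using le[of t] d[of t] by (intro divide_right_mono) auto
      finally have "ennreal (norm (ln (max 1 (cmod (g (of_real t)))) / (1 + t\<^sup>2))) \<le> ennreal (max 0 (ln (cmod (f (of_real t)))) / (1 + t\<^sup>2) + ln (max 1 M) / (1 + t\<^sup>2))"
        by (rule ennreal_leI)
      also have "\<dots> = ennreal (max 0 (ln (cmod (f (of_real t)))) / (1 + t\<^sup>2)) + ennreal (ln (max 1 M) / (1 + t\<^sup>2))"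
        by (intro ennreal_plus divide_nonneg_pos d) auto
      finally show "ennreal (norm (ln (max 1 (cmod (g (of_real t)))) / (1 + t\<^sup>2))) \<le> ennreal (max 0 (ln (cmod (f (of_real t)))) / (1 + t\<^sup>2)) + ennreal (ln (max 1 M) / (1 + t\<^sup>2))" .
    qed
    also have "\<dots> = (\<integral>\<^sup>+t. ennreal (max 0 (ln (cmod (f (of_real t)))) / (1 + t\<^sup>2)) \<partial>lborel) + (\<integral>\<^sup>+t. ennreal (ln (max 1 M) / (1 + t\<^sup>2)) \<partial>lborel)"
      by (rule nn_integral_add) measurable
    also have "\<dots> < \<infinity>" using int nn_integral_inverse_one_plus_square[of "ln (max 1 M)"] by simp
    finally show "(\<integral>\<^sup>+t. ennreal (norm (ln (max 1 (cmod (g (of_real t)))) / (1 + t\<^sup>2))) \<partial>lborel) < \<infinity>" .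
  qed measurable
  obtain D L where asy: "Re (L + deriv g 0 / g 0) = 0" "((\<lambda>R. zero_count m' R / R) \<longlongrightarrow> D) at_top"
      "(balanced_sum m' \<longlongrightarrow> L) at_top" "(zero_moment m' \<longlongrightarrow> 0) at_top"
    using cartwright_zero_asymptotics[OF g(1) A' A(2) gA intg g(2) g0 fin] by blast
  show "\<exists>L. ((\<lambda>R::real. \<Sum>z\<in>{z. m z \<noteq> 0 \<and> 0 < cmod z \<and> cmod z < R}. of_nat (m z) / z) \<longlongrightarrow> L) at_top"
  \<comment> \<open>The plain sum of 1 / a is \<open>balanced_sum\<close> plus
    \<open>zero_moment\<close>; the summand 0 is the limit of the latter.\<close>
  proof (rule exI[of _ "L + 0"])
    have "(\<Sum>z\<in>{z. m z \<noteq> 0 \<and> 0 < cmod z \<and> cmod z < R}. of_nat (m z) / z) = balanced_sum m' R + zero_moment m' R" for R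
    proof -
      have "(\<Sum>z\<in>{z. m z \<noteq> 0 \<and> 0 < cmod z \<and> cmod z < R}. of_nat (m z) / z) = (\<Sum>z\<in>zeros_in m' R. of_nat (m' z) / z)"
        unfolding m'_def zeros_in_remove_0 by (intro sum.cong) auto
      also have "\<dots> = (\<Sum>z\<in>zeros_in m' R. of_nat (m' z) * (1 / z - cnj z / of_real (R\<^sup>2)) + of_nat (m' z) * cnj z / of_real (R\<^sup>2))"
        by (intro sum.cong refl) (simp add: algebra_simps)
      also have "\<dots> = balanced_sum m' R + zero_moment m' R"
        unfolding balanced_sum_def zero_moment_def sum_divide_distrib by (rule sum.distrib)
      finally show ?thesis .
    qed
    then show "((\<lambda>R::real. \<Sum>z\<in>{z. m z \<noteq> 0 \<and> 0 < cmod z \<and> cmod z < R}. of_nat (m z) / z) \<longlongrightarrow> L + 0) at_top"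
      using tendsto_add[OF asy(3,4)] by simp
  qed
  have inv: "((\<lambda>R::real. c / R) \<longlongrightarrow> 0) at_top" for c
    by (intro tendsto_divide_0[OF tendsto_const] filterlim_at_top_imp_at_infinity filterlim_ident)
  have sh: "filterlim (\<lambda>t::real. t + 1) at_top at_top"
    using filterlim_tendsto_add_at_top[OF tendsto_const filterlim_ident, of "1::real"] by (simp add: add.commute)
  have nlim: "((\<lambda>t. real (ncount m 0 t) / t) \<longlongrightarrow> D) at_top"
  proof (rule tendsto_sandwich)
    show "((\<lambda>t. real (m 0) / t + zero_count m' t / t) \<longlongrightarrow> D) at_top"
      using tendsto_add[OF inv asy(2), of "real (m 0)"] by simp
    have "((\<lambda>t. real (m 0) / t + zero_count m' (t + 1) / (t + 1) * (1 + 1 / t)) \<longlongrightarrow> 0 + D * (1 + 0)) at_top"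
      by (intro tendsto_intros inv filterlim_compose[OF asy(2) sh])
    moreover have "\<forall>\<^sub>F t in at_top. real (m 0) / t + zero_count m' (t + 1) / (t + 1) * (1 + 1 / t) = (real (m 0) + zero_count m' (t + 1)) / t"
      using eventually_gt_at_top[of 0]
    proof eventually_elim
      case (elim t)
      have h: "1 + 1 / t = (t + 1) / t" "t + 1 \<noteq> 0" using elim by (auto simp: field_simps)
      have "zero_count m' (t + 1) / (t + 1) * (1 + 1 / t) = zero_count m' (t + 1) / t" unfolding h(1) using h(2) by simp
      then show ?case by (simp only: add_divide_distrib)
    qed
    ultimately show "((\<lambda>t. (real (m 0) + zero_count m' (t + 1)) / t) \<longlongrightarrow> D) at_top" by (simp add: tendsto_cong)
    show "\<forall>\<^sub>F t in at_top. real (m 0) / t + zero_count m' t / t \<le> real (ncount m 0 t) / t"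
      using eventually_gt_at_top[of 0]
    proof eventually_elim
      case (elim t)
      then show ?case using ncount_zero_count(1)[OF nl elim] unfolding m'_def
        by (simp add: add_divide_distrib[symmetric] divide_right_mono)
    qed
    show "\<forall>\<^sub>F t in at_top. real (ncount m 0 t) / t \<le> (real (m 0) + zero_count m' (t + 1)) / t"
      using eventually_gt_at_top[of 0]
    proof eventually_elim
      case (elim t)
      then show ?case using ncount_zero_count(2)[OF nl elim] unfolding m'_def by (simp add: divide_right_mono)
    qed
  qed
  have ne: "\<forall>\<^sub>F t::real in at_top. t \<noteq> 0" using eventually_gt_at_top[of 0] by eventually_elim auto
  show "(\<lambda>t. real (ncount m 0 t)) \<in> O(\<lambda>t. t)"
    by (rule bigoI_tendsto[OF nlim ne])
  show iii: "(\<lambda>t. real (ncount m 0 (t + 1)) - real (ncount m 0 t)) \<in> o(\<lambda>t. t)"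
  proof (rule smalloI_tendsto[OF _ ne])
    have "((\<lambda>t. real (ncount m 0 (t + 1)) / (t + 1) * (1 + 1 / t) - real (ncount m 0 t) / t) \<longlongrightarrow> D * (1 + 0) - D) at_top"
      by (intro tendsto_intros inv filterlim_compose[OF nlim sh] nlim)
    moreover have "\<forall>\<^sub>F t in at_top. real (ncount m 0 (t + 1)) / (t + 1) * (1 + 1 / t) - real (ncount m 0 t) / t = (real (ncount m 0 (t + 1)) - real (ncount m 0 t)) / t"
      using eventually_gt_at_top[of 0]
    proof eventually_elim
      case (elim t)
      have h: "1 + 1 / t = (t + 1) / t" "t + 1 \<noteq> 0" using elim by (auto simp: field_simps)
      have "real (ncount m 0 (t + 1)) / (t + 1) * (1 + 1 / t) = real (ncount m 0 (t + 1)) / t" unfolding h(1) using h(2) by simp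
      then show ?case by (simp only: diff_divide_distrib)
    qed
    ultimately show "((\<lambda>t. (real (ncount m 0 (t + 1)) - real (ncount m 0 t)) / t) \<longlongrightarrow> 0) at_top" by (simp add: tendsto_cong)
  qed
  have "countable ({x::real. m (of_real x) \<noteq> 0} \<union> {0})" using real_zeros_countable[OF nl] by simp
  \<comment> \<open>With b \<noteq> 0 the logarithm of |f b| splits into (m 0) ln |b| and ln |g
    b|.\<close>
  then obtain b :: real where b: "m (of_real b) = 0" "b \<noteq> 0"
    using exists_real_not_in_countable[of "{x::real. m (of_real x) \<noteq> 0} \<union> {0}" 0 1] by auto
  have val: "((\<lambda>T. inner_trunc m b x T) \<longlongrightarrow> ln (cmod (f (of_real x))) - ln (cmod (f (of_real b)))) at_top"
    if x: "m (of_real x) = 0" "x \<noteq> 0" for x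
  proof (rule inner_trunc_tendsto[OF nl b(1) x(1) iii])
    have nzg: "g (of_real x) \<noteq> 0" "g (of_real b) \<noteq> 0"
      using is_zero_set_iff(1)[OF g(1,2)] x b by (auto simp: m'_def)
    define \<phi> where "\<phi> a = ln (cmod (of_real x - a)) - ln (cmod (of_real b - a))" for a
    have "((\<lambda>R. \<Sum>a\<in>zeros_in m' R. m' a * \<phi> a) \<longlongrightarrow> ln (cmod (g (of_real x))) - ln (cmod (g (of_real b)))) at_top"
      unfolding \<phi>_def by (rule cartwright_value_limit[OF g(1) A' A(2) gA g(2) g0 fin asy nzg])
    then have "((\<lambda>R. m 0 * \<phi> 0 + (\<Sum>a\<in>zeros_in m' R. m' a * \<phi> a)) \<longlongrightarrow> m 0 * \<phi> 0 + (ln (cmod (g (of_real x))) - ln (cmod (g (of_real b))))) at_top"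
      by (intro tendsto_intros)
    moreover have "\<forall>\<^sub>F R in at_top. m 0 * \<phi> 0 + (\<Sum>a\<in>zeros_in m' R. m' a * \<phi> a) = (\<Sum>a\<in>zeros_in m R. m a * \<phi> a)"
      using eventually_gt_at_top[of 0]
      by eventually_elim (simp only: log_sum_remove_0[OF nl] m'_def)
    ultimately have "((\<lambda>R. \<Sum>a\<in>zeros_in m R. m a * \<phi> a) \<longlongrightarrow> m 0 * \<phi> 0 + (ln (cmod (g (of_real x))) - ln (cmod (g (of_real b))))) at_top"
      by (rule Lim_transform_eventually)
    moreover have "m 0 * \<phi> 0 + (ln (cmod (g (of_real x))) - ln (cmod (g (of_real b)))) = ln (cmod (f (of_real x))) - ln (cmod (f (of_real b)))"
      unfolding g(3) using x b nzg by (simp add: \<phi>_def norm_mult norm_power ln_mult ln_realpow algebra_simps)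
    ultimately show "((\<lambda>R. \<Sum>a\<in>zeros_in m R. m a * (ln (cmod (of_real x - a)) - ln (cmod (of_real b - a)))) \<longlongrightarrow> ln (cmod (f (of_real x))) - ln (cmod (f (of_real b)))) at_top"
      unfolding \<phi>_def by simp
  qed
  show "\<exists>b::real. m (of_real b) = 0 \<and>
               (\<exists>I::real \<Rightarrow> real.
                  (AE x in lborel. ((\<lambda>T. inner_trunc m b x T) \<longlongrightarrow> I x) at_top) \<and>
                  (\<integral>\<^sup>+ x. ennreal (max 0 (I x) / (1 + x\<^sup>2)) \<partial>lborel) < \<infinity>)"
  proof (intro exI conjI)
    show "m (of_real b) = 0" by (rule b)
    show "AE x in lborel. ((\<lambda>T. inner_trunc m b x T) \<longlongrightarrow> ln (cmod (f (of_real x))) - ln (cmod (f (of_real b)))) at_top"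
      using AE_not_real_zero[OF nl] by eventually_elim (rule val, auto)
    show "(\<integral>\<^sup>+ x. ennreal (max 0 (ln (cmod (f (of_real x))) - ln (cmod (f (of_real b)))) / (1 + x\<^sup>2)) \<partial>lborel) < \<infinity>"
      by (rule log_integral_shift[OF int, of "\<lambda>x. ln (cmod (f (of_real x)))" _ "- ln (cmod (f (of_real b)))"]) auto
  qed
qed

text \<open>For almost every x uniqueness of limits forces I x = ln |f x| - ln |f b| for the
  canonical product f, so (iv) bounds log^+ |f| up to a constant.\<close>

lemma cartwright_backward:
  assumes nl: "no_finite_limit_points m"
    and i: "((\<lambda>R::real. \<Sum>z\<in>{z. m z \<noteq> 0 \<and> 0 < cmod z \<and> cmod z < R}. of_nat (m z) / z) \<longlongrightarrow> L) at_top"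
    and ii: "(\<lambda>t. real (ncount m 0 t)) \<in> O(\<lambda>t. t)"
    and iii: "(\<lambda>t. real (ncount m 0 (t + 1)) - real (ncount m 0 t)) \<in> o(\<lambda>t. t)"
    and b: "m (of_real b) = 0" and I: "AE x in lborel. ((\<lambda>T. inner_trunc m b x T) \<longlongrightarrow> I x) at_top"
    and int: "(\<integral>\<^sup>+ x. ennreal (max 0 (I x) / (1 + x\<^sup>2)) \<partial>lborel) < \<infinity>"
  shows "\<exists>f. f holomorphic_on UNIV \<and> is_zero_set m f \<and> exponential_type f \<and>
            (\<integral>\<^sup>+ x. ennreal (max 0 (ln (cmod (f (of_real x)))) / (1 + x\<^sup>2)) \<partial>lborel) < \<infinity>"
proof -
  define m' where "m' = m(0 := 0)"
  have nl': "no_finite_limit_points m'" unfolding m'_def by (rule no_finite_limit_points_remove_0[OF nl])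
  have fin: "finite (zeros_in m' R)" for R by (rule finite_zeros_in[OF nl'])
  have m'0: "m' 0 = 0" by (simp add: m'_def)
  have lim: "((\<lambda>R. \<Sum>a\<in>zeros_in m' R. of_nat (m' a) / a) \<longlongrightarrow> L) at_top"
  proof -
    have "(\<Sum>z\<in>{z. m z \<noteq> 0 \<and> 0 < cmod z \<and> cmod z < R}. of_nat (m z) / z) = (\<Sum>z\<in>zeros_in m' R. of_nat (m' z) / z)" for R
      unfolding m'_def zeros_in_remove_0 by (intro sum.cong) auto
    then show ?thesis using i by simp
  qed
  obtain C where C: "\<And>R. R > 0 \<Longrightarrow> zero_count m' R \<le> C * R"
  proof -
    obtain c where c: "c > 0" "\<forall>\<^sub>F t in at_top. norm (real (ncount m 0 t)) \<le> c * norm t" using landau_o.bigE[OF ii] by blast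
    then obtain t0 where t0: "\<And>t. t \<ge> t0 \<Longrightarrow> real (ncount m 0 t) \<le> c * \<bar>t\<bar>" unfolding eventually_at_top_linorder by auto
    define t1 where "t1 = max t0 1"
    define X where "X = insert 1 (cmod ` zeros_in m' t1)"
    have X: "finite X" "X \<noteq> {}" using fin by (auto simp: X_def)
    \<comment> \<open>(ii) is a statement about large t, whereas the dyadic sums need a linear bound
      for every R > 0. No nonzero zero has modulus below \<rho>, and for \<rho> \<le> R <
      \<open>t1\<close> the count is at most \<open>n1\<close>, hence at most (n1 / \<rho>)
      R.\<close>
    define \<rho> where "\<rho> = Min X"
    have \<rho>: "\<rho> > 0" unfolding \<rho>_def using X zeros_in_pos[OF fin m'0] by (subst Min_gr_iff) (auto simp: X_def)
    define n1 where "n1 = zero_count m' t1"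
    have n1: "n1 \<ge> 0" unfolding n1_def by (rule zero_count_nonneg[OF fin m'0])
    have "zero_count m' R \<le> (c + n1 / \<rho>) * R" if R: "R > 0" for R
    proof (cases "R \<ge> t1")
      case True
      have "zero_count m' R \<le> real (ncount m 0 R)" using ncount_zero_count(1)[OF nl R] by (simp add: m'_def)
      also have "\<dots> \<le> c * R" using t0[of R] True R by (simp add: t1_def)
      also have "\<dots> \<le> (c + n1 / \<rho>) * R" using n1 \<rho> R by (simp add: distrib_right)
      finally show ?thesis .
    next
      case False
      show ?thesis
      proof (cases "R \<ge> \<rho>")
        case True
        have "zero_count m' R \<le> n1" unfolding n1_def using False by (intro zero_count_mono[OF fin m'0]) auto
        also have "\<dots> \<le> n1 / \<rho> * R" using mult_right_mono[OF True n1] \<rho> by (simp add: field_simps)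
        also have "\<dots> \<le> (c + n1 / \<rho>) * R" using c(1) R by (simp add: distrib_right)
        finally show ?thesis .
      next
        case F2: False
        have "zeros_in m' R = {}"
        proof (rule ccontr)
          assume "zeros_in m' R \<noteq> {}"
          then obtain a where a: "a \<in> zeros_in m' R" by blast
          then have "cmod a \<in> X" using zeros_in_mono[OF fin m'0, of R t1] False by (auto simp: X_def)
          then have "\<rho> \<le> cmod a" using X by (simp add: \<rho>_def)
          then show False using a F2 by (simp add: zeros_in_def)
        qed
        then have "zero_count m' R = 0" by (simp add: zero_count_def)
        then show ?thesis using c(1) n1 \<rho> R by simp
      qed
    qed
    then show ?thesis by (rule that)
  qed
  obtain g where g: "g holomorphic_on UNIV" "is_zero_set m' g" "\<exists>A B. \<forall>z. cmod (g z) \<le> A * exp (B * cmod z)"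
    "\<And>x b. m' x = 0 \<Longrightarrow> m' b = 0 \<Longrightarrow> ((\<lambda>R. \<Sum>a\<in>zeros_in m' R. m' a * (ln (cmod (x - a)) - ln (cmod (b - a)))) \<longlongrightarrow> ln (cmod (g x)) - ln (cmod (g b))) at_top"
    using canonical_product[OF fin m'0 _ lim, of C] C that by blast
  define f where "f z = z ^ m 0 * g z" for z
  have f: "f holomorphic_on UNIV" unfolding f_def by (intro holomorphic_intros g)
  have zs: "is_zero_set m f" unfolding f_def by (rule power_mult_is_zero_set[OF g(1)]) (use g(2) in \<open>simp add: m'_def\<close>)
  have et: "exponential_type f"
  proof -
    have "exponential_type g" using g(3) by (simp add: exponential_type_def)
    then obtain A B where A: "A \<ge> 1" "B \<ge> 0" "\<And>z. cmod (g z) \<le> A * exp (B * cmod z)" by (rule exponential_type_constants) (rule that)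
    have "cmod (f z) \<le> (fact (m 0) * A) * exp ((1 + B) * cmod z)" for z
    proof -
      have "cmod z ^ m 0 / fact (m 0) \<le> exp (cmod z)"
      proof -
        have s: "(\<lambda>n. cmod z ^ n /\<^sub>R fact n) sums exp (cmod z)" by (rule exp_converges)
        have "(\<Sum>n\<in>{m 0}. cmod z ^ n /\<^sub>R fact n) \<le> (\<Sum>n. cmod z ^ n /\<^sub>R fact n)"
          by (intro sum_le_suminf[OF sums_summable[OF s]]) auto
        then have "(\<Sum>n\<in>{m 0}. cmod z ^ n /\<^sub>R fact n) \<le> exp (cmod z)"
          using sums_unique[OF s] by simp
        then show ?thesis by (simp add: divide_inverse mult.commute)
      qed
      then have "cmod z ^ m 0 \<le> fact (m 0) * exp (cmod z)" by (simp add: pos_divide_le_eq mult.commute)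
      then have "cmod z ^ m 0 * cmod (g z) \<le> (fact (m 0) * exp (cmod z)) * (A * exp (B * cmod z))"
        by (intro mult_mono A) auto
      also have "\<dots> = (fact (m 0) * A) * exp ((1 + B) * cmod z)" by (simp add: distrib_right exp_add)
      finally show ?thesis by (simp add: f_def norm_mult norm_power)
    qed
    then show ?thesis unfolding exponential_type_def by blast
  qed
  have contf: "continuous_on UNIV (\<lambda>t. f (of_real t))"
    by (auto intro!: continuous_on_compose2[OF holomorphic_on_imp_continuous_on[OF f]] continuous_intros)
  note [measurable] = borel_measurable_continuous_onI[OF contf]
  have val: "((\<lambda>T. inner_trunc m b x T) \<longlongrightarrow> ln (cmod (f (of_real x))) - ln (cmod (f (of_real b)))) at_top"
    if x: "m (of_real x) = 0" "x \<noteq> 0" for x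
  proof (rule inner_trunc_tendsto[OF nl b x(1) iii])
    have mx: "m' (of_real x) = 0" "m' (of_real b) = 0" using x b by (auto simp: m'_def)
    have nzg: "g (of_real x) \<noteq> 0" "g (of_real b) \<noteq> 0"
      using is_zero_set_iff(1)[OF g(1,2)] mx by auto
    define \<phi> where "\<phi> a = ln (cmod (of_real x - a)) - ln (cmod (of_real b - a))" for a
    have "((\<lambda>R. \<Sum>a\<in>zeros_in m' R. m' a * \<phi> a) \<longlongrightarrow> ln (cmod (g (of_real x))) - ln (cmod (g (of_real b)))) at_top"
      unfolding \<phi>_def by (rule g(4)[OF mx])
    then have "((\<lambda>R. m 0 * \<phi> 0 + (\<Sum>a\<in>zeros_in m' R. m' a * \<phi> a)) \<longlongrightarrow> m 0 * \<phi> 0 + (ln (cmod (g (of_real x))) - ln (cmod (g (of_real b))))) at_top"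
      by (intro tendsto_intros)
    moreover have "\<forall>\<^sub>F R in at_top. m 0 * \<phi> 0 + (\<Sum>a\<in>zeros_in m' R. m' a * \<phi> a) = (\<Sum>a\<in>zeros_in m R. m a * \<phi> a)"
      using eventually_gt_at_top[of 0]
      by eventually_elim (simp only: log_sum_remove_0[OF nl] m'_def)
    ultimately have "((\<lambda>R. \<Sum>a\<in>zeros_in m R. m a * \<phi> a) \<longlongrightarrow> m 0 * \<phi> 0 + (ln (cmod (g (of_real x))) - ln (cmod (g (of_real b))))) at_top"
      by (rule Lim_transform_eventually)
    moreover have "m 0 * \<phi> 0 + (ln (cmod (g (of_real x))) - ln (cmod (g (of_real b)))) = ln (cmod (f (of_real x))) - ln (cmod (f (of_real b)))"
    \<comment> \<open>Here b is given and may be 0, but then m 0 = 0 and f = g, so no logarithm of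
      |b| has to be split off.\<close>
    proof (cases "b = 0")
      case True
      then have "m 0 = 0" using b by simp
      then show ?thesis by (simp add: f_def)
    next
      case False
      then show ?thesis using x nzg by (simp add: f_def \<phi>_def norm_mult norm_power ln_mult ln_realpow algebra_simps)
    qed
    ultimately show "((\<lambda>R. \<Sum>a\<in>zeros_in m R. m a * (ln (cmod (of_real x - a)) - ln (cmod (of_real b - a)))) \<longlongrightarrow> ln (cmod (f (of_real x))) - ln (cmod (f (of_real b)))) at_top"
      unfolding \<phi>_def by simp
  qed
  have ae: "AE x in lborel. I x = ln (cmod (f (of_real x))) - ln (cmod (f (of_real b)))"
    using AE_not_real_zero[OF nl] I
  proof eventually_elim
    case (elim x)
    then show ?case using tendsto_unique[OF trivial_limit_at_top_linorder elim(2) val] by simp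
  qed
  have "(\<integral>\<^sup>+ x. ennreal (max 0 (ln (cmod (f (of_real x)))) / (1 + x\<^sup>2)) \<partial>lborel) < \<infinity>"
    by (rule log_integral_shift[OF int _ ae, of _ "ln (cmod (f (of_real b)))"]) auto
  then show ?thesis using f zs et by blast
qed

text \<open>In (iv) the inner integral is the limit of its truncations, required for almost every x.
  At a real zero x the integrand is - m x / t for small t, so the integral would be minus infinity
  with positive part 0; there are only countably many such x.\<close>

theorem theorem1:
  fixes m :: "complex \<Rightarrow> nat"
  assumes "no_finite_limit_points m"
  shows "(\<exists>f. f holomorphic_on UNIV \<and> is_zero_set m f \<and> exponential_type f \<and>
            (\<integral>\<^sup>+ x. ennreal (max 0 (ln (cmod (f (of_real x)))) / (1 + x\<^sup>2)) \<partial>lborel) < \<infinity>)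
     \<longleftrightarrow>
         ((\<exists>L. ((\<lambda>R::real. \<Sum>z\<in>{z. m z \<noteq> 0 \<and> 0 < cmod z \<and> cmod z < R}. of_nat (m z) / z)
                 \<longlongrightarrow> L) at_top)
          \<and> (\<lambda>t. real (ncount m 0 t)) \<in> O(\<lambda>t. t)
          \<and> (\<lambda>t. real (ncount m 0 (t + 1)) - real (ncount m 0 t)) \<in> o(\<lambda>t. t)
          \<and> (\<exists>b::real. m (of_real b) = 0 \<and>
               (\<exists>I::real \<Rightarrow> real.
                  (AE x in lborel. ((\<lambda>T. inner_trunc m b x T) \<longlongrightarrow> I x) at_top) \<and>
                  (\<integral>\<^sup>+ x. ennreal (max 0 (I x) / (1 + x\<^sup>2)) \<partial>lborel) < \<infinity>)))"
    (is "?F \<longleftrightarrow> ?C")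
proof
  assume ?F
  then obtain f where f: "f holomorphic_on UNIV" "is_zero_set m f" "exponential_type f"
    "(\<integral>\<^sup>+ x. ennreal (max 0 (ln (cmod (f (of_real x)))) / (1 + x\<^sup>2)) \<partial>lborel) < \<infinity>" by blast
  show ?C by (intro conjI cartwright_forward[OF assms f])
next
  assume ?C
  then show ?F using cartwright_backward[OF assms] by blast
qed

end
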